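(* Let $\mathsf u_0\in\tilde H^s(\Omega)$ and $\mathsf f\in L^\infty(0,T;L^2(\Omega))$. Let $\mathsf u$ be the weak solution of the fractional heat equation with right-hand side $\mathsf f$ and initial datum $\mathsf u_0$, and let $U^\tau$ be the piecewise constant function $U^\tau(t)=U^k$ for $t\in(t_{k-1},t_k]$, where $\{U^k\}$ solves the semidiscrete scheme. Then $$\|\mathsf u-U^\tau\|_{L^2(0,T;L^2(\Omega))}\le C\tau\left(|\mathsf u_0|_{H^s(\mathbb R^n)}+\|\mathsf f\|_{L^\infty(0,T;L^2(\Omega))}\right),$$ with $C$ independent of the data, $\mathsf u$, $U^\tau$ and $\tau$.
   Context: $\Omega\subset\mathbb R^n$ bounded Lipschitz, $s\in(0,1)$, $T>0$. $\tilde H^s(\Omega)$ is the closure of $C_0^\infty(\Omega)$ in $H^s(\mathbb R^n)$, $H^{-s}(\Omega)$ its dual; $|\cdot|_{H^s(\mathbb R^n)}$ the Gagliardo seminorm. $\mathcal A(v,w)=\frac{C(n,s)}{2}\iint\frac{(v(x)-v(y))(w(x)-w(y))}{|x-y|^{n+2s}}dxdy$, $C(n,s)=\frac{2^{2s}s\Gamma(s+n/2)}{\pi^{n/2}\Gamma(1-s)}$. The weak solution is the $\mathsf u\in L^2(0,T;\tilde H^s(\Omega))\cap L^\infty(0,T;L^2(\Omega))$ with $\partial_t\mathsf u\in L^2(0,T;H^{-s}(\Omega))$, $\mathsf u(0)=\mathsf u_0$, and $\langle\partial_t\mathsf u,\phi\rangle+\mathcal A(\mathsf u,\phi)=\langle\mathsf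 f,\phi\rangle$ for all $\phi\in\tilde H^s(\Omega)$, a.e. $t$. $\tau=T/\mathcal K$, $t_k=k\tau$, $\mathfrak d\phi^{k+1}=\tau^{-1}(\phi^{k+1}-\phi^k)$, $\mathsf f^{k+1}=\tau^{-1}\int_{t_k}^{t_{k+1}}\mathsf f\,dt$. Semidiscrete scheme: $U^0=\mathsf u_0$, and for $k=0,\dots,\mathcal K-1$, $U^{k+1}\in\tilde H^s(\Omega)$ with $(\mathfrak dU^{k+1},\phi)_{L^2(\Omega)}+\mathcal A(U^{k+1},\phi)=\langle\mathsf f^{k+1},\phi\rangle$ for all $\phi\in\tilde H^s(\Omega)$. *)

theory Defs
  imports "HOL-Analysis.Analysis" "HOL-Probability.Essential_Supremum"
begin

text \<open>Bounded Lipschitz domain: open, bounded, and near every boundary point the set is,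
  in a suitable orthonormal direction e, the strict epigraph of a Lipschitz function
  defined on the hyperplane orthogonal to e.\<close>
definition lipschitz_domain :: "'a::euclidean_space set \<Rightarrow> bool" where
  "lipschitz_domain \<Omega> \<longleftrightarrow> open \<Omega> \<and> bounded \<Omega> \<and>
     (\<forall>x\<in>frontier \<Omega>. \<exists>e r L g. norm e = 1 \<and> r > 0 \<and>
        L-lipschitz_on {v. v \<bullet> e = 0} g \<and>
        \<Omega> \<inter> ball x r = {y \<in> ball x r. g (y - (y \<bullet> e) *\<^sub>R e) < y \<bullet> e})"

primrec C_k :: "nat \<Rightarrow> ('a::euclidean_space \<Rightarrow> real) \<Rightarrow> bool" where
  "C_k 0 f = continuous_on UNIV f"
| "C_k (Suc k) f = ((\<forall>x. f differentiable (at x)) \<and>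
                     (\<forall>v. C_k k (\<lambda>x. frechet_derivative f (at x) v)))"

definition smooth_fun :: "('a::euclidean_space \<Rightarrow> real) \<Rightarrow> bool" where
  "smooth_fun f \<longleftrightarrow> (\<forall>k. C_k k f)"

definition test_fun :: "'a::euclidean_space set \<Rightarrow> ('a \<Rightarrow> real) \<Rightarrow> bool" where
  "test_fun \<Omega> \<phi> \<longleftrightarrow> smooth_fun \<phi> \<and> compact (closure {x. \<phi> x \<noteq> 0}) \<and>
                        closure {x. \<phi> x \<noteq> 0} \<subseteq> \<Omega>"

definition gagliardo_sq :: "real \<Rightarrow> ('a::euclidean_space \<Rightarrow> real) \<Rightarrow> ennreal" where
  "gagliardo_sq s v = (\<integral>\<^sup>+ p. ennreal ((v (fst p) - v (snd p))^2 /
        norm (fst p - snd p) powr (real DIM('a) + 2 * s)) \<partial>(lborel \<Otimes>\<^sub>M lborel))"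

definition L2_sq :: "('a::euclidean_space \<Rightarrow> real) \<Rightarrow> ennreal" where
  "L2_sq v = (\<integral>\<^sup>+ x. ennreal ((v x)^2) \<partial>lborel)"

definition Hs_norm_sq :: "real \<Rightarrow> ('a::euclidean_space \<Rightarrow> real) \<Rightarrow> ennreal" where
  "Hs_norm_sq s v = L2_sq v + gagliardo_sq s v"

definition tildeH :: "real \<Rightarrow> 'a::euclidean_space set \<Rightarrow> ('a \<Rightarrow> real) set" where
  "tildeH s \<Omega> = {v. v \<in> borel_measurable lborel \<and> Hs_norm_sq s v < \<infinity> \<and>
      (\<exists>\<phi>. (\<forall>k. test_fun \<Omega> (\<phi> k)) \<and>
           (\<lambda>k. Hs_norm_sq s (\<lambda>x. \<phi> k x - v x)) \<longlonglongrightarrow> 0)}"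

definition Cns :: "real \<Rightarrow> real \<Rightarrow> real" where
  "Cns n s = 2 powr (2 * s) * s * Gamma (s + n / 2) / (pi powr (n / 2) * Gamma (1 - s))"

definition bilinA :: "real \<Rightarrow> ('a::euclidean_space \<Rightarrow> real) \<Rightarrow> ('a \<Rightarrow> real) \<Rightarrow> real" where
  "bilinA s v w = Cns (real DIM('a)) s / 2 *
     (\<integral> p. (v (fst p) - v (snd p)) * (w (fst p) - w (snd p)) /
            norm (fst p - snd p) powr (real DIM('a) + 2 * s) \<partial>(lborel \<Otimes>\<^sub>M lborel))"

definition ipO :: "'a::euclidean_space set \<Rightarrow> ('a \<Rightarrow> real) \<Rightarrow> ('a \<Rightarrow> real) \<Rightarrow> real" where
  "ipO \<Omega> v w = (LINT x:\<Omega>|lborel. v x * w x)"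

definition dual_norm_sq :: "real \<Rightarrow> 'a::euclidean_space set \<Rightarrow> (('a \<Rightarrow> real) \<Rightarrow> real) \<Rightarrow> ennreal" where
  "dual_norm_sq s \<Omega> l = (SUP \<phi>\<in>{\<phi> \<in> tildeH s \<Omega>. Hs_norm_sq s \<phi> \<noteq> 0}.
                            ennreal ((l \<phi>)^2) / Hs_norm_sq s \<phi>)"

definition Linf_L2_sq :: "'a::euclidean_space set \<Rightarrow> real \<Rightarrow> (real \<Rightarrow> 'a \<Rightarrow> real) \<Rightarrow> ennreal" where
  "Linf_L2_sq \<Omega> T f = esssup (restrict_space lborel {0<..<T})
                          (\<lambda>t. \<integral>\<^sup>+ x\<in>\<Omega>. ennreal ((f t x)^2) \<partial>lborel)"

definition in_Linf_L2 :: "'a::euclidean_space set \<Rightarrow> real \<Rightarrow> (real \<Rightarrow> 'a \<Rightarrow> real) \<Rightarrow> bool" where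
  "in_Linf_L2 \<Omega> T f \<longleftrightarrow> (\<lambda>p. f (fst p) (snd p)) \<in> borel_measurable (lborel \<Otimes>\<^sub>M lborel) \<and>
                        Linf_L2_sq \<Omega> T f < \<infinity>"

text \<open>Weak solution of the fractional heat equation. The time derivative is a
  (weakly measurable) family w t of bounded linear functionals on tilde H^s(Omega)
  with t \<mapsto> ||w t||_{H^{-s}} in L^2(0,T), and it is the distributional time derivative
  of u. The initial condition u(0)=u0 is the (essential) L^2 limit as t \<rightarrow> 0+.\<close>
definition weak_solution ::
  "real \<Rightarrow> 'a::euclidean_space set \<Rightarrow> real \<Rightarrow> ('a \<Rightarrow> real) \<Rightarrow> (real \<Rightarrow> 'a \<Rightarrow> real)
     \<Rightarrow> (real \<Rightarrow> 'a \<Rightarrow> real) \<Rightarrow> bool" where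
  "weak_solution s \<Omega> T u0 f u \<longleftrightarrow>
     (\<lambda>p. u (fst p) (snd p)) \<in> borel_measurable (lborel \<Otimes>\<^sub>M lborel) \<and>
     (AE t in lborel. t \<in> {0<..<T} \<longrightarrow> u t \<in> tildeH s \<Omega>) \<and>
     (\<integral>\<^sup>+ t\<in>{0<..<T}. Hs_norm_sq s (u t) \<partial>lborel) < \<infinity> \<and>
     Linf_L2_sq \<Omega> T u < \<infinity> \<and>
     (\<forall>\<epsilon>>0. \<exists>\<delta>>0. AE t in lborel. 0 < t \<and> t < \<delta> \<and> t < T \<longrightarrow>
                      L2_sq (\<lambda>x. u t x - u0 x) < ennreal \<epsilon>) \<and>
     (\<exists>w :: real \<Rightarrow> ('a \<Rightarrow> real) \<Rightarrow> real.
        (\<forall>\<phi>\<in>tildeH s \<Omega>. (\<lambda>t. w t \<phi>) \<in> borel_measurable lborel) \<and>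
        (AE t in lborel. t \<in> {0<..<T} \<longrightarrow>
            (\<forall>\<phi>\<in>tildeH s \<Omega>. \<forall>\<psi>\<in>tildeH s \<Omega>. \<forall>a b.
               w t (\<lambda>x. a * \<phi> x + b * \<psi> x) = a * w t \<phi> + b * w t \<psi>) \<and>
            dual_norm_sq s \<Omega> (w t) < \<infinity>) \<and>
        (\<integral>\<^sup>+ t\<in>{0<..<T}. dual_norm_sq s \<Omega> (w t) \<partial>lborel) < \<infinity> \<and>
        (\<forall>\<phi>\<in>tildeH s \<Omega>. \<forall>\<psi>. test_fun {0<..<T} \<psi> \<longrightarrow>
            (LINT t:{0<..<T}|lborel. ipO \<Omega> (u t) \<phi> * deriv \<psi> t) =
            - (LINT t:{0<..<T}|lborel. w t \<phi> * \<psi> t)) \<and>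
        (\<forall>\<phi>\<in>tildeH s \<Omega>. AE t in lborel. t \<in> {0<..<T} \<longrightarrow>
            w t \<phi> + bilinA s (u t) \<phi> = ipO \<Omega> (f t) \<phi>))"

text \<open>Time averages f^{k+1} = tau^{-1} int_{t_k}^{t_{k+1}} f dt (here index k).\<close>
definition f_avg :: "real \<Rightarrow> (real \<Rightarrow> 'a \<Rightarrow> real) \<Rightarrow> nat \<Rightarrow> 'a \<Rightarrow> real" where
  "f_avg \<tau> f k x = (1 / \<tau>) * (LINT t:{real k * \<tau> .. real (Suc k) * \<tau>}|lborel. f t x)"

definition semidiscrete ::
  "real \<Rightarrow> 'a::euclidean_space set \<Rightarrow> real \<Rightarrow> nat \<Rightarrow> ('a \<Rightarrow> real) \<Rightarrow> (real \<Rightarrow> 'a \<Rightarrow> real)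
     \<Rightarrow> (nat \<Rightarrow> 'a \<Rightarrow> real) \<Rightarrow> bool" where
  "semidiscrete s \<Omega> T K u0 f U \<longleftrightarrow>
     (let \<tau> = T / real K in
       (AE x in lborel. U 0 x = u0 x) \<and>
       (\<forall>k<K. U (Suc k) \<in> tildeH s \<Omega> \<and>
          (\<forall>\<phi>\<in>tildeH s \<Omega>.
             ipO \<Omega> (\<lambda>x. (U (Suc k) x - U k x) / \<tau>) \<phi> + bilinA s (U (Suc k)) \<phi>
               = ipO \<Omega> (f_avg \<tau> f k) \<phi>)))"

definition U_tau :: "real \<Rightarrow> (nat \<Rightarrow> 'a \<Rightarrow> real) \<Rightarrow> real \<Rightarrow> 'a \<Rightarrow> real" where
  "U_tau \<tau> U t = U (nat \<lceil>t / \<tau>\<rceil>)"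

definition L2L2_dist_sq :: "'a::euclidean_space set \<Rightarrow> real \<Rightarrow> (real \<Rightarrow> 'a \<Rightarrow> real)
     \<Rightarrow> (real \<Rightarrow> 'a \<Rightarrow> real) \<Rightarrow> ennreal" where
  "L2L2_dist_sq \<Omega> T u v = (\<integral>\<^sup>+ t\<in>{0<..<T}. (\<integral>\<^sup>+ x\<in>\<Omega>. ennreal ((u t x - v t x)^2) \<partial>lborel) \<partial>lborel)"

end

theory Submission
  imports Defs
begin

text \<open>Let \<open>e = U\<^sup>\<tau> - u\<close>. Integrating the weak formulation and the scheme in time and subtracting gives,
  for \<open>t\<close> in the slot \<open>(t_k, t_{k+1}]\<close>, \<open>\<theta> = (t - t_k) / \<tau>\<close> and \<open>d = U_{k+1} - U_k\<close>,
  \<open>(e(t), \<phi>) + \<integral>\<^sub>0\<^sup>t A(e(r), \<phi>) dr = (1 - \<theta>) (d, \<phi>) + O(\<tau>) \<parallel>f\<parallel> \<parallel>\<phi>\<parallel>\<close>,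
  because the averages of \<open>f\<close> match \<open>f\<close> on complete slots. Testing with \<open>\<phi> = e(t)\<close> and integrating
  over \<open>t\<close>, the double time integral of \<open>A(e(r), e(t))\<close> over \<open>r < t\<close> is nonnegative, and
  \<open>\<Sum> \<parallel>d\<parallel>\<^sup>2\<close> is \<open>O(\<tau>)\<close> by the discrete energy estimate. No time regularity of \<open>u\<close> is used.\<close>

section \<open>Smooth bumps and weak derivatives on an interval\<close>

text \<open>Integrating in time before testing replaces the time derivative of the error by the
  error itself. What is left consists of integrals over at most one slot, each with a factor \<tau>,
  and of the jumps: slots of length \<tau> weighted by squared jumps that sum to order \<tau> give
  order \<tau>^2. The obstacle is that the test function \<open>e(t)\<close> varies with
  \<open>t\<close>, whereas the weak formulation is distributional in time, holds for each \<phi>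
  only outside a null set of times depending on \<phi>, and concerns data defined almost everywhere.
  Hence the du Bois-Reymond argument, which yields an integrated identity with the right initial
  value; the separability argument, which yields one null set for all \<phi>; and the replacement of
  the data by representatives without exceptional times. The constant comes out as
  \<open>C^2 = 10 * T + C(n,s)\<close>.\<close>

lemma frechet_derivative_real:
  assumes "(f has_real_derivative D) (at x)"
  shows "frechet_derivative f (at x) v = D * v"
  using frechet_derivative_at[of f "\<lambda>v. D * v" x] assms
  by (metis has_field_derivative_def)

lemma C_k_cmult:
  fixes f :: "'a::euclidean_space \<Rightarrow> real"
  shows "C_k k f \<Longrightarrow> C_k k (\<lambda>x. c * f x)"
proof (induction k arbitrary: f)
  case 0
  then show ?case by (auto intro!: continuous_intros)
next
  case (Suc k)
  have d: "f differentiable (at x)" for x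
    using Suc.prems by simp
  have "frechet_derivative (\<lambda>x. c * f x) (at x) v = c * frechet_derivative f (at x) v" for x v
    using frechet_derivative_at[OF has_derivative_mult_right[OF d[unfolded frechet_derivative_works]]]
    by metis
  then show ?case
    using Suc by (auto intro!: derivative_intros)
qed

text \<open>\<open>C_k\<close> quantifies over all directions \<open>v\<close>. On the line the
  derivative in direction \<open>v\<close> is \<open>v\<close> times the ordinary one, so the single
  function \<open>f'\<close> settles all of them.\<close>

lemma C_k_SucI:
  fixes f :: "real \<Rightarrow> real"
  assumes "\<And>x. (f has_real_derivative f' x) (at x)" and "C_k k f'"
  shows "C_k (Suc k) f"
  using assms(1) C_k_cmult[OF assms(2)] frechet_derivative_real[OF assms(1)]
  by (auto simp: real_differentiable_def mult.commute)

lemma C_k_add: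
  fixes f g :: "'a::euclidean_space \<Rightarrow> real"
  shows "C_k k f \<Longrightarrow> C_k k g \<Longrightarrow> C_k k (\<lambda>x. f x + g x)"
proof (induction k arbitrary: f g)
  case 0
  then show ?case by (auto intro!: continuous_intros)
next
  case (Suc k)
  have d: "f differentiable (at x)" "g differentiable (at x)" for x
    using Suc.prems by simp_all
  have "frechet_derivative (\<lambda>x. f x + g x) (at x) v
      = frechet_derivative f (at x) v + frechet_derivative g (at x) v" for x v
    using frechet_derivative_at[OF has_derivative_add[OF d(1)[unfolded frechet_derivative_works]
          d(2)[unfolded frechet_derivative_works]]]
    by metis
  then show ?case
    using Suc by (auto intro!: derivative_intros)
qed

lemma C_k_Suc_imp:
  fixes f :: "'a::euclidean_space \<Rightarrow> real"
  shows "C_k (Suc k) f \<Longrightarrow> C_k k f"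
proof (induction k arbitrary: f)
  case 0
  then show ?case
    by (auto intro!: continuous_at_imp_continuous_on differentiable_imp_continuous_within)
qed auto

lemma C_k_mult:
  fixes f g :: "'a::euclidean_space \<Rightarrow> real"
  shows "C_k k f \<Longrightarrow> C_k k g \<Longrightarrow> C_k k (\<lambda>x. f x * g x)"
proof (induction k arbitrary: f g)
  case 0
  then show ?case by (auto intro!: continuous_intros)
next
  case (Suc k)
  have d: "f differentiable (at x)" "g differentiable (at x)" for x
    using Suc.prems by simp_all
  have "frechet_derivative (\<lambda>x. f x * g x) (at x) v
      = f x * frechet_derivative g (at x) v + frechet_derivative f (at x) v * g x" for x v
    using frechet_derivative_at[OF has_derivative_mult[OF d(1)[unfolded frechet_derivative_works]
          d(2)[unfolded frechet_derivative_works]]]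
    by metis
  moreover have "C_k k f" "C_k k g"
    using Suc.prems C_k_Suc_imp by blast+
  ultimately show ?case
    using Suc by (auto intro!: derivative_intros C_k_add)
qed

lemma smooth_funI_real:
  fixes f :: "real \<Rightarrow> real"
  assumes "\<And>x. (f has_real_derivative f' x) (at x)" and "smooth_fun f'"
  shows "smooth_fun f"
  unfolding smooth_fun_def
proof
  fix k
  show "C_k k f"
    by (rule C_k_Suc_imp, rule C_k_SucI[OF assms(1)]) (use assms(2) in \<open>simp add: smooth_fun_def\<close>)
qed

text \<open>All members of a sequence closed under differentiation are treated at once, because the
  induction on \<open>k\<close> passes from \<open>F n\<close> to \<open>F (Suc n)\<close>.\<close>

lemma C_k_derivative_sequence:
  fixes F :: "nat \<Rightarrow> real \<Rightarrow> real"
  assumes "\<And>n x. (F n has_real_derivative F (Suc n) x) (at x)"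
  shows "C_k k (F n)"
proof (induction k arbitrary: n)
  case 0
  show ?case
    using assms by (auto intro!: continuous_at_imp_continuous_on DERIV_isCont)
next
  case (Suc k)
  show ?case
    by (rule C_k_SucI[OF assms Suc])
qed

section \<open>Flat exponentials and smooth interval bumps\<close>

definition exp_bump :: "real \<Rightarrow> real" where
  "exp_bump x = (if x > 0 then exp (- (1 / x)) else 0)"

text \<open>With \<open>y = 1 / x\<close> one has \<open>d/dx = - y^2 d/dy\<close>, so
  differentiating \<open>p(y) exp(-y)\<close> gives \<open>y^2 (p(y) - p'(y)) exp(-y)\<close>; this
  is the recursion.\<close>

primrec exp_bump_poly :: "nat \<Rightarrow> real poly" where
  "exp_bump_poly 0 = 1"
| "exp_bump_poly (Suc n) = [:0, 0, 1:] * (exp_bump_poly n - pderiv (exp_bump_poly n))"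

definition exp_bump_deriv :: "nat \<Rightarrow> real \<Rightarrow> real" where
  "exp_bump_deriv n x = (if x > 0 then poly (exp_bump_poly n) (1 / x) * exp (- (1 / x)) else 0)"

lemma poly_exp_tendsto_0:
  fixes p :: "real poly"
  shows "((\<lambda>x. poly p x * exp (- x)) \<longlongrightarrow> 0) at_top"
proof -
  have *: "((\<lambda>x::real. x ^ i * exp (- x)) \<longlongrightarrow> 0) at_top" for i :: nat
    using tendsto_power_div_exp_0[of i] by (simp add: exp_minus divide_inverse)
  have "((\<lambda>x. \<Sum>i\<le>degree q. coeff q i * (x ^ i * exp (- x))) \<longlongrightarrow> (\<Sum>i\<le>degree q. coeff q i * 0)) at_top"
    for q :: "real poly"
    by (intro tendsto_intros *)
  from this[of p] show ?thesis
    by (simp add: poly_altdef sum_distrib_right mult.assoc)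
qed

lemma exp_bump_deriv_has_derivative:
  "(exp_bump_deriv n has_real_derivative exp_bump_deriv (Suc n) x) (at x)"
proof -
  consider "x > 0" | "x < 0" | "x = 0" by linarith
  then show ?thesis
  proof cases
    case 1
    have "((\<lambda>x. poly (exp_bump_poly n) (1 / x) * exp (- (1 / x))) has_real_derivative
        exp_bump_deriv (Suc n) x) (at x)"
      using 1
      by (auto intro!: derivative_eq_intros DERIV_chain'[OF _ poly_DERIV]
          simp: exp_bump_deriv_def divide_simps power2_eq_square algebra_simps)
    then show ?thesis
      by (rule has_field_derivative_transform_within_open[where S="{0<..}"])
        (use 1 in \<open>auto simp: exp_bump_deriv_def\<close>)
  next
    case 2
    have "((\<lambda>x. 0) has_real_derivative exp_bump_deriv (Suc n) x) (at x)"
      using 2 by (auto simp: exp_bump_deriv_def)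
    then show ?thesis
      by (rule has_field_derivative_transform_within_open[where S="{..<0}"])
        (use 2 in \<open>auto simp: exp_bump_deriv_def\<close>)
  next
    case 3
    have "((\<lambda>y. exp_bump_deriv n y / y) \<longlongrightarrow> 0) (at_left 0)"
      by (rule tendsto_eventually) (auto simp: eventually_at_filter exp_bump_deriv_def)
    moreover have "((\<lambda>y. exp_bump_deriv n y / y) \<longlongrightarrow> 0) (at_right 0)"
    proof -
      \<comment> \<open>Dividing by \<open>y\<close> raises the degree of the polynomial in
        \<open>1 / y\<close> by one, hence \<open>pCons 0\<close>; the exponential still
        wins.\<close>
      have "((\<lambda>y. poly (pCons 0 (exp_bump_poly n)) (inverse y) * exp (- inverse y)) \<longlongrightarrow> 0) (at_right (0::real))"
        by (rule filterlim_compose[OF poly_exp_tendsto_0 filterlim_inverse_at_top_right])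
      then show ?thesis
        by (rule Lim_transform_eventually)
          (auto simp: eventually_at_filter exp_bump_deriv_def field_simps)
    qed
    ultimately have "((\<lambda>y. exp_bump_deriv n y / y) \<longlongrightarrow> 0) (at 0)"
      by (simp add: filterlim_split_at)
    then show ?thesis
      using 3 by (simp add: has_field_derivative_iff exp_bump_deriv_def)
  qed
qed

lemma exp_bump_comp_smooth: "smooth_fun (\<lambda>t. exp_bump (a * t + b))"
proof -
  have "((\<lambda>t. a ^ n * exp_bump_deriv n (a * t + b)) has_real_derivative
      a ^ Suc n * exp_bump_deriv (Suc n) (a * t + b)) (at t)" for n t
    by (auto intro!: derivative_eq_intros DERIV_chain'[OF _ exp_bump_deriv_has_derivative])
  from C_k_derivative_sequence[of "\<lambda>n t. a ^ n * exp_bump_deriv n (a * t + b)", OF this, of _ 0]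
  show ?thesis
    by (simp add: smooth_fun_def exp_bump_deriv_def exp_bump_def cong: if_cong)
qed

lemma exp_bump_bounds: "0 \<le> exp_bump x" "exp_bump x \<le> 1" "exp_bump x \<noteq> 0 \<longleftrightarrow> 0 < x"
  by (auto simp: exp_bump_def)

text \<open>The parameter \<open>m\<close> steepens the flanks: for growing \<open>m\<close> the
  values tend to 1 inside the interval and always stay between 0 and 1. Indicators are thus
  approximated by dominated convergence.\<close>

definition interval_bump :: "real \<Rightarrow> real \<Rightarrow> real \<Rightarrow> real \<Rightarrow> real" where
  "interval_bump m a b t = exp_bump (m * (t - a)) * exp_bump (m * (b - t))"

lemma interval_bump_smooth: "smooth_fun (interval_bump m a b)"
  using exp_bump_comp_smooth[of m "- m * a"] exp_bump_comp_smooth[of "- m" "m * b"]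
  by (auto simp: smooth_fun_def interval_bump_def [abs_def] algebra_simps intro!: C_k_mult)

lemma interval_bump_bounds:
  "0 \<le> interval_bump m a b t" "interval_bump m a b t \<le> 1"
  by (simp_all add: interval_bump_def exp_bump_bounds mult_le_one)

lemma interval_bump_nonzero_iff:
  "m > 0 \<Longrightarrow> interval_bump m a b t \<noteq> 0 \<longleftrightarrow> a < t \<and> t < b"
  by (simp add: interval_bump_def exp_bump_bounds(3) zero_less_mult_iff)

lemma interval_bump_continuous: "continuous_on S (interval_bump m a b)"
  using interval_bump_smooth[of m a b] unfolding smooth_fun_def
  by (metis C_k.simps(1) continuous_on_subset subset_UNIV)


section \<open>The du Bois-Reymond lemma with an initial value\<close>

lemma antiderivative_real:
  fixes f :: "real \<Rightarrow> real"
  assumes "continuous_on UNIV f"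
  shows "((\<lambda>t. LBINT x=0..t. f x) has_real_derivative f t) (at t)"
proof -
  define N where "N = \<bar>t\<bar> + 1"
  have "((\<lambda>u. LBINT y=ereal 0..u. f y) has_vector_derivative f t) (at t within {- N..N})"
    by (rule interval_integral_FTC2) (auto simp: N_def intro: continuous_on_subset[OF assms])
  moreover have "at t within {-N..N} = at t"
    by (rule at_within_interior) (auto simp: N_def)
  ultimately show ?thesis
    by (simp add: has_real_derivative_iff_has_vector_derivative zero_ereal_def)
qed

text \<open>The primitive from 0 vanishes to the left of \<open>lo\<close> and is constant to the
  right of \<open>hi\<close>; zero mean makes that constant 0. So zero-mean functions may be used as
  \<psi>' in a weak derivative.\<close>

lemma zero_mean_primitive_test_fun:
  fixes \<eta> :: "real \<Rightarrow> real"
  assumes smooth: "smooth_fun \<eta>" and supp: "\<And>t. \<eta> t \<noteq> 0 \<Longrightarrow> lo < t \<and> t < hi"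
    and mean: "(LINT t|lborel. \<eta> t) = 0" and bnds: "0 < lo" "lo < hi" "hi < T"
  shows "\<exists>\<psi>. test_fun {0<..<T} \<psi> \<and> (\<forall>t. deriv \<psi> t = \<eta> t)"
proof -
  define \<psi> where "\<psi> = (\<lambda>t::real. LBINT x=0..t. \<eta> x)"
  have cont: "continuous_on UNIV \<eta>"
    using smooth unfolding smooth_fun_def by (metis C_k.simps(1))
  have der: "(\<psi> has_real_derivative \<eta> t) (at t)" for t
    unfolding \<psi>_def by (rule antiderivative_real[OF cont])
  have "\<psi> t = 0" if "t \<le> lo" for t
  proof (cases "0 \<le> t")
    case True
    have z: "indicator (einterval 0 (ereal t)) x * \<eta> x = 0" for x
      using supp[of x] that by (cases "\<eta> x = 0") (auto simp: indicator_def einterval_def zero_ereal_def)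
    then show ?thesis
      using True unfolding \<psi>_def
      by (simp add: interval_lebesgue_integral_def set_lebesgue_integral_def z)
  next
    case False
    have z: "indicator (einterval (ereal t) 0) x * \<eta> x = 0" for x
      using supp[of x] that bnds by (cases "\<eta> x = 0") (auto simp: indicator_def einterval_def zero_ereal_def)
    then show ?thesis
      using False unfolding \<psi>_def
      by (simp add: interval_lebesgue_integral_def set_lebesgue_integral_def z)
  qed
  moreover have "\<psi> t = 0" if "hi \<le> t" for t
  proof -
    have z: "indicator (einterval 0 (ereal t)) x * \<eta> x = \<eta> x" for x
      using supp[of x] that bnds by (cases "\<eta> x = 0") (auto simp: indicator_def einterval_def zero_ereal_def)
    then show ?thesis
      using that bnds mean unfolding \<psi>_def
      by (simp add: interval_lebesgue_integral_def set_lebesgue_integral_def z)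
  qed
  ultimately have "{t. \<psi> t \<noteq> 0} \<subseteq> {lo..hi}"
    by (force simp: not_less [symmetric])
  then have cl: "closure {t. \<psi> t \<noteq> 0} \<subseteq> {lo..hi}"
    by (rule closure_minimal) simp
  then have "compact (closure {t. \<psi> t \<noteq> 0})"
    by (metis closed_closure compact_Icc compact_Int_closed inf.absorb_iff2)
  with cl bnds have "test_fun {0<..<T} \<psi>"
    unfolding test_fun_def by (auto intro: smooth_funI_real[OF der smooth])
  then show ?thesis
    using DERIV_imp_deriv[OF der] by auto
qed

lemma interval_bump_integrable: "m > 0 \<Longrightarrow> integrable lborel (interval_bump m a b)"
proof -
  assume "m > 0"
  have "set_integrable lborel {a..b} (interval_bump m a b)"
    by (rule borel_integrable_atLeastAtMost')(rule interval_bump_continuous)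
  moreover have "indicator {a..b} t *\<^sub>R interval_bump m a b t = interval_bump m a b t" for t
    using interval_bump_nonzero_iff[OF \<open>m > 0\<close>, of a b t] by (auto simp: indicator_def)
  ultimately show ?thesis
    by (simp only: set_integrable_def)
qed

lemma interval_bump_integral_pos:
  assumes "m > 0" "a < b"
  shows "0 < (LINT t|lborel. interval_bump m a b t)"
proof -
  have "\<not> (AE t in lborel. interval_bump m a b t = 0)"
  proof
    assume "AE t in lborel. interval_bump m a b t = 0"
    then have "AE t in lborel. t \<notin> {a<..<b}"
      by (rule AE_mp) (auto intro!: AE_I2 simp: interval_bump_nonzero_iff[OF assms(1), symmetric])
    then have "{a<..<b} \<in> null_sets lborel"
      by (subst AE_iff_null_sets) auto
    then have "emeasure lborel {a<..<b} = 0"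
      by (rule null_setsD1)
    then show False
      using assms by simp
  qed
  then have "(LINT t|lborel. interval_bump m a b t) \<noteq> 0"
    using integral_nonneg_eq_0_iff_AE[OF interval_bump_integrable[OF assms(1)]] interval_bump_bounds
    by auto
  moreover have "0 \<le> (LINT t|lborel. interval_bump m a b t)"
    by (rule integral_nonneg_AE) (simp add: interval_bump_bounds)
  ultimately show ?thesis by simp
qed

lemma interval_bump_measurable [measurable]: "interval_bump m a b \<in> borel_measurable borel"
  by (intro borel_measurable_continuous_onI interval_bump_continuous)

lemma interval_bump_mult_integrable:
  fixes G :: "real \<Rightarrow> real"
  assumes "set_integrable lborel A G"
  shows "set_integrable lborel A (\<lambda>t. G t * interval_bump m a b t)"
  unfolding set_integrable_def
proof (rule Bochner_Integration.integrable_bound)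
  show "integrable lborel (\<lambda>t. indicator A t *\<^sub>R G t)"
    using assms by (simp add: set_integrable_def)
  have "(\<lambda>t. (indicator A t *\<^sub>R G t) * interval_bump m a b t) \<in> borel_measurable lborel"
    using assms unfolding set_integrable_def by (intro borel_measurable_times) auto
  then show "(\<lambda>t. indicator A t *\<^sub>R (G t * interval_bump m a b t)) \<in> borel_measurable lborel"
    by (simp add: mult.assoc)
  show "AE t in lborel. norm (indicator A t *\<^sub>R (G t * interval_bump m a b t)) \<le> norm (indicator A t *\<^sub>R G t)"
    by (auto intro!: AE_I2 mult_left_mono mult_left_le simp: abs_mult interval_bump_bounds)
qed

text \<open>The interval is shrunk by \<open>1 / (k + 1)\<close> so that, for
  \<open>a \<ge> 0\<close> and \<open>b = T\<close>, the supports stay strictly inside (0, T). The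
  slope outgrows the shrinking: \<open>(k+1)^2 (d - 1/(k+1)) = (k+1) ((k+1) d - 1)\<close> tends to
  infinity for \<open>d > 0\<close>, and is never positive for \<open>d \<le> 0\<close>.\<close>

lemma interval_bump_tendsto:
  assumes "0 \<le> a"
  shows "(\<lambda>k. interval_bump ((real k + 1)^2) (a + 1 / (real k + 1)) (b - 1 / (real k + 1)) t)
    \<longlonglongrightarrow> indicator {a<..<b} t"
proof -
  have *: "(\<lambda>k. exp_bump ((real k + 1)^2 * (d - 1 / (real k + 1)))) \<longlonglongrightarrow> (if d > 0 then 1 else 0)" for d
  proof (cases "d > 0")
    case True
    have lim: "filterlim (\<lambda>k. (real k + 1) * ((real k + 1) * d - 1)) at_top sequentially"
      using True by real_asymp
    have "((\<lambda>x. exp (- (1 / x))) \<longlongrightarrow> 1) (at_top :: real filter)"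
      by real_asymp
    then have "(exp_bump \<longlongrightarrow> 1) at_top"
      by (rule Lim_transform_eventually)
        (use eventually_gt_at_top[of 0] in \<open>auto elim!: eventually_mono simp: exp_bump_def\<close>)
    note filterlim_compose[OF this lim]
    moreover have "(real k + 1) * ((real k + 1) * d - 1) = (real k + 1)^2 * (d - 1 / (real k + 1))" for k
      by (simp add: power2_eq_square field_simps)
    ultimately show ?thesis
      using True by simp
  next
    case False
    have "(real k + 1)^2 * (d - 1 / (real k + 1)) \<le> 0" for k
      using False by (intro mult_nonneg_nonpos) (auto intro: order.trans[of _ 0])
    then have "exp_bump ((real k + 1)^2 * (d - 1 / (real k + 1))) = 0" for k
      unfolding exp_bump_def using not_less by auto
    then show ?thesis using False by simp
  qed
  have "indicator {a<..<b} t = (if t - a > 0 then 1 else 0) * (if b - t > 0 then 1 else (0::real))"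
    by (auto simp: indicator_def)
  then show ?thesis
    using tendsto_mult[OF *[of "t - a"] *[of "b - t"]]
    by (simp add: interval_bump_def algebra_simps)
qed

text \<open>The positive and the negative part of \<open>H\<close> are densities of two measures
  with equal finite values on all rays. Rays determine the measures, and densities are unique almost
  everywhere.\<close>

lemma AE_zero_if_interval_integrals_zero:
  fixes H :: "real \<Rightarrow> real"
  assumes int: "integrable lborel H" and zero: "\<And>x. (LINT t:{x<..}|lborel. H t) = 0"
  shows "AE t in lborel. H t = 0"
proof -
  have m [measurable]: "H \<in> borel_measurable borel"
    using int by auto
  have si: "set_integrable lborel {x<..} H" for x
    by (rule set_integrable_subset[where A=UNIV]) (use int in \<open>auto simp: set_integrable_def\<close>)
  have pos: "integrable lborel (\<lambda>t. max 0 (H t) * indicator {x<..} t)"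
    and neg: "integrable lborel (\<lambda>t. max 0 (- H t) * indicator {x<..} t)" for x
    using si[of x] unfolding set_integrable_def
    by (auto intro!: Bochner_Integration.integrable_bound[OF si[unfolded set_integrable_def]] AE_I2
        simp: indicator_def split: split_max)
  have e1: "emeasure (density lborel (\<lambda>t. ennreal (max 0 (K t)))) {x<..}
      = ennreal (LINT t|lborel. max 0 (K t) * indicator {x<..} t)"
    if "K \<in> borel_measurable borel" "integrable lborel (\<lambda>t. max 0 (K t) * indicator {x<..} t)"
    for K :: "real \<Rightarrow> real" and x
  proof -
    have "emeasure (density lborel (\<lambda>t. ennreal (max 0 (K t)))) {x<..}
      = (\<integral>\<^sup>+ t. ennreal (max 0 (K t) * indicator {x<..} t) \<partial>lborel)"
      using that(1) by (subst emeasure_density) (auto intro!: nn_integral_cong simp: indicator_def)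
    then show ?thesis
      by (subst (asm) nn_integral_eq_integral[OF that(2)]) auto
  qed
  have eq: "(LINT t|lborel. max 0 (H t) * indicator {x<..} t) = (LINT t|lborel. max 0 (- H t) * indicator {x<..} t)" for x
  proof -
    have "(LINT t|lborel. max 0 (H t) * indicator {x<..} t) - (LINT t|lborel. max 0 (- H t) * indicator {x<..} t)
      = (LINT t:{x<..}|lborel. H t)"
      unfolding set_lebesgue_integral_def Bochner_Integration.integral_diff[OF pos neg, symmetric]
      by (rule Bochner_Integration.integral_cong) (auto simp: indicator_def)
    with zero show ?thesis by simp
  qed
  have "density lborel (\<lambda>t. ennreal (max 0 (H t))) = density lborel (\<lambda>t. ennreal (max 0 (- H t)))"
    by (rule measure_eqI_lessThan) (auto simp: e1 pos neg eq)
  then have "AE t in lborel. ennreal (max 0 (H t)) = ennreal (max 0 (- H t))"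
    by (subst (asm) sigma_finite_measure.density_unique_iff[OF lborel.sigma_finite_measure_axioms]) auto
  then show ?thesis
    by (rule AE_mp) (auto intro!: AE_I2 split: split_max simp: max_def split: if_splits)
qed

text \<open>Rather than obtaining some constant and identifying it afterwards, the mass of an
  arbitrary bump is compensated by a bump close to 0, where \<open>G\<close> is already within
  \<epsilon> of \<open>c\<close>. This shows directly that \<open>G - c\<close> annihilates all
  bumps.\<close>

lemma weak_derivative_zero_imp_const:
  fixes G :: "real \<Rightarrow> real"
  assumes "0 < T" and int: "set_integrable lborel {0<..<T} G"
    and weak: "\<And>\<psi>. test_fun {0<..<T} \<psi> \<Longrightarrow> (LINT t:{0<..<T}|lborel. G t * deriv \<psi> t) = 0"
    and init: "\<And>\<epsilon>. \<epsilon> > 0 \<Longrightarrow> \<exists>\<delta>>0. AE t in lborel. 0 < t \<and> t < \<delta> \<and> t < T \<longrightarrow> \<bar>G t - c\<bar> \<le> \<epsilon>"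
  shows "AE t in lborel. t \<in> {0<..<T} \<longrightarrow> G t = c"
proof -
  define H where "H = (\<lambda>t. indicator {0<..<T} t * (G t - c))"
  have Hint: "integrable lborel H"
  proof -
    have "set_integrable lborel {0<..<T} (\<lambda>_. c)"
      unfolding set_integrable_def using \<open>0 < T\<close>
      by (intro integrable_scaleR_left integrable_real_indicator) auto
    from set_integral_diff(1)[OF int this] show ?thesis
      by (simp add: H_def set_integrable_def)
  qed
  have bi: "integrable lborel (\<lambda>t. H t * interval_bump m a b t)" for m a b
    using interval_bump_mult_integrable[of UNIV H] Hint by (simp add: set_integrable_def)
  have bump: "(LINT t|lborel. H t * interval_bump m a b t) = 0" if ab: "0 < a" "a < b" "b < T" "m > 0" for m a b
  proof -
    define I where "I = (LINT t|lborel. interval_bump m a b t)"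
    have "I \<ge> 0"
      using interval_bump_integral_pos that by (simp add: I_def less_imp_le)
    have "\<bar>LINT t|lborel. H t * interval_bump m a b t\<bar> \<le> \<epsilon> * I" if eps: "\<epsilon> > 0" for \<epsilon>
    proof -
      obtain \<delta> where "\<delta> > 0" and \<delta>: "AE t in lborel. 0 < t \<and> t < \<delta> \<and> t < T \<longrightarrow> \<bar>G t - c\<bar> \<le> \<epsilon>"
        using init[OF eps] by blast
      define a' b' where "a' = min \<delta> T / 3" and "b' = min \<delta> T / 2"
      have ab': "0 < a'" "a' < b'" "b' < T" "b' < \<delta>"
        using \<open>\<delta> > 0\<close> \<open>0 < T\<close> by (auto simp: a'_def b'_def min_def)
      define I' where "I' = (LINT t|lborel. interval_bump 1 a' b' t)"
      have "I' > 0"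
        using interval_bump_integral_pos[of 1 a' b'] ab' by (simp add: I'_def)
      \<comment> \<open>The weights \<open>1\<close> and \<open>- I / I'\<close> give zero mean, so
        \<eta> is the derivative of a test function. Hence the integral of \<open>H\<close> against
        the given bump is \<open>I / I'\<close> times the integral against the bump on
        \<open>(a', b')\<close>; that one is at most \<open>\<epsilon> * I'\<close>, since
        \<open>b'\<close> is below \<delta>.\<close>
      define \<eta> where "\<eta> = (\<lambda>t. interval_bump m a b t + (- (I / I')) * interval_bump 1 a' b' t)"
      have "smooth_fun \<eta>"
        using interval_bump_smooth[of m a b] interval_bump_smooth[of 1 a' b'] unfolding smooth_fun_def \<eta>_def
        by (intro allI C_k_add C_k_cmult) auto
      moreover have "min a a' < t \<and> t < max b b'" if "\<eta> t \<noteq> 0" for t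
        using that interval_bump_nonzero_iff[of m a b t] interval_bump_nonzero_iff[of 1 a' b' t] ab
        by (auto simp: \<eta>_def)
      moreover have "(LINT t|lborel. \<eta> t) = 0"
      proof -
        have "(LINT t|lborel. \<eta> t) = I + (- (I / I')) * I'"
          unfolding \<eta>_def I_def I'_def using ab ab'
          by (subst Bochner_Integration.integral_add)
            (auto intro!: interval_bump_integrable integrable_mult_right)
        then show ?thesis using \<open>I' > 0\<close> by simp
      qed
      moreover have "0 < min a a'" "min a a' < max b b'" "max b b' < T"
        using ab ab' by auto
      ultimately have "\<exists>\<psi>. test_fun {0<..<T} \<psi> \<and> (\<forall>t. deriv \<psi> t = \<eta> t)"
        by (rule zero_mean_primitive_test_fun)
      then obtain \<psi> where \<psi>: "test_fun {0<..<T} \<psi>" "\<And>t. deriv \<psi> t = \<eta> t"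
        by auto
      have supp: "indicator {0<..<T} t * \<eta> t = \<eta> t" for t
        using interval_bump_nonzero_iff[of m a b t] interval_bump_nonzero_iff[of 1 a' b' t] ab ab'
        by (auto simp: \<eta>_def indicator_def)
      have "(LINT t|lborel. H t * \<eta> t) = (LINT t:{0<..<T}|lborel. G t * \<eta> t) - (LINT t|lborel. c * \<eta> t)"
      proof -
        have "set_integrable lborel {0<..<T} (\<lambda>t. G t * interval_bump m a b t + (- (I / I')) * (G t * interval_bump 1 a' b' t))"
          by (intro set_integral_add set_integrable_mult_right interval_bump_mult_integrable int)
        then have 1: "integrable lborel (\<lambda>t. indicator {0<..<T} t *\<^sub>R (G t * \<eta> t))"
          by (simp add: set_integrable_def \<eta>_def algebra_simps)
        have 2: "integrable lborel (\<lambda>t. c * \<eta> t)"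
          unfolding \<eta>_def using ab ab' by (intro integrable_mult_right Bochner_Integration.integrable_add interval_bump_integrable) auto
        show ?thesis
          unfolding set_lebesgue_integral_def Bochner_Integration.integral_diff[OF 1 2, symmetric]
        proof (rule Bochner_Integration.integral_cong[OF refl])
          fix t
          have "H t * \<eta> t = indicator {0<..<T} t * (G t * \<eta> t) - c * (indicator {0<..<T} t * \<eta> t)"
            by (simp add: H_def algebra_simps)
          then show "H t * \<eta> t = indicator {0<..<T} t *\<^sub>R (G t * \<eta> t) - c * \<eta> t"
            by (simp add: supp)
        qed
      qed
      also have "\<dots> = 0"
        using weak[OF \<psi>(1)] \<open>(LINT t|lborel. \<eta> t) = 0\<close> by (simp add: \<psi>(2))
      finally have "(LINT t|lborel. H t * \<eta> t) = 0" .
      moreover have "(LINT t|lborel. H t * \<eta> t) = (LINT t|lborel. H t * interval_bump m a b t)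
          + (LINT t|lborel. (- (I / I')) * (H t * interval_bump 1 a' b' t))"
        unfolding Bochner_Integration.integral_add[OF bi integrable_mult_right[OF bi], symmetric]
        by (rule Bochner_Integration.integral_cong) (simp_all add: \<eta>_def algebra_simps)
      ultimately have e: "(LINT t|lborel. H t * interval_bump m a b t)
          = (I / I') * (LINT t|lborel. H t * interval_bump 1 a' b' t)"
        by simp
      have "\<bar>LINT t|lborel. H t * interval_bump 1 a' b' t\<bar> \<le> (LINT t|lborel. \<epsilon> * interval_bump 1 a' b' t)"
      proof -
        have "\<bar>LINT t|lborel. H t * interval_bump 1 a' b' t\<bar> \<le> (LINT t|lborel. \<bar>H t * interval_bump 1 a' b' t\<bar>)"
          by (rule integral_abs_bound)
        also have "\<dots> \<le> (LINT t|lborel. \<epsilon> * interval_bump 1 a' b' t)"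
        proof (rule integral_mono_AE)
          show "integrable lborel (\<lambda>t. \<epsilon> * interval_bump 1 a' b' t)"
            by (intro integrable_mult_right interval_bump_integrable) simp
          show "AE t in lborel. \<bar>H t * interval_bump 1 a' b' t\<bar> \<le> \<epsilon> * interval_bump 1 a' b' t"
            using \<delta>
          proof (rule AE_mp, intro AE_I2 impI)
            fix t assume "0 < t \<and> t < \<delta> \<and> t < T \<longrightarrow> \<bar>G t - c\<bar> \<le> \<epsilon>"
            then have "\<bar>H t\<bar> \<le> \<epsilon> \<or> interval_bump 1 a' b' t = 0"
              using interval_bump_nonzero_iff[of 1 a' b' t] ab' by (auto simp: H_def)
            then show "\<bar>H t * interval_bump 1 a' b' t\<bar> \<le> \<epsilon> * interval_bump 1 a' b' t"
              by (elim disjE) (simp_all add: abs_mult interval_bump_bounds mult_right_mono)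
          qed
        qed (use bi in auto)
        finally show ?thesis .
      qed
      also have "\<dots> = \<epsilon> * I'"
        by (simp add: I'_def)
      finally have "(I / I') * \<bar>LINT t|lborel. H t * interval_bump 1 a' b' t\<bar> \<le> (I / I') * (\<epsilon> * I')"
        using \<open>I \<ge> 0\<close> \<open>I' > 0\<close> by (intro mult_left_mono) auto
      then show ?thesis
        unfolding e using \<open>I \<ge> 0\<close> \<open>I' > 0\<close> by (simp add: abs_mult mult.commute)
    qed
    note bound = this
    have "\<bar>LINT t|lborel. H t * interval_bump m a b t\<bar> \<le> 0"
    proof (rule field_le_epsilon)
      fix e :: real assume "e > 0"
      from bound[of "e / (I + 1)"] have "\<bar>LINT t|lborel. H t * interval_bump m a b t\<bar> \<le> e / (I + 1) * I"
        using \<open>e > 0\<close> \<open>I \<ge> 0\<close> by simp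
      also have "\<dots> \<le> e"
        using \<open>e > 0\<close> \<open>I \<ge> 0\<close> by (simp add: field_simps)
      finally show "\<bar>LINT t|lborel. H t * interval_bump m a b t\<bar> \<le> 0 + e" by simp
    qed
    then show ?thesis by simp
  qed
  have "(LINT t:{x<..}|lborel. H t) = 0" for x
  proof -
    \<comment> \<open>\<open>H\<close> vanishes outside (0, T), so the ray beyond \<open>x\<close>
      only sees the interval from \<open>max x 0\<close> to \<open>T\<close>.\<close>
    define a where "a = max x 0"
    have lim: "(\<lambda>k. LINT t|lborel. H t * interval_bump ((real k + 1)^2) (a + 1 / (real k + 1)) (T - 1 / (real k + 1)) t)
        \<longlonglongrightarrow> (LINT t|lborel. H t * indicator {a<..<T} t)"
    proof (rule integral_dominated_convergence[where w="\<lambda>t. \<bar>H t\<bar>"])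
      show "integrable lborel (\<lambda>t. \<bar>H t\<bar>)" using Hint by simp
      show "AE t in lborel. (\<lambda>k. H t * interval_bump ((real k + 1)^2) (a + 1 / (real k + 1)) (T - 1 / (real k + 1)) t)
          \<longlonglongrightarrow> H t * indicator {a<..<T} t"
        by (intro AE_I2 tendsto_mult_left interval_bump_tendsto) (simp add: a_def)
      show "AE t in lborel. norm (H t * interval_bump ((real k + 1)^2) (a + 1 / (real k + 1)) (T - 1 / (real k + 1)) t) \<le> \<bar>H t\<bar>" for k
        by (intro AE_I2) (auto simp: abs_mult interval_bump_bounds intro!: mult_left_le)
    qed (use Hint in measurable)
    have "(LINT t|lborel. H t * interval_bump ((real k + 1)^2) (a + 1 / (real k + 1)) (T - 1 / (real k + 1)) t) = 0" for k
    proof (cases "a + 1 / (real k + 1) < T - 1 / (real k + 1)")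
      case True
      then show ?thesis
        by (intro bump) (auto simp: a_def intro: add_nonneg_pos)
    next
      case False
      then have "interval_bump ((real k + 1)^2) (a + 1 / (real k + 1)) (T - 1 / (real k + 1)) t = 0" for t
        using interval_bump_nonzero_iff[of "(real k + 1)^2" "a + 1 / (real k + 1)" "T - 1 / (real k + 1)" t]
        by auto
      then show ?thesis by simp
    qed
    with lim have "(LINT t|lborel. H t * indicator {a<..<T} t) = 0"
      by (simp add: LIMSEQ_const_iff)
    moreover have "H t * indicator {a<..<T} t = indicator {x<..} t *\<^sub>R H t" for t
      by (auto simp: a_def H_def indicator_def)
    ultimately show ?thesis
      by (simp add: set_lebesgue_integral_def)
  qed
  from AE_zero_if_interval_integrals_zero[OF Hint this] show ?thesis
    by (rule AE_mp) (auto intro!: AE_I2 simp: H_def)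
qed

section \<open>Square integrable functions\<close>

definition L2 :: "'b measure \<Rightarrow> ('b \<Rightarrow> real) set" where
  "L2 M = {v \<in> borel_measurable M. integrable M (\<lambda>x. (v x)^2)}"

lemma L2_square_integrable: "v \<in> L2 M \<Longrightarrow> integrable M (\<lambda>x. (v x)^2)"
  by (auto simp: L2_def)

lemma abs_mult_le_squares: "\<bar>a * b\<bar> \<le> a^2 + b^2" for a b :: real
proof -
  have "0 \<le> \<bar>a\<bar> * \<bar>b\<bar>" by simp
  moreover have "2 * (\<bar>a\<bar> * \<bar>b\<bar>) \<le> a^2 + b^2"
    using sum_squares_bound[of "\<bar>a\<bar>" "\<bar>b\<bar>"] by (simp add: mult.assoc)
  ultimately show ?thesis by (simp only: abs_mult)
qed

lemma L2_mult_integrable: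
  assumes "v \<in> L2 M" "w \<in> L2 M"
  shows "integrable M (\<lambda>x. v x * w x)"
proof (rule Bochner_Integration.integrable_bound)
  show "integrable M (\<lambda>x. (v x)^2 + (w x)^2)"
    using assms by (simp add: L2_def)
  show "AE x in M. norm (v x * w x) \<le> norm ((v x)^2 + (w x)^2)"
    using abs_mult_le_squares by auto
qed (use assms in \<open>auto simp: L2_def\<close>)

lemma L2_add: "v \<in> L2 M \<Longrightarrow> w \<in> L2 M \<Longrightarrow> (\<lambda>x. v x + w x) \<in> L2 M"
  using L2_mult_integrable[of v M w]
  by (auto simp: L2_def power2_sum mult.assoc)

lemma L2_scale: "v \<in> L2 M \<Longrightarrow> (\<lambda>x. c * v x) \<in> L2 M"
  by (auto simp: L2_def power_mult_distrib)

lemma L2_diff: "v \<in> L2 M \<Longrightarrow> w \<in> L2 M \<Longrightarrow> (\<lambda>x. v x - w x) \<in> L2 M"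
  using L2_add[of v M "\<lambda>x. (-1) * w x"] L2_scale[of w M "-1"] by simp

lemma L2_iff_nn_integral:
  "v \<in> L2 M \<longleftrightarrow> v \<in> borel_measurable M \<and> (\<integral>\<^sup>+x. ennreal ((v x)^2) \<partial>M) < \<infinity>"
  by (auto simp: L2_def integrable_iff_bounded)

lemma L2_nn_integral:
  "v \<in> L2 M \<Longrightarrow> (\<integral>\<^sup>+x. ennreal ((v x)^2) \<partial>M) = ennreal (\<integral>x. (v x)^2 \<partial>M)"
  by (intro nn_integral_eq_integral) (auto simp: L2_def)

lemma L2_integral_diff_square:
  assumes "v \<in> L2 M" "w \<in> L2 M"
  shows "(\<integral>x. (v x - c * w x)^2 \<partial>M)
    = (\<integral>x. (v x)^2 \<partial>M) - 2 * c * (\<integral>x. v x * w x \<partial>M) + c^2 * (\<integral>x. (w x)^2 \<partial>M)"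
proof -
  have "(\<integral>x. (v x - c * w x)^2 \<partial>M) = (\<integral>x. (v x)^2 - (2 * c) * (v x * w x) + c^2 * (w x)^2 \<partial>M)"
    by (rule Bochner_Integration.integral_cong) (auto simp: power2_eq_square algebra_simps)
  then show ?thesis
    using L2_square_integrable[OF assms(1)] L2_square_integrable[OF assms(2)] L2_mult_integrable[OF assms]
    by simp
qed

lemma L2_Cauchy_Schwarz:
  assumes "v \<in> L2 M" "w \<in> L2 M"
  shows "\<bar>\<integral>x. v x * w x \<partial>M\<bar> \<le> sqrt (\<integral>x. (v x)^2 \<partial>M) * sqrt (\<integral>x. (w x)^2 \<partial>M)"
proof -
  define a b c where "a = (\<integral>x. (v x)^2 \<partial>M)" and "b = (\<integral>x. v x * w x \<partial>M)" and "c = (\<integral>x. (w x)^2 \<partial>M)"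
  have nn: "0 \<le> a - 2 * t * b + t^2 * c" for t
  proof -
    have "0 \<le> (\<integral>x. (v x - t * w x)^2 \<partial>M)" by simp
    then show ?thesis
      unfolding L2_integral_diff_square[OF assms] a_def b_def c_def .
  qed
  have "c \<ge> 0" by (simp add: c_def)
  have "b^2 \<le> a * c"
  proof (cases "c = 0")
    case True
    have "b = 0"
    proof (rule ccontr)
      assume "b \<noteq> 0"
      \<comment> \<open>For \<open>c = 0\<close> the quadratic is affine in \<open>t\<close>; this
        \<open>t\<close> gives it the value -1.\<close>
      with nn[of "(a + 1) / (2 * b)"] True show False by simp
    qed
    then show ?thesis using True by simp
  next
    case False
    have "0 \<le> a - b^2 / c"
      \<comment> \<open>\<open>t = b / c\<close> minimizes the quadratic.\<close>
      using nn[of "b / c"] False by (simp add: power2_eq_square)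
    then show ?thesis
      using False \<open>c \<ge> 0\<close> by (simp add: field_simps)
  qed
  then have "sqrt (b^2) \<le> sqrt (a * c)" by (rule real_sqrt_le_mono)
  then show ?thesis by (simp add: a_def b_def c_def real_sqrt_mult)
qed

lemma L2_add_square_le:
  assumes "v \<in> L2 M" "w \<in> L2 M"
  shows "(\<integral>x. (v x + w x)^2 \<partial>M) \<le> 2 * (\<integral>x. (v x)^2 \<partial>M) + 2 * (\<integral>x. (w x)^2 \<partial>M)"
proof -
  have "(\<integral>x. (v x + w x)^2 \<partial>M) \<le> (\<integral>x. 2 * (v x)^2 + 2 * (w x)^2 \<partial>M)"
  proof (rule integral_mono)
    show "(v x + w x)^2 \<le> 2 * (v x)^2 + 2 * (w x)^2" for x
      using zero_le_power2[of "v x - w x"] by (simp add: power2_eq_square algebra_simps)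
  qed (use L2_square_integrable[OF L2_add[OF assms]] L2_square_integrable[OF assms(1)]
      L2_square_integrable[OF assms(2)] in auto)
  then show ?thesis
    using L2_square_integrable[OF assms(1)] L2_square_integrable[OF assms(2)] by simp
qed

section \<open>Separability of the spaces of integrable and square integrable functions\<close>

lemma open_approx_finite_union:
  fixes e :: "nat \<Rightarrow> 'b::euclidean_space set" and U :: "'b set"
  assumes basis: "topological_basis (range e)" and U: "open U" "emeasure lborel U < \<infinity>" and "\<epsilon> > 0"
  obtains l where "(\<Union>i\<in>set l. e i) \<subseteq> U" "measure lborel (U - (\<Union>i\<in>set l. e i)) < \<epsilon>"
proof -
  \<comment> \<open>Among the first \<open>n\<close> basis sets those inside \<open>U\<close> are
    kept. Every point of \<open>U\<close> lies in such a set, so the unions \<open>W n\<close>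
    increase to \<open>U\<close>, and finite measure makes their measures converge.\<close>
  define l where "l n = filter (\<lambda>i. e i \<subseteq> U) [0..<n]" for n
  define W where "W n = (\<Union>i\<in>set (l n). e i)" for n
  have op: "open (e i)" for i
    using basis by (auto simp: topological_basis_def)
  obtain B' where B': "B' \<subseteq> range e" "\<Union>B' = U"
    using basis U(1) unfolding topological_basis_def by blast
  have sub: "W n \<subseteq> U" for n
    by (auto simp: W_def l_def)
  have "U \<subseteq> (\<Union>n. W n)"
  proof
    fix x assume "x \<in> U"
    then obtain i where "x \<in> e i" "e i \<subseteq> U"
      using B' by blast
    then have "x \<in> W (Suc i)"
      by (auto simp: W_def l_def)
    then show "x \<in> (\<Union>n. W n)" by blast
  qed
  with sub have un: "(\<Union>n. W n) = U" by blast
  have [measurable]: "W n \<in> sets borel" for n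
    by (auto simp: W_def intro!: borel_open op)
  have "(\<lambda>n. measure lborel (W n)) \<longlonglongrightarrow> measure lborel (\<Union>n. W n)"
  proof (rule Lim_measure_incseq)
    show "incseq W" by (force simp: incseq_def W_def l_def)
    show "emeasure lborel (\<Union>n. W n) \<noteq> \<infinity>" using un U by simp
  qed auto
  then have "\<forall>\<^sub>F n in sequentially. dist (measure lborel (W n)) (measure lborel U) < \<epsilon>"
    unfolding un using \<open>\<epsilon> > 0\<close> tendstoD by blast
  then obtain n where n: "dist (measure lborel (W n)) (measure lborel U) < \<epsilon>"
    by (auto simp: eventually_sequentially)
  have "measure lborel (U - W n) = measure lborel U - measure lborel (W n)"
    using U sub by (intro measure_Diff) auto
  then show ?thesis
    using that[of "l n"] n sub by (simp add: W_def dist_real_def)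
qed

text \<open>The dense family consists of finite rational combinations of indicators of finite unions
  of basis sets. Coding them by lists of pairs makes countability a matter of the list type and
  turns sums into \<open>@\<close>. The approximation property then follows by induction over
  integrable functions.\<close>

lemma lborel_L1_separable:
  obtains D :: "nat \<Rightarrow> 'b::euclidean_space \<Rightarrow> real"
  where "\<And>n. integrable lborel (D n)"
    and "\<And>f \<epsilon>. integrable lborel f \<Longrightarrow> \<epsilon> > 0 \<Longrightarrow> \<exists>n. (LINT x|lborel. \<bar>f x - D n x\<bar>) < \<epsilon>"
proof -
  obtain B :: "'b set set" where B: "countable B" "topological_basis B"
    using ex_countable_basis by blast
  have "B \<noteq> {}"
    using B(2) open_UNIV unfolding topological_basis_def by (metis Union_empty empty_not_UNIV subset_empty)
  define e where "e = from_nat_into B"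
  have basis: "topological_basis (range e)"
    using B \<open>B \<noteq> {}\<close> by (simp add: e_def)
  have op: "open (e i)" for i
    using basis by (auto simp: topological_basis_def)
  define W where "W l = (\<Union>i\<in>set l. e i)" for l
  have W[measurable]: "W l \<in> sets borel" for l
    by (auto simp: W_def intro!: borel_open op)
  define D where "D L x = (\<Sum>(q, l)\<leftarrow>L. of_rat q * indicat_real (W l) x)" for L x
  have Dapp: "D (L @ L') x = D L x + D L' x" for L L' x
    by (simp add: D_def)
  have main: "\<forall>\<epsilon>>0. \<exists>L. integrable lborel (D L) \<and> (LINT x|lborel. \<bar>f x - D L x\<bar>) < \<epsilon>"
    if "integrable lborel f" for f
    using that
  proof (induction f rule: integrable_induct)
    case (base A c)
    show ?case
    proof (intro allI impI)
      fix \<epsilon> :: real assume "\<epsilon> > 0"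
      have Am[measurable]: "A \<in> sets borel" using base by simp
      define a where "a = measure lborel A"
      have "a \<ge> 0" by (simp add: a_def)
      \<comment> \<open>Half of the budget: a rational within \<delta> of \<open>c\<close> changes
        the integral over \<open>A\<close> by at most
        \<open>\<delta> * a < \<epsilon> / 2\<close>.\<close>
      define \<delta> where "\<delta> = \<epsilon> / (2 * (a + 1))"
      have "\<delta> > 0" using \<open>\<epsilon> > 0\<close> \<open>a \<ge> 0\<close> by (simp add: \<delta>_def)
      then obtain q where q: "c < of_rat q" "of_rat q < c + \<delta>"
        using of_rat_dense[of c "c + \<delta>"] by auto
      define r :: real where "r = of_rat q"
      \<comment> \<open>The other half: \<open>A\<close> and \<open>W l\<close> are compared through
        an open \<open>U\<close> containing both. Each of the two differences has measure below
        \<eta>, which weighted by \<open>\<bar>r\<bar>\<close> costs at most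
        \<open>\<epsilon> / 4\<close>.\<close>
      define \<eta> where "\<eta> = \<epsilon> / (4 * (\<bar>r\<bar> + 1))"
      have "\<eta> > 0" using \<open>\<epsilon> > 0\<close> by (simp add: \<eta>_def add_nonneg_pos)
      obtain U where U: "open U" "A \<subseteq> U" "emeasure lborel (U - A) < ennreal \<eta>"
        using outer_regular_lborel[OF Am \<open>\<eta> > 0\<close>] by blast
      have Um[measurable]: "U \<in> sets borel" using U by simp
      have "emeasure lborel U = emeasure lborel A + emeasure lborel (U - A)"
        using U(2) by (subst plus_emeasure) (auto simp: Un_absorb1)
      then have Ufin: "emeasure lborel U < \<infinity>"
        using base U(3) by (auto simp: less_top[symmetric])
      obtain l where l: "W l \<subseteq> U" "measure lborel (U - W l) < \<eta>"
        using open_approx_finite_union[OF basis U(1) Ufin \<open>\<eta> > 0\<close>] unfolding W_def by blast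
      have UA: "measure lborel (U - A) < \<eta>"
      proof -
        have "emeasure lborel (U - A) = ennreal (measure lborel (U - A))"
          using U(3) by (intro emeasure_eq_ennreal_measure) auto
        with U(3) show ?thesis by (simp add: ennreal_less_iff)
      qed
      have fin: "emeasure lborel S < \<infinity>" if "S \<subseteq> U" "S \<in> sets borel" for S
        using emeasure_mono[of S U lborel] that Ufin by auto
      have D: "D [(q, l)] = (\<lambda>x. r * indicat_real (W l) x)"
        by (auto simp: D_def r_def)
      have "integrable lborel (D [(q, l)])"
        unfolding D using fin[OF l(1)] by simp
      moreover have "(LINT x|lborel. \<bar>indicator A x *\<^sub>R c - D [(q, l)] x\<bar>) < \<epsilon>"
      proof -
        have "(LINT x|lborel. \<bar>indicator A x *\<^sub>R c - D [(q, l)] x\<bar>)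
          \<le> (LINT x|lborel. \<delta> * indicator A x + (\<bar>r\<bar> * indicator (U - A) x + \<bar>r\<bar> * indicator (U - W l) x))"
        proof (rule integral_mono)
          show "integrable lborel (\<lambda>x. \<bar>indicator A x *\<^sub>R c - D [(q, l)] x\<bar>)"
            unfolding D using fin[OF l(1)] fin[OF U(2)] by (intro integrable_abs Bochner_Integration.integrable_diff) auto
          show "integrable lborel (\<lambda>x. \<delta> * indicator A x + (\<bar>r\<bar> * indicator (U - A) x + \<bar>r\<bar> * indicator (U - W l) x))"
            using fin[of A] fin[of "U - A"] fin[of "U - W l"] U(2) by auto
          show "\<bar>indicator A x *\<^sub>R c - D [(q, l)] x\<bar>
            \<le> \<delta> * indicator A x + (\<bar>r\<bar> * indicator (U - A) x + \<bar>r\<bar> * indicator (U - W l) x)" for x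
            using q[folded r_def] U(2) l(1) \<open>\<delta> > 0\<close> unfolding D by (auto simp: indicator_def)
        qed
        also have "\<dots> = \<delta> * a + (\<bar>r\<bar> * measure lborel (U - A) + \<bar>r\<bar> * measure lborel (U - W l))"
          using fin[of A] fin[of "U - A"] fin[of "U - W l"] U(2) by (simp add: a_def)
        also have "\<dots> \<le> \<delta> * a + (\<bar>r\<bar> * \<eta> + \<bar>r\<bar> * \<eta>)"
          using UA l(2) \<open>\<delta> > 0\<close> \<open>a \<ge> 0\<close> by (intro add_mono mult_left_mono) auto
        also have "\<dots> < \<epsilon>"
        proof -
          have "\<delta> * a < \<epsilon> / 2"
            using \<open>\<epsilon> > 0\<close> \<open>a \<ge> 0\<close> by (simp add: \<delta>_def field_simps)
          moreover have "\<bar>r\<bar> * \<eta> \<le> \<epsilon> / 4"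
            using \<open>\<epsilon> > 0\<close> unfolding \<eta>_def by (simp add: field_simps add_pos_nonneg)
          ultimately show ?thesis by linarith
        qed
        finally show ?thesis .
      qed
      ultimately show "\<exists>L. integrable lborel (D L) \<and> (LINT x|lborel. \<bar>indicator A x *\<^sub>R c - D L x\<bar>) < \<epsilon>"
        by blast
    qed
  next
    case (add f g)
    show ?case
    proof (intro allI impI)
      fix \<epsilon> :: real assume "\<epsilon> > 0"
      then have "\<epsilon> / 2 > 0" by simp
      then obtain L L' where L: "integrable lborel (D L)" "(LINT x|lborel. \<bar>f x - D L x\<bar>) < \<epsilon> / 2"
        and L': "integrable lborel (D L')" "(LINT x|lborel. \<bar>g x - D L' x\<bar>) < \<epsilon> / 2"
        using add.IH by meson
      have "(LINT x|lborel. \<bar>f x + g x - D (L @ L') x\<bar>)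
        \<le> (LINT x|lborel. \<bar>f x - D L x\<bar> + \<bar>g x - D L' x\<bar>)"
        using add.hyps L L' by (intro integral_mono) (auto simp: Dapp)
      also have "\<dots> < \<epsilon>"
        using add.hyps L L' by simp
      finally show "\<exists>L. integrable lborel (D L) \<and> (LINT x|lborel. \<bar>f x + g x - D L x\<bar>) < \<epsilon>"
        using L L' by (intro exI[of _ "L @ L'"]) (simp add: Dapp [abs_def])
    qed
  next
    case (lim f s)
    show ?case
    proof (intro allI impI)
      fix \<epsilon> :: real assume "\<epsilon> > 0"
      have "(\<lambda>i. LINT x|lborel. \<bar>f x - s i x\<bar>) \<longlonglongrightarrow> (LINT x::'b|lborel. 0)"
      proof (rule integral_dominated_convergence[where w="\<lambda>x. 3 * \<bar>f x\<bar>"])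
        show "AE x in lborel. (\<lambda>i. \<bar>f x - s i x\<bar>) \<longlonglongrightarrow> 0"
          using lim.hyps by (intro AE_I2 tendsto_rabs_zero) (auto intro!: tendsto_eq_intros)
        show "AE x in lborel. norm \<bar>f x - s i x\<bar> \<le> 3 * \<bar>f x\<bar>" for i
        proof (rule AE_I2)
          fix x :: 'b
          show "norm \<bar>f x - s i x\<bar> \<le> 3 * \<bar>f x\<bar>"
            using lim.hyps(3)[of x i] by simp
        qed
      qed (use lim.hyps in auto)
      then have "\<forall>\<^sub>F i in sequentially. (LINT x|lborel. \<bar>f x - s i x\<bar>) < \<epsilon> / 2"
        using \<open>\<epsilon> > 0\<close> by (intro order_tendstoD(2)) auto
      then obtain i where i: "(LINT x|lborel. \<bar>f x - s i x\<bar>) < \<epsilon> / 2"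
        by (auto simp: eventually_sequentially)
      obtain L where L: "integrable lborel (D L)" "(LINT x|lborel. \<bar>s i x - D L x\<bar>) < \<epsilon> / 2"
        using lim.IH[of i] \<open>\<epsilon> > 0\<close> half_gt_zero by blast
      have "(LINT x|lborel. \<bar>f x - D L x\<bar>) \<le> (LINT x|lborel. \<bar>f x - s i x\<bar> + \<bar>s i x - D L x\<bar>)"
        using lim.hyps L by (intro integral_mono) auto
      also have "\<dots> < \<epsilon>"
        using lim.hyps L i by simp
      finally show "\<exists>L. integrable lborel (D L) \<and> (LINT x|lborel. \<bar>f x - D L x\<bar>) < \<epsilon>"
        using L by blast
    qed
  qed
  \<comment> \<open>A code may name a set of infinite measure; codes of functions that are not
    integrable are sent to 0.\<close>
  define E where "E n = (if integrable lborel (D (from_nat n)) then D (from_nat n) else (\<lambda>_. 0))" for n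
  show ?thesis
  proof (rule that[of E])
    show "integrable lborel (E n)" for n by (simp add: E_def)
    fix f :: "'b \<Rightarrow> real" and \<epsilon> :: real assume "integrable lborel f" "\<epsilon> > 0"
    then obtain L where "integrable lborel (D L)" "(LINT x|lborel. \<bar>f x - D L x\<bar>) < \<epsilon>"
      using main by blast
    then show "\<exists>n. (LINT x|lborel. \<bar>f x - E n x\<bar>) < \<epsilon>"
      by (intro exI[of _ "to_nat L"]) (simp add: E_def)
  qed
qed

text \<open>For equal signs the right side contains
  \<open>\<bar>a - b\<bar> * \<bar>a + b\<bar>\<close>, and
  \<open>\<bar>a - b\<bar> \<le> \<bar>a + b\<bar>\<close>. For opposite signs it is
  \<open>2 * (a^2 + b^2)\<close>, which is where the factor 2 comes from.\<close>

lemma diff_square_le_signed_squares: "(a - b)^2 \<le> 2 * \<bar>a * \<bar>a\<bar> - b * \<bar>b\<bar>\<bar>" for a b :: real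
proof -
  have same: "(x - y)^2 \<le> 2 * (x^2 - y^2)" if "0 \<le> y" "y \<le> x" for x y :: real
  proof -
    have "(x - y) * (x - y) \<le> (x - y) * (2 * (x + y))"
      using that by (intro mult_left_mono) auto
    then show ?thesis by (simp add: power2_eq_square algebra_simps)
  qed
  have opp: "(x + y)^2 \<le> 2 * (x^2 + y^2)" for x y :: real
    using zero_le_power2[of "x - y"] by (simp add: power2_eq_square algebra_simps)
  consider "0 \<le> b" "b \<le> a" | "0 \<le> a" "a \<le> b" | "b \<le> a" "a \<le> 0" | "a \<le> b" "b \<le> 0"
    | "0 \<le> a" "b \<le> 0" | "a \<le> 0" "0 \<le> b"
    by linarith
  then show ?thesis
  proof cases
    case 1
    with same[of b a] abs_ge_self[of "a * a - b * b"] show ?thesis by (simp add: power2_eq_square algebra_simps)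
  next
    case 2
    with same[of a b] abs_ge_minus_self[of "a * a - b * b"] show ?thesis by (simp add: power2_eq_square algebra_simps)
  next
    case 3
    with same[of "-a" "-b"] abs_ge_self[of "b * b - a * a"] show ?thesis by (simp add: power2_eq_square algebra_simps)
  next
    case 4
    with same[of "-b" "-a"] abs_ge_minus_self[of "b * b - a * a"] show ?thesis by (simp add: power2_eq_square algebra_simps)
  next
    case 5
    with opp[of a "-b"] show ?thesis by (simp add: power2_eq_square algebra_simps)
  next
    case 6
    with opp[of "-a" b] show ?thesis by (simp add: power2_eq_square algebra_simps)
  qed
qed

text \<open>The map \<open>a \<mapsto> a\<bar>a\<bar>\<close> carries \<open>L\<^sup>2\<close> to \<open>L\<^sup>1\<close> and, by the previous lemma, its inverse is
  continuous from \<open>L\<^sup>1\<close> to \<open>L\<^sup>2\<close>; so separability transfers.\<close>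

lemma lborel_L2_separable:
  obtains E :: "nat \<Rightarrow> 'b::euclidean_space \<Rightarrow> real"
  where "\<And>n. E n \<in> L2 lborel"
    and "\<And>f \<epsilon>. f \<in> L2 lborel \<Longrightarrow> \<epsilon> > 0 \<Longrightarrow> \<exists>n. (LINT x|lborel. (f x - E n x)^2) < \<epsilon>"
proof -
  obtain D :: "nat \<Rightarrow> 'b \<Rightarrow> real" where D: "\<And>n. integrable lborel (D n)"
    and dense: "\<And>f \<epsilon>. integrable lborel f \<Longrightarrow> \<epsilon> > 0 \<Longrightarrow> \<exists>n. (LINT x|lborel. \<bar>f x - D n x\<bar>) < \<epsilon>"
    using lborel_L1_separable by blast
  have Dm[measurable]: "D n \<in> borel_measurable borel" for n
    using D[of n] by auto
  define E where "E n x = sgn (D n x) * sqrt \<bar>D n x\<bar>" for n x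
  have Em[measurable]: "E n \<in> borel_measurable borel" for n
    unfolding E_def by measurable
  have sq: "(E n x)^2 = \<bar>D n x\<bar>" and sgn_sq: "E n x * \<bar>E n x\<bar> = D n x" for n x
    by (auto simp: E_def power_mult_distrib sgn_if abs_mult)
  have EL: "E n \<in> L2 lborel" for n
    using D by (simp add: L2_def sq)
  show ?thesis
  proof (rule that[OF EL])
    fix f :: "'b \<Rightarrow> real" and \<epsilon> :: real assume f: "f \<in> L2 lborel" and "\<epsilon> > 0"
    have fm[measurable]: "f \<in> borel_measurable borel" using f by (simp add: L2_def)
    have int: "integrable lborel (\<lambda>x. f x * \<bar>f x\<bar>)"
      using f unfolding L2_def
      by (auto intro: Bochner_Integration.integrable_bound[of _ "\<lambda>x. (f x)^2"] simp: abs_mult power2_eq_square)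
    obtain n where n: "(LINT x|lborel. \<bar>f x * \<bar>f x\<bar> - D n x\<bar>) < \<epsilon> / 2"
      using dense[OF int, of "\<epsilon> / 2"] \<open>\<epsilon> > 0\<close> by auto
    have "(LINT x|lborel. (f x - E n x)^2) \<le> (LINT x|lborel. 2 * \<bar>f x * \<bar>f x\<bar> - D n x\<bar>)"
    proof (rule integral_mono)
      show "integrable lborel (\<lambda>x. (f x - E n x)^2)"
        using L2_diff[OF f EL[of n]] by (simp add: L2_def)
      show "integrable lborel (\<lambda>x. 2 * \<bar>f x * \<bar>f x\<bar> - D n x\<bar>)"
        using int D by simp
      show "(f x - E n x)^2 \<le> 2 * \<bar>f x * \<bar>f x\<bar> - D n x\<bar>" for x
        using diff_square_le_signed_squares[of "f x" "E n x"] by (simp add: sgn_sq)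
    qed
    also have "\<dots> < \<epsilon>" using n by simp
    finally show "\<exists>n. (LINT x|lborel. (f x - E n x)^2) < \<epsilon>" by blast
  qed
qed

text \<open>The dense functions need not come from \<open>S\<close>. So for each pair of them and
  each resolution \<open>1 / Suc k\<close> one nearby member of \<open>S\<close> is chosen, if there
  is any. Two maps are treated together because closeness in the fractional space means closeness of
  the function and of its difference quotient.\<close>

lemma L2_pair_separable_subset:
  fixes J :: "'c \<Rightarrow> 'b::euclidean_space \<Rightarrow> real" and J' :: "'c \<Rightarrow> 'd::euclidean_space \<Rightarrow> real"
  assumes S: "S \<noteq> {}" "\<And>v. v \<in> S \<Longrightarrow> J v \<in> L2 lborel" "\<And>v. v \<in> S \<Longrightarrow> J' v \<in> L2 lborel"
  obtains C where "countable C" "C \<subseteq> S"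
    and "\<And>v \<epsilon>. v \<in> S \<Longrightarrow> \<epsilon> > 0 \<Longrightarrow> \<exists>w\<in>C. (LINT x|lborel. (J v x - J w x)^2) < \<epsilon> \<and> (LINT x|lborel. (J' v x - J' w x)^2) < \<epsilon>"
proof -
  obtain E :: "nat \<Rightarrow> 'b \<Rightarrow> real" where E: "\<And>n. E n \<in> L2 lborel"
    "\<And>f \<epsilon>. f \<in> L2 lborel \<Longrightarrow> \<epsilon> > 0 \<Longrightarrow> \<exists>n. (LINT x|lborel. (f x - E n x)^2) < \<epsilon>"
    using lborel_L2_separable by blast
  obtain E' :: "nat \<Rightarrow> 'd \<Rightarrow> real" where E': "\<And>n. E' n \<in> L2 lborel"
    "\<And>f \<epsilon>. f \<in> L2 lborel \<Longrightarrow> \<epsilon> > 0 \<Longrightarrow> \<exists>n. (LINT x|lborel. (f x - E' n x)^2) < \<epsilon>"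
    using lborel_L2_separable by blast
  define near where "near n n' k v \<longleftrightarrow> v \<in> S \<and> (LINT x|lborel. (J v x - E n x)^2) < 1 / real (Suc k)
      \<and> (LINT x|lborel. (J' v x - E' n' x)^2) < 1 / real (Suc k)" for n n' k v
  define pick where "pick = (\<lambda>(n, n', k). SOME v. near n n' k v)"
  define C where "C = pick ` {(n, n', k). \<exists>v. near n n' k v}"
  have pick: "near n n' k (pick (n, n', k))" if "near n n' k v" for n n' k v
    unfolding pick_def using that by (auto intro: someI)
  show ?thesis
  proof (rule that)
    show "countable C" unfolding C_def by (rule countable_image) (rule countable_subset[OF subset_UNIV], simp)
    show "C \<subseteq> S" using pick unfolding C_def near_def by blast
    fix v and \<epsilon> :: real assume v: "v \<in> S" and "\<epsilon> > 0"
    \<comment> \<open>Passing through \<open>E n\<close> doubles each of the two squared distances,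
      hence the quarter.\<close>
    obtain k where k: "1 / real (Suc k) < \<epsilon> / 4"
      using reals_Archimedean[of "\<epsilon> / 4"] \<open>\<epsilon> > 0\<close> by (auto simp: inverse_eq_divide)
    obtain n n' where "near n n' k v"
      using E(2)[OF S(2)[OF v], of "1 / real (Suc k)"] E'(2)[OF S(3)[OF v], of "1 / real (Suc k)"] v
      unfolding near_def by auto
    define w where "w = pick (n, n', k)"
    have w: "near n n' k w" "w \<in> C"
      using pick[OF \<open>near n n' k v\<close>] \<open>near n n' k v\<close> by (auto simp: w_def C_def)
    have "w \<in> S" using w by (simp add: near_def)
    have sym: "(LINT x|lborel. (E n x - J w x)^2) = (LINT x|lborel. (J w x - E n x)^2)"
      "(LINT x|lborel. (E' n' x - J' w x)^2) = (LINT x|lborel. (J' w x - E' n' x)^2)"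
      by (simp_all add: power2_commute)
    have "(LINT x|lborel. (J v x - J w x)^2) < \<epsilon>"
      using L2_add_square_le[OF L2_diff[OF S(2)[OF v] E(1)[of n]] L2_diff[OF E(1)[of n] S(2)[OF \<open>w \<in> S\<close>]]]
        w(1) \<open>near n n' k v\<close> k by (simp add: near_def sym)
    moreover have "(LINT x|lborel. (J' v x - J' w x)^2) < \<epsilon>"
      using L2_add_square_le[OF L2_diff[OF S(3)[OF v] E'(1)[of n']] L2_diff[OF E'(1)[of n'] S(3)[OF \<open>w \<in> S\<close>]]]
        w(1) \<open>near n n' k v\<close> k by (simp add: near_def sym)
    ultimately show "\<exists>w\<in>C. (LINT x|lborel. (J v x - J w x)^2) < \<epsilon> \<and> (LINT x|lborel. (J' v x - J' w x)^2) < \<epsilon>"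
      using w by blast
  qed
qed

section \<open>Energy form and fractional Sobolev space\<close>

text \<open>By symmetry in \<open>(r, t)\<close> the integral over \<open>r < t\<close> is half the integral over the square,
  which is \<open>\<integral> (\<integral> h t x dt)\<^sup>2 dx\<close>.\<close>

lemma time_kernel_nonneg:
  fixes h :: "real \<Rightarrow> 'b \<Rightarrow> real"
  assumes M: "sigma_finite_measure M" and S: "S \<in> sets borel" "emeasure lborel S < \<infinity>"
    and hm: "(\<lambda>p. h (fst p) (snd p)) \<in> borel_measurable (lborel \<Otimes>\<^sub>M M)"
    and fin: "(\<integral>\<^sup>+t\<in>S. (\<integral>\<^sup>+x. ennreal ((h t x)^2) \<partial>M) \<partial>lborel) < \<infinity>"
  defines "I \<equiv> (\<lambda>t. LINT r|lborel. indicator {..<t} r * (\<integral>x. (indicator S r * h r x) * (indicator S t * h t x) \<partial>M))"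
  shows "integrable lborel I" and "0 \<le> (LINT t|lborel. I t)"
proof -
  interpret M: sigma_finite_measure M by fact
  interpret LM: pair_sigma_finite "lborel \<Otimes>\<^sub>M lborel :: (real \<times> real) measure" M
    by (rule pair_sigma_finite.intro) (auto intro: lborel_pair.P.sigma_finite_measure_axioms M)
  note S(1)[measurable] hm[measurable]
  define g where "g t x = indicator S t * h t x" for t x
  have gm[measurable]: "(\<lambda>p. g (fst p) (snd p)) \<in> borel_measurable (lborel \<Otimes>\<^sub>M M)"
    unfolding g_def by measurable
  define \<Phi> where "\<Phi> = (\<lambda>q. g (fst (fst q)) (snd q) * g (snd (fst q)) (snd q))"
  have [measurable]: "(\<lambda>q. g (fst (fst q)) (snd q)) \<in> borel_measurable ((lborel \<Otimes>\<^sub>M lborel) \<Otimes>\<^sub>M M)"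
    "(\<lambda>q. g (snd (fst q)) (snd q)) \<in> borel_measurable ((lborel \<Otimes>\<^sub>M lborel) \<Otimes>\<^sub>M M)"
    using measurable_compose[OF _ gm, of "\<lambda>q. (fst (fst q), snd q)" "(lborel \<Otimes>\<^sub>M lborel) \<Otimes>\<^sub>M M"]
      measurable_compose[OF _ gm, of "\<lambda>q. (snd (fst q), snd q)" "(lborel \<Otimes>\<^sub>M lborel) \<Otimes>\<^sub>M M"]
    by simp_all
  have \<Phi>m[measurable]: "\<Phi> \<in> borel_measurable ((lborel \<Otimes>\<^sub>M lborel) \<Otimes>\<^sub>M M)"
    unfolding \<Phi>_def by measurable
  define N where "N t = (\<integral>\<^sup>+x. ennreal ((g t x)^2) \<partial>M)" for t
  have Nm[measurable]: "N \<in> borel_measurable borel"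
    unfolding N_def using M.borel_measurable_nn_integral_fst[of "\<lambda>p. ennreal ((g (fst p) (snd p))^2)" lborel] by simp
  have N_fin: "(\<integral>\<^sup>+t. N t \<partial>lborel) < \<infinity>"
  proof -
    have "(\<integral>\<^sup>+t. N t \<partial>lborel) = (\<integral>\<^sup>+t\<in>S. (\<integral>\<^sup>+x. ennreal ((h t x)^2) \<partial>M) \<partial>lborel)"
      by (rule nn_integral_cong) (auto simp: N_def g_def indicator_def)
    with fin show ?thesis by simp
  qed
  \<comment> \<open>The product is bounded by the sum of the two squares. Each square depends on one
    time only, but the product vanishes unless both times lie in \<open>S\<close>; keeping the
    indicator of the other time bounds the integral by twice the measure of \<open>S\<close> times
    the integral of \<open>N\<close>.\<close>
  have "integrable ((lborel \<Otimes>\<^sub>M lborel) \<Otimes>\<^sub>M M) \<Phi>"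
  proof (rule integrableI_bounded[OF \<Phi>m])
    have "(\<integral>\<^sup>+q. ennreal (norm (\<Phi> q)) \<partial>((lborel \<Otimes>\<^sub>M lborel) \<Otimes>\<^sub>M M))
      \<le> (\<integral>\<^sup>+q. indicator S (fst (fst q)) * ennreal ((g (snd (fst q)) (snd q))^2)
          + indicator S (snd (fst q)) * ennreal ((g (fst (fst q)) (snd q))^2) \<partial>((lborel \<Otimes>\<^sub>M lborel) \<Otimes>\<^sub>M M))"
    proof (rule nn_integral_mono)
      fix q
      show "ennreal (norm (\<Phi> q)) \<le> indicator S (fst (fst q)) * ennreal ((g (snd (fst q)) (snd q))^2)
          + indicator S (snd (fst q)) * ennreal ((g (fst (fst q)) (snd q))^2)"
        using abs_mult_le_squares[of "g (fst (fst q)) (snd q)" "g (snd (fst q)) (snd q)"]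
        by (auto simp: \<Phi>_def g_def indicator_def simp flip: ennreal_plus intro!: ennreal_leI)
    qed
    also have "\<dots> = (\<integral>\<^sup>+p. (\<integral>\<^sup>+x. indicator S (fst p) * ennreal ((g (snd p) x)^2)
          + indicator S (snd p) * ennreal ((g (fst p) x)^2) \<partial>M) \<partial>(lborel \<Otimes>\<^sub>M lborel))"
      by (subst M.nn_integral_fst[symmetric]) auto
    also have "\<dots> = (\<integral>\<^sup>+p. indicator S (fst p) * N (snd p) + indicator S (snd p) * N (fst p) \<partial>(lborel \<Otimes>\<^sub>M lborel))"
    proof (rule nn_integral_cong)
      fix p :: "real \<times> real"
      have [measurable]: "g t \<in> borel_measurable M" for t
        using measurable_compose[OF measurable_Pair1' gm, of t] by simp
      show "(\<integral>\<^sup>+x. indicator S (fst p) * ennreal ((g (snd p) x)^2)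
          + indicator S (snd p) * ennreal ((g (fst p) x)^2) \<partial>M)
        = indicator S (fst p) * N (snd p) + indicator S (snd p) * N (fst p)"
        by (subst nn_integral_add) (auto simp: N_def nn_integral_cmult)
    qed
    also have "\<dots> = (\<integral>\<^sup>+r. (\<integral>\<^sup>+t. indicator S r * N t + indicator S t * N r \<partial>lborel) \<partial>lborel)"
      by (subst lborel.nn_integral_fst[symmetric]) auto
    also have "\<dots> = (\<integral>\<^sup>+r. indicator S r * (\<integral>\<^sup>+t. N t \<partial>lborel) + emeasure lborel S * N r \<partial>lborel)"
      by (rule nn_integral_cong) (simp add: nn_integral_add nn_integral_cmult nn_integral_multc)
    also have "\<dots> = emeasure lborel S * (\<integral>\<^sup>+t. N t \<partial>lborel) + emeasure lborel S * (\<integral>\<^sup>+t. N t \<partial>lborel)"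
      by (simp add: nn_integral_add nn_integral_cmult nn_integral_multc)
    also have "\<dots> < \<infinity>"
      using S(2) N_fin by (simp add: ennreal_mult_less_top)
    finally show "(\<integral>\<^sup>+q. ennreal (norm (\<Phi> q)) \<partial>((lborel \<Otimes>\<^sub>M lborel) \<Otimes>\<^sub>M M)) < \<infinity>" .
  qed
  note \<Phi>_int = this
  define K where "K p = (\<integral>x. \<Phi> (p, x) \<partial>M)" for p
  have K_int: "integrable (lborel \<Otimes>\<^sub>M lborel) K"
    unfolding K_def by (rule LM.integrable_fst'[OF \<Phi>_int])
  then have Km[measurable]: "K \<in> borel_measurable (lborel \<Otimes>\<^sub>M lborel)"
    by (rule borel_measurable_integrable)
  have K_sym: "K (r, t) = K (t, r)" for r t
    by (simp add: K_def \<Phi>_def mult.commute)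
  define L where "L p = (if fst p < snd p then K p else 0)" for p
  define L' where "L' p = (if snd p < fst p then K p else 0)" for p
  have Lm[measurable]: "L \<in> borel_measurable (lborel \<Otimes>\<^sub>M lborel)" "L' \<in> borel_measurable (lborel \<Otimes>\<^sub>M lborel)"
    unfolding L_def L'_def by measurable
  have L_int: "integrable (lborel \<Otimes>\<^sub>M lborel) L" "integrable (lborel \<Otimes>\<^sub>M lborel) L'"
    by (auto intro!: Bochner_Integration.integrable_bound[OF K_int] simp: L_def L'_def)
  have "(\<integral>p. L' p \<partial>(lborel \<Otimes>\<^sub>M lborel)) = (\<integral>p. L p \<partial>(lborel \<Otimes>\<^sub>M lborel))"
  proof -
    have "L' = (\<lambda>(x, y). L (y, x))"
      by (auto simp: fun_eq_iff L_def L'_def K_sym)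
    then show ?thesis
      using lborel_pair.integral_product_swap[OF Lm(1)] by simp
  qed
  moreover have "(\<integral>p. K p \<partial>(lborel \<Otimes>\<^sub>M lborel)) = (\<integral>p. L p + L' p \<partial>(lborel \<Otimes>\<^sub>M lborel))"
  proof (rule integral_cong_AE)
    \<comment> \<open>The diagonal is null, so the two open triangles make up the square.\<close>
    have "AE p in lborel \<Otimes>\<^sub>M lborel. fst p \<noteq> (snd p :: real)"
    proof (rule lborel_pair.AE_pair_measure)
      show "{p \<in> space (lborel \<Otimes>\<^sub>M lborel). fst p \<noteq> (snd p :: real)} \<in> sets (lborel \<Otimes>\<^sub>M lborel)"
        by measurable
      have "AE y in lborel. x \<noteq> y" for x :: real
        using AE_lborel_singleton[of x] by (rule AE_mp) (auto intro!: AE_I2)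
      then show "AE x in lborel. AE y in lborel. fst (x, y) \<noteq> (snd (x, y) :: real)"
        by simp
    qed
    then show "AE p in lborel \<Otimes>\<^sub>M lborel. K p = L p + L' p"
      by (rule AE_mp) (auto intro!: AE_I2 simp: L_def L'_def)
  qed auto
  moreover have "0 \<le> (\<integral>p. K p \<partial>(lborel \<Otimes>\<^sub>M lborel))"
  proof -
    have "(\<integral>p. K p \<partial>(lborel \<Otimes>\<^sub>M lborel)) = (\<integral>x. (\<integral>p. \<Phi> (p, x) \<partial>(lborel \<Otimes>\<^sub>M lborel)) \<partial>M)"
      using LM.Fubini_integral[of "\<lambda>p x. \<Phi> (p, x)"] \<Phi>_int unfolding K_def by simp
    also have "\<dots> = (\<integral>x. (\<integral>t. g t x \<partial>lborel)^2 \<partial>M)"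
    proof (rule integral_cong_AE)
      show "AE x in M. (\<integral>p. \<Phi> (p, x) \<partial>(lborel \<Otimes>\<^sub>M lborel)) = (\<integral>t. g t x \<partial>lborel)^2"
      proof -
        have "AE x in M. integrable (lborel \<Otimes>\<^sub>M lborel) (\<lambda>p. \<Phi> (p, x))"
          using LM.AE_integrable_snd[of "\<lambda>p x. \<Phi> (p, x)"] \<Phi>_int by simp
        then show ?thesis
        proof (rule AE_mp, intro AE_I2 impI)
          fix x assume "integrable (lborel \<Otimes>\<^sub>M lborel) (\<lambda>p. \<Phi> (p, x))"
          from lborel_pair.integral_fst'[OF this] show "(\<integral>p. \<Phi> (p, x) \<partial>(lborel \<Otimes>\<^sub>M lborel)) = (\<integral>t. g t x \<partial>lborel)^2"
            by (simp add: \<Phi>_def power2_eq_square)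
        qed
      qed
      show "(\<lambda>x. \<integral>p. \<Phi> (p, x) \<partial>(lborel \<Otimes>\<^sub>M lborel)) \<in> borel_measurable M"
        using LM.integrable_snd[of "\<lambda>p x. \<Phi> (p, x)"] \<Phi>_int by simp
      have "(\<lambda>q. g (snd q) (fst q)) \<in> borel_measurable (M \<Otimes>\<^sub>M lborel)"
        using measurable_compose[OF measurable_pair_swap' gm] by (simp add: case_prod_beta)
      then have "(\<lambda>x. \<integral>t. g t x \<partial>lborel) \<in> borel_measurable M"
        by (intro lborel.borel_measurable_lebesgue_integral) (simp add: case_prod_beta)
      then show "(\<lambda>x. (\<integral>t. g t x \<partial>lborel)^2) \<in> borel_measurable M" by measurable
    qed
    finally show ?thesis by simp
  qed
  ultimately have nn: "0 \<le> (\<integral>p. L p \<partial>(lborel \<Otimes>\<^sub>M lborel))"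
    using L_int by simp
  have I: "I = (\<lambda>t. \<integral>r. L (r, t) \<partial>lborel)"
    unfolding I_def L_def K_def \<Phi>_def g_def
    by (intro ext Bochner_Integration.integral_cong) (auto simp: indicator_def)
  show "integrable lborel I"
    unfolding I using lborel_pair.integrable_snd[of "\<lambda>r t. L (r, t)"] L_int by simp
  show "0 \<le> (LINT t|lborel. I t)"
    unfolding I using lborel_pair.integral_snd[of "\<lambda>r t. L (r, t)"] L_int nn by simp
qed

text \<open>The singular kernel is split evenly between the two factors. The Gagliardo seminorm and
  the form \<A> thereby become, up to the constant, the \<open>L2\<close> norm and inner product of
  ordinary functions on the product space, and all facts on \<open>L2\<close> apply to them.\<close>

definition gagliardo_diff :: "real \<Rightarrow> ('a::euclidean_space \<Rightarrow> real) \<Rightarrow> 'a \<times> 'a \<Rightarrow> real" where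
  "gagliardo_diff s v p = (v (fst p) - v (snd p)) / norm (fst p - snd p) powr ((real DIM('a) + 2 * s) / 2)"

definition Hs :: "real \<Rightarrow> ('a::euclidean_space \<Rightarrow> real) set" where
  "Hs s = {v. v \<in> L2 lborel \<and> gagliardo_diff s v \<in> L2 lborel}"

lemma gagliardo_diff_mult:
  fixes v w :: "'a::euclidean_space \<Rightarrow> real"
  shows "gagliardo_diff s v p * gagliardo_diff s w p
    = (v (fst p) - v (snd p)) * (w (fst p) - w (snd p)) / norm (fst p - snd p) powr (real DIM('a) + 2 * s)"
  by (simp only: gagliardo_diff_def times_divide_times_eq powr_add[symmetric] field_sum_of_halves)

lemma gagliardo_diff_diff: "gagliardo_diff s (\<lambda>x. v x - w x) = (\<lambda>p. gagliardo_diff s v p - gagliardo_diff s w p)"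
  by (auto simp: gagliardo_diff_def fun_eq_iff diff_divide_distrib[symmetric])

text \<open>Joint measurability in the parameter and the pair of points is what Fubini in time
  requires once the parameter is the time.\<close>

lemma gagliardo_diff_measurable:
  fixes g :: "'b \<Rightarrow> 'a::euclidean_space \<Rightarrow> real"
  assumes [measurable]: "(\<lambda>p. g (fst p) (snd p)) \<in> borel_measurable (M \<Otimes>\<^sub>M borel)"
  shows "(\<lambda>p. gagliardo_diff s (g (fst p)) (snd p)) \<in> borel_measurable (M \<Otimes>\<^sub>M borel)"
proof -
  have b: "(borel :: ('a \<times> 'a) measure) = borel \<Otimes>\<^sub>M borel"
    by (simp add: borel_prod)
  have [measurable]: "(\<lambda>p. g (fst p) (fst (snd p))) \<in> borel_measurable (M \<Otimes>\<^sub>M (borel \<Otimes>\<^sub>M borel))"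
    "(\<lambda>p. g (fst p) (snd (snd p))) \<in> borel_measurable (M \<Otimes>\<^sub>M (borel \<Otimes>\<^sub>M borel))"
    using measurable_compose[OF _ assms, of "\<lambda>p. (fst p, fst (snd p))" "M \<Otimes>\<^sub>M (borel \<Otimes>\<^sub>M borel)"]
      measurable_compose[OF _ assms, of "\<lambda>p. (fst p, snd (snd p))" "M \<Otimes>\<^sub>M (borel \<Otimes>\<^sub>M borel)"]
    by simp_all
  show ?thesis
    unfolding gagliardo_diff_def b by measurable
qed

lemma gagliardo_diff_measurable_single:
  fixes v :: "'a::euclidean_space \<Rightarrow> real"
  assumes "v \<in> borel_measurable borel"
  shows "gagliardo_diff s v \<in> borel_measurable borel"
proof -
  have "(\<lambda>p. gagliardo_diff s v (snd p)) \<in> borel_measurable ((borel :: real measure) \<Otimes>\<^sub>M borel)"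
    by (rule gagliardo_diff_measurable) (use assms in measurable)
  from measurable_compose[OF _ this, of "\<lambda>p. (0, p)" borel] show ?thesis
    by simp
qed

lemma gagliardo_sq_eq:
  fixes v :: "'a::euclidean_space \<Rightarrow> real"
  shows "gagliardo_sq s v = (\<integral>\<^sup>+p. ennreal ((gagliardo_diff s v p)^2) \<partial>lborel)"
  unfolding gagliardo_sq_def lborel_prod
  by (simp add: power2_eq_square gagliardo_diff_mult)

lemma bilinA_eq:
  fixes v w :: "'a::euclidean_space \<Rightarrow> real"
  shows "bilinA s v w = Cns (real DIM('a)) s / 2 * (LINT p|lborel. gagliardo_diff s v p * gagliardo_diff s w p)"
  unfolding bilinA_def lborel_prod by (simp add: gagliardo_diff_mult)

lemma Hs_iff:
  fixes v :: "'a::euclidean_space \<Rightarrow> real"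
  shows "v \<in> Hs s \<longleftrightarrow> v \<in> borel_measurable borel \<and> Hs_norm_sq s v < \<infinity>"
  using gagliardo_diff_measurable_single[of v s]
  by (auto simp: Hs_def L2_iff_nn_integral Hs_norm_sq_def L2_sq_def gagliardo_sq_eq)

lemma tildeH_subset_Hs: "tildeH s \<Omega> \<subseteq> Hs s"
  by (auto simp: tildeH_def Hs_iff)

lemma Hs_L2: "v \<in> Hs s \<Longrightarrow> v \<in> L2 lborel"
  and Hs_gagliardo_L2: "v \<in> Hs s \<Longrightarrow> gagliardo_diff s v \<in> L2 lborel"
  by (auto simp: Hs_def)

lemma Hs_diff: "v \<in> Hs s \<Longrightarrow> w \<in> Hs s \<Longrightarrow> (\<lambda>x. v x - w x) \<in> Hs s"
  by (simp add: Hs_def L2_diff gagliardo_diff_diff)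

lemma bilinA_diff_left:
  "v \<in> Hs s \<Longrightarrow> w \<in> Hs s \<Longrightarrow> \<phi> \<in> Hs s \<Longrightarrow> bilinA s (\<lambda>x. v x - w x) \<phi> = bilinA s v \<phi> - bilinA s w \<phi>"
  unfolding bilinA_eq gagliardo_diff_diff left_diff_distrib
  using L2_mult_integrable Hs_gagliardo_L2 by (subst Bochner_Integration.integral_diff) (blast, blast, simp add: algebra_simps)

lemma bilinA_commute: "bilinA s v w = bilinA s w v"
  unfolding bilinA_eq by (simp add: mult.commute)

lemma bilinA_diff_right:
  "v \<in> Hs s \<Longrightarrow> w \<in> Hs s \<Longrightarrow> \<phi> \<in> Hs s \<Longrightarrow> bilinA s \<phi> (\<lambda>x. v x - w x) = bilinA s \<phi> v - bilinA s \<phi> w"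
  by (simp add: bilinA_commute[of s \<phi>] bilinA_diff_left)

lemma Cns_nonneg: "0 < s \<Longrightarrow> s < 1 \<Longrightarrow> 0 \<le> n \<Longrightarrow> 0 \<le> Cns n s"
  unfolding Cns_def by (intro divide_nonneg_pos mult_nonneg_nonneg mult_pos_pos) (auto intro: Gamma_real_pos less_imp_le)

lemma bilinA_nonneg:
  fixes v :: "'a::euclidean_space \<Rightarrow> real"
  assumes "0 < s" "s < 1"
  shows "0 \<le> bilinA s v v"
  unfolding bilinA_eq using Cns_nonneg[OF assms, of "real DIM('a)"] by (simp flip: power2_eq_square)

lemma bilinA_bound:
  fixes v w :: "'a::euclidean_space \<Rightarrow> real"
  assumes "0 < s" "s < 1" "v \<in> Hs s" "w \<in> Hs s"
  shows "\<bar>bilinA s v w\<bar> \<le> Cns (real DIM('a)) s / 2 *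
    (sqrt (LINT p|lborel. (gagliardo_diff s v p)^2) * sqrt (LINT p|lborel. (gagliardo_diff s w p)^2))"
  unfolding bilinA_eq abs_mult using Cns_nonneg[OF assms(1,2), of "real DIM('a)"] assms
  by (auto intro!: mult_left_mono L2_Cauchy_Schwarz Hs_gagliardo_L2)

text \<open>A null set \<open>N\<close> of points spoils only the pairs in
  \<open>N \<times> UNIV\<close> and \<open>UNIV \<times> N\<close>, both null. This makes seminorm
  and form insensitive to changes on null sets.\<close>

lemma AE_lborel_prod:
  fixes P :: "'a::euclidean_space \<Rightarrow> bool"
  assumes "AE x in lborel. P x"
  shows "AE p in lborel. P (fst (p :: 'a \<times> 'a)) \<and> P (snd p)"
proof -
  obtain N where N: "{x \<in> space lborel. \<not> P x} \<subseteq> N" "N \<in> null_sets lborel"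
    using assms by (auto elim!: AE_E2 simp: eventually_ae_filter)
  have "N \<times> UNIV \<in> null_sets (lborel \<Otimes>\<^sub>M lborel)" "UNIV \<times> N \<in> null_sets (lborel \<Otimes>\<^sub>M lborel)"
    using N(2) by auto
  then have "AE p in lborel \<Otimes>\<^sub>M lborel. p \<notin> N \<times> UNIV \<and> p \<notin> UNIV \<times> N"
    using AE_not_in by auto
  then show ?thesis
    unfolding lborel_prod by (rule AE_mp) (use N(1) in \<open>auto intro!: AE_I2\<close>)
qed

lemma Hs_norm_sq_cong_AE:
  fixes v w :: "'a::euclidean_space \<Rightarrow> real"
  assumes "AE x in lborel. v x = w x"
  shows "Hs_norm_sq s v = Hs_norm_sq s w"
proof -
  have "L2_sq v = L2_sq w"
    unfolding L2_sq_def using assms by (intro nn_integral_cong_AE) auto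
  moreover have "gagliardo_sq s v = gagliardo_sq s w"
    unfolding gagliardo_sq_def lborel_prod
    by (rule nn_integral_cong_AE, rule AE_mp[OF AE_lborel_prod[OF assms]]) (auto intro!: AE_I2)
  ultimately show ?thesis by (simp add: Hs_norm_sq_def)
qed

lemma bilinA_cong_AE:
  fixes v w \<phi> :: "'a::euclidean_space \<Rightarrow> real"
  assumes "AE x in lborel. v x = w x" "v \<in> borel_measurable borel" "w \<in> borel_measurable borel" "\<phi> \<in> borel_measurable borel"
  shows "bilinA s \<phi> v = bilinA s \<phi> w"
proof -
  have "(LINT p|lborel. gagliardo_diff s \<phi> p * gagliardo_diff s v p)
      = (LINT p|lborel. gagliardo_diff s \<phi> p * gagliardo_diff s w p)"
  proof (rule integral_cong_AE)
    show "AE p in lborel. gagliardo_diff s \<phi> p * gagliardo_diff s v p = gagliardo_diff s \<phi> p * gagliardo_diff s w p"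
      using AE_lborel_prod[OF assms(1)] by (rule AE_mp) (auto intro!: AE_I2 simp: gagliardo_diff_def)
  qed (use assms gagliardo_diff_measurable_single in \<open>auto intro!: borel_measurable_times\<close>)
  then show ?thesis by (simp add: bilinA_eq)
qed

lemma tildeH_cong_AE:
  assumes v: "v \<in> tildeH s \<Omega>" and vw: "AE x in lborel. v x = w x" and w: "w \<in> borel_measurable borel"
  shows "w \<in> tildeH s \<Omega>"
proof -
  have "Hs_norm_sq s (\<lambda>x. \<phi> x - v x) = Hs_norm_sq s (\<lambda>x. \<phi> x - w x)" for \<phi>
    by (rule Hs_norm_sq_cong_AE) (use vw in auto)
  then show ?thesis
    using v w Hs_norm_sq_cong_AE[OF vw, of s] by (simp add: tildeH_def)
qed

text \<open>Test functions vanish outside \<Omega>, so the mass of \<open>v\<close> there is at most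
  its squared distance to any of the approximating test functions.\<close>

lemma tildeH_AE_zero:
  fixes v :: "'a::euclidean_space \<Rightarrow> real"
  assumes v: "v \<in> tildeH s \<Omega>" and [measurable]: "\<Omega> \<in> sets borel"
  shows "AE x in lborel. x \<notin> \<Omega> \<longrightarrow> v x = 0"
proof -
  have vm[measurable]: "v \<in> borel_measurable borel"
    using v by (simp add: tildeH_def)
  obtain \<phi> where \<phi>: "\<And>k. test_fun \<Omega> (\<phi> k)" "(\<lambda>k. Hs_norm_sq s (\<lambda>x. \<phi> k x - v x)) \<longlonglongrightarrow> 0"
    using v by (auto simp: tildeH_def)
  define J where "J = (\<integral>\<^sup>+x. ennreal ((v x)^2) * indicator (- \<Omega>) x \<partial>lborel)"
  have "J \<le> Hs_norm_sq s (\<lambda>x. \<phi> k x - v x)" for k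
  proof -
    have "\<phi> k x = 0" if "x \<notin> \<Omega>" for x
      using \<phi>(1)[of k] that closure_subset[of "{x. \<phi> k x \<noteq> 0}"] by (auto simp: test_fun_def)
    then have "J \<le> L2_sq (\<lambda>x. \<phi> k x - v x)"
      unfolding J_def L2_sq_def by (intro nn_integral_mono) (auto simp: indicator_def)
    then show ?thesis
      by (simp add: Hs_norm_sq_def add_increasing2)
  qed
  then have "J \<le> 0"
    using \<phi>(2) by (intro LIMSEQ_le_const) auto
  then have "AE x in lborel. ennreal ((v x)^2) * indicator (- \<Omega>) x = 0"
    unfolding J_def by (subst nn_integral_0_iff_AE[symmetric]) auto
  then show ?thesis
    by (rule AE_mp) (auto intro!: AE_I2 simp: indicator_def)
qed

text \<open>The test function carries the localization: since it vanishes outside \<Omega>, the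
  other factor may be arbitrary there, and all pairings can be taken over the whole space.\<close>

lemma ipO_tildeH:
  fixes v w :: "'a::euclidean_space \<Rightarrow> real"
  assumes w: "w \<in> tildeH s \<Omega>" and [measurable]: "\<Omega> \<in> sets borel" "v \<in> borel_measurable borel"
  shows "ipO \<Omega> v w = (LINT x|lborel. v x * w x)"
  unfolding ipO_def set_lebesgue_integral_def
proof (rule integral_cong_AE)
  have [measurable]: "w \<in> borel_measurable borel"
    using w by (simp add: tildeH_def)
  show "(\<lambda>x. indicat_real \<Omega> x *\<^sub>R (v x * w x)) \<in> borel_measurable lborel" by measurable
  show "(\<lambda>x. v x * w x) \<in> borel_measurable lborel" by measurable
  show "AE x in lborel. indicat_real \<Omega> x *\<^sub>R (v x * w x) = v x * w x"
    using tildeH_AE_zero[OF w assms(2)] by (rule AE_mp) (auto intro!: AE_I2 simp: indicator_def)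
qed

section \<open>Error estimate for everywhere defined representatives\<close>

lemma set_integrable_Ioc_bounded:
  fixes g :: "real \<Rightarrow> real"
  assumes [measurable]: "g \<in> borel_measurable borel" and "\<And>t. t \<in> {a<..b} \<Longrightarrow> \<bar>g t\<bar> \<le> B"
  shows "set_integrable lborel {a<..b} g"
  unfolding set_integrable_def
proof (rule Bochner_Integration.integrable_bound)
  show "integrable lborel (\<lambda>t. indicator {a<..b} t * B)"
    by (cases "a \<le> b") auto
qed (use assms(2) in \<open>force simp: indicator_def\<close>)+

lemma set_integral_Ioc_split:
  fixes g :: "real \<Rightarrow> real"
  assumes "a \<le> b" "b \<le> c" "set_integrable lborel {a<..c} g"
  shows "(LINT t:{a<..c}|lborel. g t) = (LINT t:{a<..b}|lborel. g t) + (LINT t:{b<..c}|lborel. g t)"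
proof -
  have "{a<..c} = {a<..b} \<union> {b<..c}" using assms by auto
  moreover have "set_integrable lborel {a<..b} g" "set_integrable lborel {b<..c} g"
    using assms by (auto intro: set_integrable_subset[OF assms(3)])
  ultimately show ?thesis
    by (simp add: set_integral_Un)
qed

text \<open>The members of \<open>H\<close> enter the equations only as test functions, and the equations are linear in
  them, so \<open>H\<close> need not be a subspace. The functions \<open>u\<close>, \<open>f\<close> and \<open>V\<close> are to be representatives
  for which the pointwise assumptions hold at every time.\<close>

locale semidiscrete_heat =
  fixes s T F :: real and K :: nat and H :: "('a::euclidean_space \<Rightarrow> real) set"
    and u0 :: "'a \<Rightarrow> real" and f u :: "real \<Rightarrow> 'a \<Rightarrow> real" and V :: "nat \<Rightarrow> 'a \<Rightarrow> real"
  assumes s: "0 < s" "s < 1" and T: "0 < T" and K: "0 < K" and F: "0 \<le> F"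
    and H_Hs: "H \<subseteq> Hs s" and V_0: "V 0 = u0" and V_H: "V k \<in> H" and u_H: "u t \<in> H"
    and u_measurable: "(\<lambda>p. u (fst p) (snd p)) \<in> borel_measurable (lborel \<Otimes>\<^sub>M lborel)"
    and u_finite: "(\<integral>\<^sup>+t\<in>{0<..<T}. Hs_norm_sq s (u t) \<partial>lborel) < \<infinity>"
    and f_measurable: "(\<lambda>p. f (fst p) (snd p)) \<in> borel_measurable (lborel \<Otimes>\<^sub>M lborel)"
    and f_L2: "f t \<in> L2 lborel" and f_bound: "(LINT x|lborel. (f t x)^2) \<le> F^2"
    and weak: "\<phi> \<in> H \<Longrightarrow> AE t in lborel. t \<in> {0<..<T} \<longrightarrow>
      (LINT x|lborel. u t x * \<phi> x) = (LINT x|lborel. u0 x * \<phi> x)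
        + (LINT r:{0<..t}|lborel. (LINT x|lborel. f r x * \<phi> x) - bilinA s (u r) \<phi>)"
    and scheme: "k < K \<Longrightarrow> \<phi> \<in> H \<Longrightarrow>
      (LINT x|lborel. (V (Suc k) x - V k x) * \<phi> x) + T / real K * bilinA s (V (Suc k)) \<phi>
        = (LINT r:{real k * (T / real K)<..real (Suc k) * (T / real K)}|lborel. (LINT x|lborel. f r x * \<phi> x))"
begin

definition \<tau> :: real where
  "\<tau> = T / real K"

definition ip :: "('a \<Rightarrow> real) \<Rightarrow> ('a \<Rightarrow> real) \<Rightarrow> real" where
  "ip v w = (LINT x|lborel. v x * w x)"

definition nrm :: "('a \<Rightarrow> real) \<Rightarrow> real" where
  "nrm v = sqrt (LINT x|lborel. (v x)^2)"

definition semi :: "('a \<Rightarrow> real) \<Rightarrow> real" where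
  "semi v = sqrt (LINT p|lborel. (gagliardo_diff s v p)^2)"

text \<open>The same ceiling as in \<open>U_tau\<close>: it is \<open>Suc k\<close> on the half-open
  slot from \<open>k * \<tau>\<close> (excluded) to \<open>Suc k * \<tau>\<close>
  (included).\<close>

definition slot :: "real \<Rightarrow> nat" where
  "slot t = nat \<lceil>t / \<tau>\<rceil>"

definition err :: "real \<Rightarrow> 'a \<Rightarrow> real" where
  "err t x = V (slot t) x - u t x"

lemma \<tau>_pos: "0 < \<tau>" and K_\<tau>: "real K * \<tau> = T"
  using T K by (simp_all add: \<tau>_def)

lemma grid_nonneg: "0 \<le> real k * \<tau>"
  using \<tau>_pos by simp

lemma cns_nonneg: "0 \<le> Cns (real DIM('a)) s"
  using Cns_nonneg[OF s] by simp

lemma V_Hs: "V k \<in> Hs s" and u_Hs: "u t \<in> Hs s"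
  using V_H u_H H_Hs by auto

lemma err_Hs: "err t \<in> Hs s"
  unfolding err_def [abs_def] by (rule Hs_diff[OF V_Hs u_Hs])

lemma u0_Hs: "u0 \<in> Hs s"
  using V_Hs[of 0] V_0 by simp

lemma ip_diff_right: "v \<in> L2 lborel \<Longrightarrow> w \<in> L2 lborel \<Longrightarrow> z \<in> L2 lborel \<Longrightarrow> ip z (\<lambda>x. v x - w x) = ip z v - ip z w"
  unfolding ip_def right_diff_distrib by (intro Bochner_Integration.integral_diff L2_mult_integrable)

lemma ip_diff_left: "v \<in> L2 lborel \<Longrightarrow> w \<in> L2 lborel \<Longrightarrow> z \<in> L2 lborel \<Longrightarrow> ip (\<lambda>x. v x - w x) z = ip v z - ip w z"
  unfolding ip_def left_diff_distrib by (intro Bochner_Integration.integral_diff L2_mult_integrable)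

lemma ip_self: "ip v v = (nrm v)^2"
  by (simp add: ip_def nrm_def power2_eq_square[symmetric])

lemma ip_bound: "v \<in> L2 lborel \<Longrightarrow> w \<in> L2 lborel \<Longrightarrow> \<bar>ip v w\<bar> \<le> nrm v * nrm w"
  unfolding ip_def nrm_def by (rule L2_Cauchy_Schwarz)

lemma nrm_nonneg: "0 \<le> nrm v" and semi_nonneg: "0 \<le> semi v"
  by (simp_all add: nrm_def semi_def)

lemma A_bound: "v \<in> Hs s \<Longrightarrow> w \<in> Hs s \<Longrightarrow> \<bar>bilinA s v w\<bar> \<le> Cns (real DIM('a)) s / 2 * (semi v * semi w)"
  unfolding semi_def by (rule bilinA_bound[OF s])

lemma nrm_f: "nrm (f t) \<le> F"
  using real_sqrt_le_mono[OF f_bound[of t]] F by (simp add: nrm_def)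

lemma ip_f_bound: "\<phi> \<in> L2 lborel \<Longrightarrow> \<bar>ip (f t) \<phi>\<bar> \<le> F * nrm \<phi>"
  using ip_bound[OF f_L2[of t], of \<phi>] mult_right_mono[OF nrm_f nrm_nonneg, of t \<phi>] by linarith

lemma slot_measurable [measurable]: "slot \<in> measurable borel (count_space UNIV)"
  unfolding slot_def by measurable

lemma slot_eq: "real k * \<tau> < t \<Longrightarrow> t \<le> real (Suc k) * \<tau> \<Longrightarrow> slot t = Suc k"
proof -
  assume a: "real k * \<tau> < t" "t \<le> real (Suc k) * \<tau>"
  have "real k < t / \<tau>" "t / \<tau> \<le> real (Suc k)"
    using a \<tau>_pos by (simp_all only: pos_less_divide_eq pos_divide_le_eq)
  then have "\<lceil>t / \<tau>\<rceil> = int (Suc k)"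
    by (intro ceiling_unique) auto
  then show ?thesis by (simp add: slot_def)
qed

lemma slot_cases:
  assumes "0 < t" "t \<le> T"
  obtains k where "k < K" "real k * \<tau> < t" "t \<le> real (Suc k) * \<tau>" "slot t = Suc k"
proof -
  define k where "k = nat \<lceil>t / \<tau>\<rceil> - 1"
  have "0 < t / \<tau>" using assms(1) \<tau>_pos by (rule divide_pos_pos)
  then have c: "0 < \<lceil>t / \<tau>\<rceil>" by simp
  have "t / \<tau> \<le> real K" using assms(2) \<tau>_pos by (simp add: pos_divide_le_eq K_\<tau>)
  then have cK: "\<lceil>t / \<tau>\<rceil> \<le> int K" by (simp add: ceiling_le_iff)
  have Sk: "int (Suc k) = \<lceil>t / \<tau>\<rceil>" using c by (simp add: k_def)
  have "real k < t / \<tau>" "t / \<tau> \<le> real (Suc k)"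
    using Sk ceiling_correct[of "t / \<tau>"] by linarith+
  then have "real k * \<tau> < t" "t \<le> real (Suc k) * \<tau>"
    using \<tau>_pos by (simp_all only: pos_less_divide_eq pos_divide_le_eq)
  with Sk cK show ?thesis
    by (intro that[of k]) (auto intro: slot_eq)
qed

lemma ip_measurable:
  assumes "(\<lambda>p. g (fst p) (snd p)) \<in> borel_measurable (lborel \<Otimes>\<^sub>M lborel)" "\<phi> \<in> borel_measurable borel"
  shows "(\<lambda>t. ip (g t) \<phi>) \<in> borel_measurable borel"
proof -
  note assms[measurable]
  have "(\<lambda>t. LINT x|lborel. g t x * \<phi> x) \<in> borel_measurable lborel"
    by (rule lborel.borel_measurable_lebesgue_integral) (simp add: case_prod_beta)
  then show ?thesis by (simp add: ip_def)
qed

lemma A_measurable: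
  assumes "(\<lambda>p. g (fst p) (snd p)) \<in> borel_measurable (lborel \<Otimes>\<^sub>M lborel)" "\<phi> \<in> borel_measurable borel"
  shows "(\<lambda>t. bilinA s (g t) \<phi>) \<in> borel_measurable borel"
proof -
  have [measurable]: "(\<lambda>p. gagliardo_diff s (g (fst p)) (snd p)) \<in> borel_measurable (lborel \<Otimes>\<^sub>M borel)"
    by (rule gagliardo_diff_measurable) (use assms(1) in simp)
  have [measurable]: "gagliardo_diff s \<phi> \<in> borel_measurable borel"
    by (rule gagliardo_diff_measurable_single[OF assms(2)])
  have "(\<lambda>t. LINT p|lborel. gagliardo_diff s (g t) p * gagliardo_diff s \<phi> p) \<in> borel_measurable lborel"
    by (rule lborel.borel_measurable_lebesgue_integral) (simp add: case_prod_beta)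
  then show ?thesis by (simp add: bilinA_eq)
qed

lemma Hs_measurable: "v \<in> Hs s \<Longrightarrow> v \<in> borel_measurable borel"
  by (simp add: Hs_iff)

lemma f_set_integrable:
  assumes "\<phi> \<in> L2 lborel"
  shows "set_integrable lborel {a<..b} (\<lambda>r. ip (f r) \<phi>)"
  by (rule set_integrable_Ioc_bounded[where B="F * nrm \<phi>"])
    (use assms ip_f_bound ip_measurable[OF f_measurable] in \<open>auto simp: L2_def\<close>)

lemma f_integral_bound:
  assumes "\<phi> \<in> L2 lborel" "a \<le> b"
  shows "\<bar>LINT r:{a<..b}|lborel. ip (f r) \<phi>\<bar> \<le> (b - a) * (F * nrm \<phi>)"
proof -
  have "\<bar>LINT r:{a<..b}|lborel. ip (f r) \<phi>\<bar> \<le> (LINT r:{a<..b}|lborel. \<bar>ip (f r) \<phi>\<bar>)"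
    unfolding set_lebesgue_integral_def
    by (rule order.trans[OF integral_abs_bound]) (simp add: abs_mult)
  also have "\<dots> \<le> (LINT r:{a<..b}|lborel. F * nrm \<phi>)"
    using assms ip_f_bound by (intro set_integral_mono set_integrable_abs f_set_integrable set_integrable_Ioc_bounded) auto
  also have "\<dots> = (b - a) * (F * nrm \<phi>)"
    using assms(2) by (simp add: set_lebesgue_integral_def)
  finally show ?thesis .
qed

lemma slot_integrable:
  fixes p :: "nat \<Rightarrow> real"
  assumes "b \<le> T"
  shows "set_integrable lborel {0<..b} (\<lambda>r. p (slot r))"
proof (rule set_integrable_Ioc_bounded)
  show "(\<lambda>r. p (slot r)) \<in> borel_measurable borel"
    by measurable
  fix t assume "t \<in> {0<..b}"
  then obtain k where "k < K" "slot t = Suc k"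
    using slot_cases[of t] assms by auto
  then show "\<bar>p (slot t)\<bar> \<le> (\<Sum>k\<le>K. \<bar>p k\<bar>)"
    by (intro member_le_sum) auto
qed

lemma slot_integral:
  fixes p :: "nat \<Rightarrow> real"
  assumes "real k * \<tau> \<le> t" "t \<le> real (Suc k) * \<tau>" "t \<le> T"
  shows "(LINT r:{0<..t}|lborel. p (slot r)) = (LINT r:{0<..real k * \<tau>}|lborel. p (slot r)) + (t - real k * \<tau>) * p (Suc k)"
proof -
  have "(LINT r:{real k * \<tau><..t}|lborel. p (slot r)) = (LINT r:{real k * \<tau><..t}|lborel. p (Suc k))"
    using assms by (intro set_lebesgue_integral_cong) (auto simp: slot_eq)
  also have "\<dots> = (t - real k * \<tau>) * p (Suc k)"
    using assms(1) by (simp add: set_lebesgue_integral_def)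
  finally show ?thesis
    using set_integral_Ioc_split[of 0 "real k * \<tau>" t "\<lambda>r. p (slot r)"] assms slot_integrable[of t p] grid_nonneg
    by simp
qed

lemma grid_le_T: "k \<le> K \<Longrightarrow> real k * \<tau> \<le> T"
proof -
  assume "k \<le> K"
  then have "real k * \<tau> \<le> real K * \<tau>"
    using \<tau>_pos by (intro mult_right_mono) auto
  then show ?thesis by (simp add: K_\<tau>)
qed

lemma grid_Suc: "real (Suc k) * \<tau> = real k * \<tau> + \<tau>"
  by (simp add: algebra_simps)

lemma slot_integral_grid:
  fixes p :: "nat \<Rightarrow> real"
  shows "n \<le> K \<Longrightarrow> (LINT r:{0<..real n * \<tau>}|lborel. p (slot r)) = \<tau> * (\<Sum>k<n. p (Suc k))"
proof (induction n)
  case 0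
  then show ?case by (simp add: set_lebesgue_integral_def)
next
  case (Suc n)
  then show ?case
    using slot_integral[of n "real (Suc n) * \<tau>" p] grid_le_T[OF Suc.prems] \<tau>_pos
    unfolding grid_Suc by (simp add: distrib_left)
qed

section \<open>Integrability in time, and the weak formulation for all test functions at
  once\<close>

lemma Hs_norm_sq_eq: "Hs_norm_sq s v = ennreal ((nrm v)^2 + (semi v)^2)" if "v \<in> Hs s" for v
  using that by (simp add: Hs_norm_sq_def L2_sq_def gagliardo_sq_eq L2_nn_integral[OF Hs_L2] 
      L2_nn_integral[OF Hs_gagliardo_L2] nrm_def semi_def)

lemma semi_measurable:
  assumes "(\<lambda>p. g (fst p) (snd p)) \<in> borel_measurable (lborel \<Otimes>\<^sub>M lborel)"
  shows "(\<lambda>t. semi (g t)) \<in> borel_measurable borel"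
proof -
  have [measurable]: "(\<lambda>p. gagliardo_diff s (g (fst p)) (snd p)) \<in> borel_measurable (lborel \<Otimes>\<^sub>M borel)"
    by (rule gagliardo_diff_measurable) (use assms(1) in simp)
  have "(\<lambda>t. LINT p|lborel. (gagliardo_diff s (g t) p)^2) \<in> borel_measurable lborel"
    by (rule lborel.borel_measurable_lebesgue_integral) (simp add: case_prod_beta)
  then show ?thesis unfolding semi_def by simp
qed

lemma nrm_measurable:
  assumes [measurable]: "(\<lambda>p. g (fst p) (snd p)) \<in> borel_measurable (lborel \<Otimes>\<^sub>M lborel)"
  shows "(\<lambda>t. nrm (g t)) \<in> borel_measurable borel"
proof -
  have "(\<lambda>t. LINT x|lborel. (g t x)^2) \<in> borel_measurable lborel"
    by (rule lborel.borel_measurable_lebesgue_integral) (simp add: case_prod_beta)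
  then show ?thesis unfolding nrm_def by simp
qed

lemma semi_u_integrable: "set_integrable lborel {0<..<T} (\<lambda>t. (semi (u t))^2)"
  and nrm_u_integrable: "set_integrable lborel {0<..<T} (\<lambda>t. (nrm (u t))^2)"
proof -
  note [measurable] = semi_measurable[OF u_measurable] nrm_measurable[OF u_measurable]
  have "integrable lborel (\<lambda>t. indicator {0<..<T} t * ((nrm (u t))^2 + (semi (u t))^2))"
  proof (rule integrableI_bounded)
    have "(\<integral>\<^sup>+t. ennreal (norm (indicator {0<..<T} t * ((nrm (u t))^2 + (semi (u t))^2))) \<partial>lborel)
      = (\<integral>\<^sup>+t\<in>{0<..<T}. Hs_norm_sq s (u t) \<partial>lborel)"
      by (intro nn_integral_cong) (auto simp: indicator_def Hs_norm_sq_eq[OF u_Hs] simp flip: ennreal_plus)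
    with u_finite show "(\<integral>\<^sup>+t. ennreal (norm (indicator {0<..<T} t * ((nrm (u t))^2 + (semi (u t))^2))) \<partial>lborel) < \<infinity>"
      by simp
  qed measurable
  note int = this
  show "set_integrable lborel {0<..<T} (\<lambda>t. (semi (u t))^2)"
    unfolding set_integrable_def
    by (rule Bochner_Integration.integrable_bound[OF int]) (auto simp: indicator_def)
  show "set_integrable lborel {0<..<T} (\<lambda>t. (nrm (u t))^2)"
    unfolding set_integrable_def
    by (rule Bochner_Integration.integrable_bound[OF int]) (auto simp: indicator_def)
qed

lemma semi_u_integrable1:
  assumes "t < T"
  shows "set_integrable lborel {0<..t} (\<lambda>r. semi (u r))"
proof -
  have "set_integrable lborel {0<..<T} (\<lambda>r. 1 + (semi (u r))^2)"
    using T by (intro set_integral_add(1) semi_u_integrable) (auto simp: set_integrable_def)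
  then have int: "set_integrable lborel {0<..t} (\<lambda>r. 1 + (semi (u r))^2)"
    by (rule set_integrable_subset) (use assms in auto)
  have le: "x \<le> 1 + x^2" for x :: real
    using zero_le_power2[of "x - 1/2"] by (simp add: power2_eq_square algebra_simps)
  note [measurable] = semi_measurable[OF u_measurable]
  show ?thesis
    unfolding set_integrable_def
    by (rule Bochner_Integration.integrable_bound[OF int[unfolded set_integrable_def]])
      (use le semi_nonneg in \<open>auto simp: indicator_def\<close>)
qed

lemma u_A_integrable:
  assumes "\<phi> \<in> Hs s" "t < T"
  shows "set_integrable lborel {0<..t} (\<lambda>r. bilinA s (u r) \<phi>)"
  unfolding set_integrable_def
proof (rule Bochner_Integration.integrable_bound)
  show "integrable lborel (\<lambda>r. (Cns (real DIM('a)) s / 2 * semi \<phi>) * (indicator {0<..t} r *\<^sub>R semi (u r)))"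
    using semi_u_integrable1[OF assms(2)] unfolding set_integrable_def by (rule integrable_mult_right)
  show "(\<lambda>r. indicator {0<..t} r *\<^sub>R bilinA s (u r) \<phi>) \<in> borel_measurable lborel"
    using A_measurable[OF u_measurable Hs_measurable[OF assms(1)]] by simp
  show "AE r in lborel. norm (indicator {0<..t} r *\<^sub>R bilinA s (u r) \<phi>)
      \<le> norm ((Cns (real DIM('a)) s / 2 * semi \<phi>) * (indicator {0<..t} r *\<^sub>R semi (u r)))"
    using A_bound[OF u_Hs assms(1)] cns_nonneg semi_nonneg
    by (auto simp: indicator_def abs_mult mult_ac)
qed

text \<open>At a fixed time the residual of the integrated equation is a bounded functional of
  \<phi> in the fractional norm. That continuity is what carries an identity from a dense set of
  \<phi> to all of them; \<open>M\<close> may depend on \<open>t\<close>.\<close>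

lemma weak_residual_bound:
  assumes t: "0 < t" "t < T"
  obtains M where "0 \<le> M" "\<And>\<phi>. \<phi> \<in> Hs s \<Longrightarrow>
    \<bar>ip (u t) \<phi> - ip u0 \<phi> - (LINT r:{0<..t}|lborel. ip (f r) \<phi>) + (LINT r:{0<..t}|lborel. bilinA s (u r) \<phi>)\<bar>
      \<le> M * (nrm \<phi> + semi \<phi>)"
proof -
  define S where "S = (LINT r:{0<..t}|lborel. semi (u r))"
  have "0 \<le> S" unfolding S_def by (simp add: set_lebesgue_integral_def semi_nonneg)
  define M where "M = nrm (u t) + nrm u0 + t * F + Cns (real DIM('a)) s / 2 * S"
  have parts: "0 \<le> nrm (u t)" "0 \<le> nrm u0" "0 \<le> t * F" "0 \<le> Cns (real DIM('a)) s / 2 * S"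
    using nrm_nonneg t F cns_nonneg \<open>0 \<le> S\<close> by auto
  show ?thesis
  proof (rule that[of M])
    show "0 \<le> M" using parts by (simp add: M_def)
    fix \<phi> :: "'a \<Rightarrow> real" assume \<phi>: "\<phi> \<in> Hs s"
    have 1: "\<bar>ip (u t) \<phi>\<bar> \<le> nrm (u t) * nrm \<phi>" "\<bar>ip u0 \<phi>\<bar> \<le> nrm u0 * nrm \<phi>"
      using ip_bound Hs_L2 u_Hs u0_Hs \<phi> by blast+
    have 2: "\<bar>LINT r:{0<..t}|lborel. ip (f r) \<phi>\<bar> \<le> (t * F) * nrm \<phi>"
      using f_integral_bound[OF Hs_L2[OF \<phi>], of 0 t] t by simp
    have "\<bar>LINT r:{0<..t}|lborel. bilinA s (u r) \<phi>\<bar> \<le> (LINT r:{0<..t}|lborel. \<bar>bilinA s (u r) \<phi>\<bar>)"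
      unfolding set_lebesgue_integral_def
      by (rule order.trans[OF integral_abs_bound]) (simp add: abs_mult)
    also have "\<dots> \<le> (LINT r:{0<..t}|lborel. Cns (real DIM('a)) s / 2 * semi \<phi> * semi (u r))"
      using A_bound[OF u_Hs \<phi>]
      by (intro set_integral_mono set_integrable_abs u_A_integrable[OF \<phi> t(2)] set_integrable_mult_right semi_u_integrable1 t)
        (simp add: mult_ac)
    also have "\<dots> = (Cns (real DIM('a)) s / 2 * S) * semi \<phi>"
      by (simp add: S_def)
    finally have 3: "\<bar>LINT r:{0<..t}|lborel. bilinA s (u r) \<phi>\<bar> \<le> (Cns (real DIM('a)) s / 2 * S) * semi \<phi>" .
    have "M * (nrm \<phi> + semi \<phi>) = nrm (u t) * nrm \<phi> + nrm u0 * nrm \<phi> + (t * F) * nrm \<phi> + (Cns (real DIM('a)) s / 2 * S) * semi \<phi>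
      + ((nrm (u t) + nrm u0 + t * F) * semi \<phi> + (Cns (real DIM('a)) s / 2 * S) * nrm \<phi>)"
      by (simp add: M_def algebra_simps)
    moreover have "0 \<le> nrm (u t) + nrm u0 + t * F"
      using parts by simp
    then have "0 \<le> (nrm (u t) + nrm u0 + t * F) * semi \<phi> + (Cns (real DIM('a)) s / 2 * S) * nrm \<phi>"
      using mult_nonneg_nonneg[OF _ semi_nonneg] mult_nonneg_nonneg[OF parts(4) nrm_nonneg] by (meson add_nonneg_nonneg)
    ultimately show "\<bar>ip (u t) \<phi> - ip u0 \<phi> - (LINT r:{0<..t}|lborel. ip (f r) \<phi>) + (LINT r:{0<..t}|lborel. bilinA s (u r) \<phi>)\<bar>
      \<le> M * (nrm \<phi> + semi \<phi>)"
      using 1 2 3 by linarith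
  qed
qed

lemma f_integral_diff:
  assumes "v \<in> Hs s" "w \<in> Hs s"
  shows "(LINT r:{a<..b}|lborel. ip (f r) (\<lambda>x. v x - w x)) = (LINT r:{a<..b}|lborel. ip (f r) v) - (LINT r:{a<..b}|lborel. ip (f r) w)"
  using assms by (simp add: ip_diff_right Hs_L2 f_L2 set_integral_diff(2)[OF f_set_integrable f_set_integrable])

text \<open>The exceptional null set in the weak formulation depends on \<open>\<phi>\<close>; separability removes this dependence, which
  is needed in order to test with the error at time \<open>t\<close> itself.\<close>

lemma weak_all:
  "AE t in lborel. t \<in> {0<..<T} \<longrightarrow> (\<forall>\<phi>\<in>H. ip (u t) \<phi> = ip u0 \<phi> + (LINT r:{0<..t}|lborel. ip (f r) \<phi>)
     - (LINT r:{0<..t}|lborel. bilinA s (u r) \<phi>))"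
proof -
  obtain C where C: "countable C" "C \<subseteq> H" and dense:
    "\<And>v \<epsilon>. v \<in> H \<Longrightarrow> \<epsilon> > 0 \<Longrightarrow> \<exists>w\<in>C. (LINT x|lborel. (v x - w x)^2) < \<epsilon>
      \<and> (LINT p|lborel. (gagliardo_diff s v p - gagliardo_diff s w p)^2) < \<epsilon>"
  proof (rule L2_pair_separable_subset[of H "\<lambda>v. v" "gagliardo_diff s"])
    show "H \<noteq> {}" using V_H by blast
    show "v \<in> L2 lborel" "gagliardo_diff s v \<in> L2 lborel" if "v \<in> H" for v
      using that H_Hs Hs_L2 Hs_gagliardo_L2 by blast+
  qed (rule that, assumption+)
  have "AE t in lborel. \<forall>\<phi>\<in>C. t \<in> {0<..<T} \<longrightarrow> ip (u t) \<phi> = ip u0 \<phi>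
        + (LINT r:{0<..t}|lborel. ip (f r) \<phi> - bilinA s (u r) \<phi>)"
    using C weak by (subst AE_ball_countable) (auto simp: ip_def)
  then show ?thesis
  proof (rule AE_mp, intro AE_I2 impI ballI)
    fix t \<phi> assume all: "\<forall>\<phi>\<in>C. t \<in> {0<..<T} \<longrightarrow> ip (u t) \<phi> = ip u0 \<phi>
        + (LINT r:{0<..t}|lborel. ip (f r) \<phi> - bilinA s (u r) \<phi>)"
      and t: "t \<in> {0<..<T}" and \<phi>: "\<phi> \<in> H"
    define R where "R \<phi> = ip (u t) \<phi> - ip u0 \<phi> - (LINT r:{0<..t}|lborel. ip (f r) \<phi>) + (LINT r:{0<..t}|lborel. bilinA s (u r) \<phi>)" for \<phi>
    obtain M where M: "0 \<le> M" "\<And>\<phi>. \<phi> \<in> Hs s \<Longrightarrow> \<bar>R \<phi>\<bar> \<le> M * (nrm \<phi> + semi \<phi>)"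
      using weak_residual_bound[of t] t unfolding R_def by auto
    have \<phi>s: "\<phi> \<in> Hs s" using \<phi> H_Hs by auto
    have "\<bar>R \<phi>\<bar> \<le> 0"
    proof (rule field_le_epsilon)
      fix \<epsilon> :: real assume "\<epsilon> > 0"
      \<comment> \<open>Chosen so that
        \<open>2 * M * sqrt \<delta> = M * \<epsilon> / (M + 1)\<close>, which is at most
        \<epsilon>, also for \<open>M = 0\<close>.\<close>
      define \<delta> where "\<delta> = (\<epsilon> / (2 * (M + 1)))^2"
      have "\<delta> > 0" using \<open>\<epsilon> > 0\<close> M by (simp add: \<delta>_def)
      then obtain w where w: "w \<in> C" "(LINT x|lborel. (\<phi> x - w x)^2) < \<delta>"
        "(LINT p|lborel. (gagliardo_diff s \<phi> p - gagliardo_diff s w p)^2) < \<delta>"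
        using dense[OF \<phi>] by blast
      have ws: "w \<in> Hs s" using w C H_Hs by auto
      have "R w = 0"
        using all w t u_A_integrable[OF ws, of t] f_set_integrable[OF Hs_L2[OF ws], of 0 t]
        by (simp add: R_def set_integral_diff(2))
      \<comment> \<open>The difference need not belong to \<open>H\<close>, but the bound on
        \<open>R\<close> holds on all of \<open>Hs s\<close>, and this is closed under
        differences.\<close>
      moreover have "R (\<lambda>x. \<phi> x - w x) = R \<phi> - R w"
        using t \<phi>s ws u_A_integrable[OF \<phi>s, of t] u_A_integrable[OF ws, of t]
        by (simp add: R_def ip_diff_right Hs_L2[OF \<phi>s] Hs_L2[OF ws] Hs_L2[OF u_Hs] Hs_L2[OF u0_Hs] u_Hs f_integral_diff bilinA_diff_right set_integral_diff(2))
      ultimately have "\<bar>R \<phi>\<bar> \<le> M * (nrm (\<lambda>x. \<phi> x - w x) + semi (\<lambda>x. \<phi> x - w x))"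
        using M(2)[OF Hs_diff[OF \<phi>s ws]] by simp
      also have "\<dots> \<le> M * (sqrt \<delta> + sqrt \<delta>)"
        using w M(1) unfolding nrm_def semi_def gagliardo_diff_diff
        by (intro mult_left_mono add_mono real_sqrt_le_mono) auto
      also have "\<dots> = M * (\<epsilon> / (M + 1))"
      proof -
        have "sqrt \<delta> = \<epsilon> / (2 * (M + 1))"
          using \<open>\<epsilon> > 0\<close> M(1) by (simp only: \<delta>_def real_sqrt_abs) simp
        then show ?thesis
          using M(1) by (simp add: field_simps)
      qed
      also have "\<dots> \<le> \<epsilon>"
        using \<open>\<epsilon> > 0\<close> M(1) by (simp add: field_simps)
      finally show "\<bar>R \<phi>\<bar> \<le> 0 + \<epsilon>" by simp
    qed
    then show "ip (u t) \<phi> = ip u0 \<phi> + (LINT r:{0<..t}|lborel. ip (f r) \<phi>) - (LINT r:{0<..t}|lborel. bilinA s (u r) \<phi>)"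
      by (simp add: R_def)
  qed
qed


section \<open>The discrete energy estimate\<close>

definition jump :: "nat \<Rightarrow> 'a \<Rightarrow> real" where
  "jump k x = V (Suc k) x - V k x"

lemma jump_Hs: "jump k \<in> Hs s"
  unfolding jump_def [abs_def] by (rule Hs_diff[OF V_Hs V_Hs])

lemma scheme_ip:
  "k < K \<Longrightarrow> \<phi> \<in> H \<Longrightarrow> ip (jump k) \<phi> + \<tau> * bilinA s (V (Suc k)) \<phi>
    = (LINT r:{real k * \<tau><..real (Suc k) * \<tau>}|lborel. ip (f r) \<phi>)"
  using scheme unfolding ip_def jump_def \<tau>_def .

text \<open>The scheme is tested with the jump, that is with \<open>V (Suc k)\<close> and
  \<open>V k\<close>, and the results are subtracted, as the jump itself need not lie in
  \<open>H\<close>. For the form,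
  \<open>2 A(a, a - b) = A(a, a) - A(b, b) + A(a - b, a - b)\<close>, and the last term is
  nonnegative. For the source, Young's inequality absorbs half of the doubled square of the
  jump.\<close>

lemma jump_energy:
  assumes "k < K"
  shows "(nrm (jump k))^2 + \<tau> * (bilinA s (V (Suc k)) (V (Suc k)) - bilinA s (V k) (V k)) \<le> \<tau>^2 * F^2"
proof -
  have j: "jump k = (\<lambda>x. V (Suc k) x - V k x)" by (simp add: jump_def fun_eq_iff)
  define n where "n = nrm (jump k)"
  define J where "J = (LINT r:{real k * \<tau><..real (Suc k) * \<tau>}|lborel. ip (f r) (jump k))"
  have "ip (jump k) (jump k) = ip (jump k) (V (Suc k)) - ip (jump k) (V k)"
    by (subst (2) j, rule ip_diff_right) (intro Hs_L2[OF V_Hs] Hs_L2[OF jump_Hs])+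
  moreover have "bilinA s (V (Suc k)) (jump k) = bilinA s (V (Suc k)) (V (Suc k)) - bilinA s (V (Suc k)) (V k)"
    unfolding j by (intro bilinA_diff_right V_Hs)
  moreover have "J = (LINT r:{real k * \<tau><..real (Suc k) * \<tau>}|lborel. ip (f r) (V (Suc k)))
      - (LINT r:{real k * \<tau><..real (Suc k) * \<tau>}|lborel. ip (f r) (V k))"
    unfolding J_def j by (intro f_integral_diff V_Hs)
  ultimately have eq: "n^2 + \<tau> * bilinA s (V (Suc k)) (jump k) = J"
    using scheme_ip[OF assms V_H, of "Suc k"] scheme_ip[OF assms V_H, of k]
    by (simp add: ip_self n_def right_diff_distrib)
  have "0 \<le> bilinA s (jump k) (jump k)"
    by (rule bilinA_nonneg[OF s])
  also have "\<dots> = bilinA s (V (Suc k)) (jump k) - bilinA s (V k) (jump k)"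
    by (subst j, rule bilinA_diff_left[OF V_Hs V_Hs jump_Hs])
  also have "bilinA s (V k) (jump k) = bilinA s (V (Suc k)) (V k) - bilinA s (V k) (V k)"
    unfolding j by (subst bilinA_diff_right[OF V_Hs V_Hs V_Hs]) (simp add: bilinA_commute)
  finally have "bilinA s (V (Suc k)) (V (Suc k)) - bilinA s (V k) (V k) \<le> 2 * bilinA s (V (Suc k)) (jump k)"
    using \<open>bilinA s (V (Suc k)) (jump k) = _\<close> by simp
  then have 1: "\<tau> * (bilinA s (V (Suc k)) (V (Suc k)) - bilinA s (V k) (V k)) \<le> \<tau> * (2 * bilinA s (V (Suc k)) (jump k))"
    using \<tau>_pos by (intro mult_left_mono) auto
  have "\<bar>J\<bar> \<le> \<tau> * (F * n)"
    using f_integral_bound[OF Hs_L2[OF jump_Hs], of "real k * \<tau>" "real (Suc k) * \<tau>" k] \<tau>_pos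
    unfolding J_def n_def grid_Suc by simp
  moreover have "2 * (\<tau> * (F * n)) \<le> n^2 + \<tau>^2 * F^2"
    using zero_le_power2[of "n - \<tau> * F"] by (simp add: power2_eq_square algebra_simps)
  ultimately show ?thesis
    using eq 1 unfolding n_def[symmetric] by linarith
qed

text \<open>Here the energy of \<open>u0\<close> enters: telescoping leaves
  \<open>A(u0, u0)\<close>, and the final energy is dropped by its sign. The source contributes
  \<open>K\<close> terms of size \<open>\<tau>^2\<close>, hence \<open>\<tau> * T\<close>; the
  overall factor \<tau> is what yields first order.\<close>

lemma jumps_energy: "(\<Sum>k<K. (nrm (jump k))^2) \<le> \<tau> * (bilinA s u0 u0 + T * F^2)"
proof -
  have "(\<Sum>k<K. (nrm (jump k))^2 + \<tau> * (bilinA s (V (Suc k)) (V (Suc k)) - bilinA s (V k) (V k))) \<le> (\<Sum>k<K. \<tau>^2 * F^2)"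
    by (intro sum_mono jump_energy) simp
  then have "(\<Sum>k<K. (nrm (jump k))^2) + \<tau> * (bilinA s (V K) (V K) - bilinA s (V 0) (V 0)) \<le> real K * (\<tau>^2 * F^2)"
    by (simp only: sum.distrib sum_distrib_left[symmetric] sum_lessThan_telescope[of "\<lambda>k. bilinA s (V k) (V k)"])
      (simp add: mult_ac)
  moreover have "0 \<le> \<tau> * bilinA s (V K) (V K)"
    using \<tau>_pos bilinA_nonneg[OF s] by (intro mult_nonneg_nonneg) auto
  moreover have "real K * (\<tau>^2 * F^2) = \<tau> * ((real K * \<tau>) * F^2)"
    by (simp add: power2_eq_square)
  ultimately show ?thesis
    unfolding V_0 K_\<tau> by (simp add: right_diff_distrib distrib_left)
qed

lemma discrete_integrated:
  assumes \<phi>: "\<phi> \<in> H"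
  shows "k \<le> K \<Longrightarrow> ip (V k) \<phi> = ip u0 \<phi> + (LINT r:{0<..real k * \<tau>}|lborel. ip (f r) \<phi>)
    - (LINT r:{0<..real k * \<tau>}|lborel. bilinA s (V (slot r)) \<phi>)"
proof (induction k)
  case 0
  then show ?case by (simp add: V_0 set_lebesgue_integral_def)
next
  case (Suc k)
  have \<phi>s: "\<phi> \<in> Hs s" using \<phi> H_Hs by auto
  have "ip (jump k) \<phi> = ip (V (Suc k)) \<phi> - ip (V k) \<phi>"
    unfolding jump_def [abs_def] by (intro ip_diff_left Hs_L2[OF V_Hs] Hs_L2[OF \<phi>s])
  moreover have "(LINT r:{0<..real (Suc k) * \<tau>}|lborel. ip (f r) \<phi>)
    = (LINT r:{0<..real k * \<tau>}|lborel. ip (f r) \<phi>) + (LINT r:{real k * \<tau><..real (Suc k) * \<tau>}|lborel. ip (f r) \<phi>)"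
    using \<tau>_pos grid_nonneg[of k]
    by (intro set_integral_Ioc_split f_set_integrable Hs_L2[OF \<phi>s]) (simp_all add: grid_Suc)
  moreover have "(LINT r:{0<..real (Suc k) * \<tau>}|lborel. bilinA s (V (slot r)) \<phi>)
    = (LINT r:{0<..real k * \<tau>}|lborel. bilinA s (V (slot r)) \<phi>) + \<tau> * bilinA s (V (Suc k)) \<phi>"
    using slot_integral[of k "real (Suc k) * \<tau>" "\<lambda>n. bilinA s (V n) \<phi>"] grid_le_T[OF Suc.prems] \<tau>_pos
    unfolding grid_Suc by simp
  ultimately show ?case
    using Suc scheme_ip[of k \<phi>] \<phi> by simp
qed

section \<open>The error identity and its integration in time\<close>

lemma err_A_integrable:
  assumes "\<phi> \<in> Hs s" "t < T"
  shows "set_integrable lborel {0<..t} (\<lambda>r. bilinA s (err r) \<phi>)"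
  using set_integral_diff(1)[OF slot_integrable[of t "\<lambda>n. bilinA s (V n) \<phi>"] u_A_integrable[OF assms]] assms(2)
  by (simp add: err_def [abs_def] bilinA_diff_left[OF V_Hs u_Hs assms(1)])

text \<open>Inside a slot the discrete solution already has its final value
  \<open>V (Suc k)\<close>, while its elliptic integral has advanced only by the fraction \<theta>
  of the slot. The scheme trades that fraction of the elliptic term for the same fraction of source
  minus jump, which leaves \<open>1 - \<theta>\<close> of the jump.\<close>

lemma error_identity:
  assumes t: "0 < t" "t < T" and k: "k < K" "real k * \<tau> < t" "t \<le> real (Suc k) * \<tau>" and \<phi>: "\<phi> \<in> H"
    and weak_t: "ip (u t) \<phi> = ip u0 \<phi> + (LINT r:{0<..t}|lborel. ip (f r) \<phi>) - (LINT r:{0<..t}|lborel. bilinA s (u r) \<phi>)"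
  defines "\<theta> \<equiv> (t - real k * \<tau>) / \<tau>"
  shows "ip (err t) \<phi> = (1 - \<theta>) * ip (jump k) \<phi> + \<theta> * (LINT r:{real k * \<tau><..real (Suc k) * \<tau>}|lborel. ip (f r) \<phi>)
    - (LINT r:{real k * \<tau><..t}|lborel. ip (f r) \<phi>) - (LINT r:{0<..t}|lborel. bilinA s (err r) \<phi>)"
proof -
  have \<phi>s: "\<phi> \<in> Hs s" using \<phi> H_Hs by auto
  have 1: "ip (jump k) \<phi> = ip (V (Suc k)) \<phi> - ip (V k) \<phi>"
    unfolding jump_def [abs_def] by (intro ip_diff_left Hs_L2[OF V_Hs] Hs_L2[OF \<phi>s])
  have 2: "ip (err t) \<phi> = ip (V (Suc k)) \<phi> - ip (u t) \<phi>"
    unfolding err_def [abs_def] slot_eq[OF k(2,3)] by (intro ip_diff_left Hs_L2[OF V_Hs] Hs_L2[OF u_Hs] Hs_L2[OF \<phi>s])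
  have 3: "(LINT r:{0<..t}|lborel. ip (f r) \<phi>)
    = (LINT r:{0<..real k * \<tau>}|lborel. ip (f r) \<phi>) + (LINT r:{real k * \<tau><..t}|lborel. ip (f r) \<phi>)"
    using grid_nonneg k by (intro set_integral_Ioc_split f_set_integrable Hs_L2[OF \<phi>s]) auto
  have 4: "(LINT r:{0<..t}|lborel. bilinA s (V (slot r)) \<phi>)
    = (LINT r:{0<..real k * \<tau>}|lborel. bilinA s (V (slot r)) \<phi>) + (t - real k * \<tau>) * bilinA s (V (Suc k)) \<phi>"
    using slot_integral[of k t "\<lambda>n. bilinA s (V n) \<phi>"] t k by simp
  have 5: "(LINT r:{0<..t}|lborel. bilinA s (err r) \<phi>)
    = (LINT r:{0<..t}|lborel. bilinA s (V (slot r)) \<phi>) - (LINT r:{0<..t}|lborel. bilinA s (u r) \<phi>)"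
    using set_integral_diff(2)[OF slot_integrable[of t "\<lambda>n. bilinA s (V n) \<phi>"] u_A_integrable[OF \<phi>s t(2)]] t
    by (simp add: err_def [abs_def] bilinA_diff_left[OF V_Hs u_Hs \<phi>s])
  have 6: "(t - real k * \<tau>) * bilinA s (V (Suc k)) \<phi> = \<theta> * (\<tau> * bilinA s (V (Suc k)) \<phi>)"
    using \<tau>_pos by (simp add: \<theta>_def)
  have 7: "\<tau> * bilinA s (V (Suc k)) \<phi> = (LINT r:{real k * \<tau><..real (Suc k) * \<tau>}|lborel. ip (f r) \<phi>) - ip (jump k) \<phi>"
    using scheme_ip[OF k(1) \<phi>] by simp
  have 8: "(1 - \<theta>) * ip (jump k) \<phi> = ip (jump k) \<phi> - \<theta> * ip (jump k) \<phi>"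
    "\<theta> * ((LINT r:{real k * \<tau><..real (Suc k) * \<tau>}|lborel. ip (f r) \<phi>) - ip (jump k) \<phi>)
     = \<theta> * (LINT r:{real k * \<tau><..real (Suc k) * \<tau>}|lborel. ip (f r) \<phi>) - \<theta> * ip (jump k) \<phi>"
    by (simp_all only: left_diff_distrib right_diff_distrib mult_1)
  show ?thesis
    using discrete_integrated[OF \<phi>, of k] k(1) weak_t 1 2 3 4 5 6 unfolding 7 8 by linarith
qed

text \<open>Testing with the error at time \<open>t\<close> means inserting
  \<open>V (slot t)\<close> and \<open>u t\<close>, both in \<open>H\<close>, and subtracting. This
  is legitimate only because the null set in \<open>weak_all\<close> does not depend on
  \<phi>.\<close>

lemma error_pointwise:
  "AE t in lborel. t \<in> {0<..<T} \<longrightarrow>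
    (nrm (err t))^2 + 2 * (LINT r:{0<..t}|lborel. bilinA s (err r) (err t)) \<le> 8 * \<tau>^2 * F^2 + 2 * (nrm (jump (slot t - 1)))^2"
  using weak_all
proof (rule AE_mp, intro AE_I2 impI)
  fix t assume weak_t: "t \<in> {0<..<T} \<longrightarrow> (\<forall>\<phi>\<in>H. ip (u t) \<phi> = ip u0 \<phi> + (LINT r:{0<..t}|lborel. ip (f r) \<phi>)
     - (LINT r:{0<..t}|lborel. bilinA s (u r) \<phi>))" and t: "t \<in> {0<..<T}"
  obtain k where k: "k < K" "real k * \<tau> < t" "t \<le> real (Suc k) * \<tau>" "slot t = Suc k"
    using slot_cases[of t] t by auto
  define \<theta> where "\<theta> = (t - real k * \<tau>) / \<tau>"
  have \<theta>: "0 \<le> \<theta>" "\<theta> \<le> 1"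
    using k(2,3) \<tau>_pos unfolding \<theta>_def grid_Suc by (simp_all add: pos_divide_le_eq pos_le_divide_eq)
  define R where "R = (\<lambda>\<phi>. (1 - \<theta>) * ip (jump k) \<phi> + \<theta> * (LINT r:{real k * \<tau><..real (Suc k) * \<tau>}|lborel. ip (f r) \<phi>)
    - (LINT r:{real k * \<tau><..t}|lborel. ip (f r) \<phi>))"
  define Z where "Z = (\<lambda>\<phi>. LINT r:{0<..t}|lborel. bilinA s (err r) \<phi>)"
  have id: "ip (err t) \<phi> = R \<phi> - Z \<phi>" if "\<phi> \<in> H" for \<phi>
    using error_identity[OF _ _ k(1-3) that] weak_t t that unfolding R_def Z_def \<theta>_def by auto
  have err: "err t = (\<lambda>x. V (slot t) x - u t x)" by (simp add: err_def fun_eq_iff)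
  have R: "R (err t) = R (V (slot t)) - R (u t)"
    unfolding R_def err by (simp add: f_integral_diff V_Hs u_Hs ip_diff_right Hs_L2[OF V_Hs] Hs_L2[OF u_Hs] Hs_L2[OF jump_Hs] algebra_simps)
  have Z: "Z (err t) = Z (V (slot t)) - Z (u t)"
    using t unfolding Z_def err
    by (simp add: bilinA_diff_right[OF V_Hs u_Hs err_Hs] set_integral_diff(2)[OF err_A_integrable[OF V_Hs] err_A_integrable[OF u_Hs]])
  have "ip (err t) (err t) = ip (err t) (V (slot t)) - ip (err t) (u t)"
    by (subst (2) err, rule ip_diff_right) (intro Hs_L2[OF V_Hs] Hs_L2[OF u_Hs] Hs_L2[OF err_Hs])+
  then have eq: "(nrm (err t))^2 + Z (err t) = R (err t)"
    using id[OF V_H] id[OF u_H] by (simp add: ip_self R Z)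
  define n where "n = nrm (err t)"
  define d where "d = nrm (jump k)"
  have "\<bar>R (err t)\<bar> \<le> d * n + \<tau> * (F * n) + \<tau> * (F * n)"
  proof -
    have "\<bar>(1 - \<theta>) * ip (jump k) (err t)\<bar> \<le> 1 * (d * n)"
      unfolding abs_mult d_def n_def using \<theta> ip_bound[OF Hs_L2[OF jump_Hs] Hs_L2[OF err_Hs]]
      by (intro mult_mono) auto
    moreover have "\<bar>\<theta> * (LINT r:{real k * \<tau><..real (Suc k) * \<tau>}|lborel. ip (f r) (err t))\<bar> \<le> 1 * (\<tau> * (F * n))"
      unfolding abs_mult n_def using \<theta> \<tau>_pos f_integral_bound[OF Hs_L2[OF err_Hs], of "real k * \<tau>" "real (Suc k) * \<tau>" t]
      unfolding grid_Suc by (intro mult_mono) auto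
    moreover have "\<bar>LINT r:{real k * \<tau><..t}|lborel. ip (f r) (err t)\<bar> \<le> \<tau> * (F * n)"
    proof -
      have "\<bar>LINT r:{real k * \<tau><..t}|lborel. ip (f r) (err t)\<bar> \<le> (t - real k * \<tau>) * (F * n)"
        unfolding n_def using k by (intro f_integral_bound Hs_L2[OF err_Hs]) auto
      also have "\<dots> \<le> \<tau> * (F * n)"
        using k(3) F nrm_nonneg[of "err t"] unfolding n_def grid_Suc by (intro mult_right_mono) auto
      finally show ?thesis .
    qed
    ultimately show ?thesis unfolding R_def by linarith
  qed
  note R_bound = this
  \<comment> \<open>Young's inequality \<open>2 * n * y \<le> n^2 + y^2\<close> with
    \<open>y = d + 2 * \<tau> * F\<close> returns one of the two copies of \<open>n^2\<close>; then
    \<open>y^2 \<le> 2 * d^2 + 8 * \<tau>^2 * F^2\<close>. This is the origin of the 8.\<close>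
  define Y where "Y = (d + 2 * \<tau> * F)^2"
  define X where "X = d * n + \<tau> * (F * n) + \<tau> * (F * n)"
  have "2 * X \<le> n^2 + Y"
    using zero_le_power2[of "n - (d + 2 * \<tau> * F)"] by (simp add: X_def Y_def power2_eq_square algebra_simps)
  moreover have "Y \<le> 8 * \<tau>^2 * F^2 + 2 * d^2"
    using zero_le_power2[of "d - 2 * \<tau> * F"] by (simp add: Y_def power2_eq_square algebra_simps)
  moreover have "R (err t) \<le> X"
    using R_bound by (simp add: X_def)
  moreover have "n^2 + Z (err t) = R (err t)"
    using eq by (simp add: n_def)
  ultimately have "n^2 + 2 * Z (err t) \<le> 8 * \<tau>^2 * F^2 + 2 * d^2"
    by linarith
  then show "(nrm (err t))^2 + 2 * (LINT r:{0<..t}|lborel. bilinA s (err r) (err t)) \<le> 8 * \<tau>^2 * F^2 + 2 * (nrm (jump (slot t - 1)))^2"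
    by (simp add: n_def d_def Z_def k(4))
qed

lemma err_measurable: "(\<lambda>p. err (fst p) (snd p)) \<in> borel_measurable (lborel \<Otimes>\<^sub>M lborel)"
proof -
  have [measurable]: "V k \<in> borel_measurable borel" for k
    using V_Hs by (rule Hs_measurable)
  note u_measurable[measurable]
  have "(\<lambda>p. V (slot (fst p)) (snd p)) \<in> borel_measurable (lborel \<Otimes>\<^sub>M lborel)"
    by (rule measurable_compose_countable[where g="\<lambda>p. slot (fst p)"]) measurable
  then show ?thesis
    unfolding err_def by measurable
qed

lemma err_set_integrable:
  "set_integrable lborel {0<..<T} (\<lambda>t. (semi (err t))^2)" "set_integrable lborel {0<..<T} (\<lambda>t. (nrm (err t))^2)"
proof -
  have bound: "set_integrable lborel {0<..<T} g"
    if g: "g \<in> borel_measurable borel" "\<And>t. 0 \<le> g t" and w: "set_integrable lborel {0<..<T} w"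
      and le: "\<And>t. g t \<le> 2 * p (slot t) + 2 * w t" for g w :: "real \<Rightarrow> real" and p
  proof -
    have "set_integrable lborel {0<..<T} (\<lambda>t. p (slot t))"
      by (rule set_integrable_subset[OF slot_integrable[of T]]) auto
    then have "set_integrable lborel {0<..<T} (\<lambda>t. 2 * p (slot t) + 2 * w t)"
      using w by (intro set_integral_add(1) set_integrable_mult_right)
    then show ?thesis
      unfolding set_integrable_def
      by (rule Bochner_Integration.integrable_bound)
        (use g in \<open>auto simp: indicator_def intro!: order.trans[OF le] abs_ge_self\<close>)
  qed
  have sum: "(LINT x|lborel. (v x - w x)^2) \<le> 2 * (LINT x|lborel. (v x)^2) + 2 * (LINT x|lborel. (w x)^2)"
    if "v \<in> L2 lborel" "w \<in> L2 lborel" for v w :: "'b::euclidean_space \<Rightarrow> real"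
    using L2_add_square_le[OF that(1) L2_scale[OF that(2), of "-1"]] by simp
  show "set_integrable lborel {0<..<T} (\<lambda>t. (semi (err t))^2)"
  proof (rule bound[where p="\<lambda>k. (semi (V k))^2", OF _ _ semi_u_integrable])
    show "(\<lambda>t. (semi (err t))^2) \<in> borel_measurable borel"
      using semi_measurable[OF err_measurable] by simp
    show "(semi (err t))^2 \<le> 2 * (semi (V (slot t)))^2 + 2 * (semi (u t))^2" for t
      using sum[OF Hs_gagliardo_L2[OF V_Hs] Hs_gagliardo_L2[OF u_Hs]]
      by (simp add: semi_def err_def [abs_def] gagliardo_diff_diff)
  qed simp
  show "set_integrable lborel {0<..<T} (\<lambda>t. (nrm (err t))^2)"
  proof (rule bound[where p="\<lambda>k. (nrm (V k))^2", OF _ _ nrm_u_integrable])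
    show "(\<lambda>t. (nrm (err t))^2) \<in> borel_measurable borel"
      using nrm_measurable[OF err_measurable] by simp
    show "(nrm (err t))^2 \<le> 2 * (nrm (V (slot t)))^2 + 2 * (nrm (u t))^2" for t
      using sum[OF Hs_L2[OF V_Hs] Hs_L2[OF u_Hs]]
      by (simp add: nrm_def err_def [abs_def])
  qed simp
qed

text \<open>The positivity of the time kernel is applied to the difference quotient of the error,
  with the product space in the role of the space variable. The result is the form up to the factor
  \<open>Cns / 2\<close>.\<close>

lemma err_energy_integral:
  "set_integrable lborel {0<..<T} (\<lambda>t. LINT r:{0<..t}|lborel. bilinA s (err r) (err t))"
  "0 \<le> (LINT t:{0<..<T}|lborel. LINT r:{0<..t}|lborel. bilinA s (err r) (err t))"
proof -
  define I where "I = (\<lambda>t. LINT r|lborel. indicator {..<t} r * (LINT p|lborel.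
    (indicator {0<..<T} r * gagliardo_diff s (err r) p) * (indicator {0<..<T} t * gagliardo_diff s (err t) p)))"
  have m: "(\<lambda>p. gagliardo_diff s (err (fst p)) (snd p)) \<in> borel_measurable (lborel \<Otimes>\<^sub>M lborel)"
    using gagliardo_diff_measurable[of err lborel s] err_measurable by simp
  have fin: "(\<integral>\<^sup>+t\<in>{0<..<T}. (\<integral>\<^sup>+p. ennreal ((gagliardo_diff s (err t) p)^2) \<partial>lborel) \<partial>lborel) < \<infinity>"
  proof -
    have "(\<integral>\<^sup>+t\<in>{0<..<T}. (\<integral>\<^sup>+p. ennreal ((gagliardo_diff s (err t) p)^2) \<partial>lborel) \<partial>lborel)
      = (\<integral>\<^sup>+t. ennreal (norm (indicator {0<..<T} t *\<^sub>R (semi (err t))^2)) \<partial>lborel)"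
      by (intro nn_integral_cong) (auto simp: indicator_def L2_nn_integral[OF Hs_gagliardo_L2[OF err_Hs]] semi_def)
    then show ?thesis
      using err_set_integrable(1) unfolding set_integrable_def integrable_iff_bounded by simp
  qed
  have I: "integrable lborel I" "0 \<le> (LINT t|lborel. I t)"
    using time_kernel_nonneg[OF lborel.sigma_finite_measure_axioms _ _ m fin] T unfolding I_def by auto
  have eq: "indicator {0<..<T} t *\<^sub>R (LINT r:{0<..t}|lborel. bilinA s (err r) (err t)) = Cns (real DIM('a)) s / 2 * I t" for t
  proof (cases "t \<in> {0<..<T}")
    case True
    have "(LINT r:{0<..t}|lborel. bilinA s (err r) (err t)) = (LINT r|lborel. Cns (real DIM('a)) s / 2 * (indicator {..<t} r * (LINT p|lborel.
      (indicator {0<..<T} r * gagliardo_diff s (err r) p) * (indicator {0<..<T} t * gagliardo_diff s (err t) p))))"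
      unfolding set_lebesgue_integral_def
    proof (rule integral_cong_AE)
      have [measurable]: "(\<lambda>r. bilinA s (err r) (err t)) \<in> borel_measurable borel"
        by (rule A_measurable[OF err_measurable Hs_measurable[OF err_Hs]])
      have ind: "Cns (real DIM('a)) s / 2 * (indicator {..<t} r * (LINT p|lborel.
        (indicator {0<..<T} r * gagliardo_diff s (err r) p) * (indicator {0<..<T} t * gagliardo_diff s (err t) p)))
        = indicator {0<..<t} r * bilinA s (err r) (err t)" for r
        using True by (auto simp: indicator_def bilinA_eq)
      show "(\<lambda>r. indicator {0<..t} r *\<^sub>R bilinA s (err r) (err t)) \<in> borel_measurable lborel" by measurable
      show "(\<lambda>r. Cns (real DIM('a)) s / 2 * (indicator {..<t} r * (LINT p|lborel.
        (indicator {0<..<T} r * gagliardo_diff s (err r) p) * (indicator {0<..<T} t * gagliardo_diff s (err t) p)))) \<in> borel_measurable lborel"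
        unfolding ind by measurable
      \<comment> \<open>The kernel lemma integrates over \<open>r < t\<close>, here
        \<open>r \<le> t\<close>; the point \<open>r = t\<close> is null.\<close>
      show "AE r in lborel. indicator {0<..t} r *\<^sub>R bilinA s (err r) (err t) = Cns (real DIM('a)) s / 2 * (indicator {..<t} r * (LINT p|lborel.
        (indicator {0<..<T} r * gagliardo_diff s (err r) p) * (indicator {0<..<T} t * gagliardo_diff s (err t) p)))"
        unfolding ind using AE_lborel_singleton[of t] by (rule AE_mp) (auto intro!: AE_I2 simp: indicator_def)
    qed
    then show ?thesis using True by (simp add: I_def)
  next
    case False
    then show ?thesis by (simp add: I_def)
  qed
  show "set_integrable lborel {0<..<T} (\<lambda>t. LINT r:{0<..t}|lborel. bilinA s (err r) (err t))"
    unfolding set_integrable_def eq using I(1) by (rule integrable_mult_right)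
  show "0 \<le> (LINT t:{0<..<T}|lborel. LINT r:{0<..t}|lborel. bilinA s (err r) (err t))"
    unfolding set_lebesgue_integral_def[of _ "{0<..<T}"] eq using I cns_nonneg by simp
qed

text \<open>After dropping the elliptic term, the constant part contributes
  \<open>8 * T * \<tau>^2 * F^2\<close>, and the jumps, each held for time \<tau>, contribute
  \<open>2 * \<tau> * \<tau> * (A(u0, u0) + T * F^2)\<close>. So the 10 is 8 + 2.\<close>

lemma error_estimate:
  "(\<integral>\<^sup>+t\<in>{0<..<T}. (\<integral>\<^sup>+x. ennreal ((err t x)^2) \<partial>lborel) \<partial>lborel)
    \<le> ennreal (\<tau>^2 * (10 * T * F^2 + 2 * bilinA s u0 u0))"
proof -
  \<comment> \<open>The index shift undoes \<open>slot t = Suc k\<close>; \<open>P 0\<close> never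
    occurs, since slots on (0, T] are at least 1.\<close>
  define P where "P k = (nrm (jump (k - 1)))^2" for k
  have P_int: "set_integrable lborel {0<..T} (\<lambda>t. P (slot t))"
    by (rule slot_integrable) simp
  then have P_int': "set_integrable lborel {0<..<T} (\<lambda>t. P (slot t))"
    by (rule set_integrable_subset) auto
  have const: "set_integrable lborel {0<..<T} (\<lambda>t. 8 * \<tau>^2 * F^2)"
    using T by (auto simp: set_integrable_def)
  have "(LINT t:{0<..<T}|lborel. (nrm (err t))^2 + 2 * (LINT r:{0<..t}|lborel. bilinA s (err r) (err t)))
    \<le> (LINT t:{0<..<T}|lborel. 8 * \<tau>^2 * F^2 + 2 * P (slot t))"
    unfolding P_def
    by (rule set_integral_mono_AE)
      (intro set_integral_add(1) set_integrable_mult_right err_set_integrable err_energy_integral const P_int'[unfolded P_def] error_pointwise)+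
  moreover have "(LINT t:{0<..<T}|lborel. (nrm (err t))^2 + 2 * (LINT r:{0<..t}|lborel. bilinA s (err r) (err t)))
    = (LINT t:{0<..<T}|lborel. (nrm (err t))^2) + 2 * (LINT t:{0<..<T}|lborel. LINT r:{0<..t}|lborel. bilinA s (err r) (err t))"
    using err_set_integrable(2) err_energy_integral(1) by (simp add: set_integral_add(2))
  moreover have "(LINT t:{0<..<T}|lborel. 8 * \<tau>^2 * F^2 + 2 * P (slot t))
    = T * (8 * \<tau>^2 * F^2) + 2 * (LINT t:{0<..<T}|lborel. P (slot t))"
  proof -
    have "(LINT t:{0<..<T}|lborel. 8 * \<tau>^2 * F^2) = T * (8 * \<tau>^2 * F^2)"
      using T by (simp add: set_lebesgue_integral_def)
    then show ?thesis
      using const P_int' by (simp add: set_integral_add(2) set_integrable_mult_right)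
  qed
  moreover have "(LINT t:{0<..<T}|lborel. P (slot t)) \<le> \<tau> * (\<tau> * (bilinA s u0 u0 + T * F^2))"
  proof -
    have "(LINT t:{0<..<T}|lborel. P (slot t)) \<le> (LINT t:{0<..T}|lborel. P (slot t))"
      unfolding set_lebesgue_integral_def
      by (rule integral_mono) (use P_int P_int' in \<open>auto simp: set_integrable_def indicator_def P_def\<close>)
    also have "\<dots> = \<tau> * (\<Sum>k<K. (nrm (jump k))^2)"
      using slot_integral_grid[of K P] by (simp add: P_def K_\<tau>)
    also have "\<dots> \<le> \<tau> * (\<tau> * (bilinA s u0 u0 + T * F^2))"
      using jumps_energy \<tau>_pos by (intro mult_left_mono) auto
    finally show ?thesis .
  qed
  ultimately have main: "(LINT t:{0<..<T}|lborel. (nrm (err t))^2) \<le> \<tau>^2 * (10 * T * F^2 + 2 * bilinA s u0 u0)"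
    using err_energy_integral(2) by (simp add: power2_eq_square algebra_simps)
  have "(\<integral>\<^sup>+t\<in>{0<..<T}. (\<integral>\<^sup>+x. ennreal ((err t x)^2) \<partial>lborel) \<partial>lborel)
    = (\<integral>\<^sup>+t. ennreal (indicator {0<..<T} t *\<^sub>R (nrm (err t))^2) \<partial>lborel)"
    by (intro nn_integral_cong) (auto simp: indicator_def L2_nn_integral[OF Hs_L2[OF err_Hs]] nrm_def)
  also have "\<dots> = ennreal (LINT t:{0<..<T}|lborel. (nrm (err t))^2)"
    unfolding set_lebesgue_integral_def using err_set_integrable(2) unfolding set_integrable_def
    by (intro nn_integral_eq_integral) auto
  also have "\<dots> \<le> ennreal (\<tau>^2 * (10 * T * F^2 + 2 * bilinA s u0 u0))"
    by (rule ennreal_leI[OF main])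
  finally show ?thesis .
qed

end

section \<open>From weak solutions to representatives\<close>

lemma test_fun_real_deriv:
  fixes \<psi> :: "real \<Rightarrow> real"
  assumes "test_fun S \<psi>"
  shows "(\<psi> has_real_derivative deriv \<psi> t) (at t)" and "continuous_on UNIV (deriv \<psi>)"
proof -
  have ck: "C_k (Suc 0) \<psi>"
    using assms by (auto simp: test_fun_def smooth_fun_def)
  show der: "(\<psi> has_real_derivative deriv \<psi> t) (at t)" for t
    using ck by (auto simp: DERIV_deriv_iff_real_differentiable)
  have "frechet_derivative \<psi> (at t) 1 = deriv \<psi> t" for t
    using frechet_derivative_real[OF der, of t 1] by simp
  then have "deriv \<psi> = (\<lambda>t. frechet_derivative \<psi> (at t) 1)"
    by (simp add: fun_eq_iff)
  then show "continuous_on UNIV (deriv \<psi>)"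
    using ck by simp
qed

text \<open>Continuity of the primitive at 0, by dominated convergence along shrinking cut-offs. It
  lets the initial value survive the subtraction of the primitive.\<close>

lemma set_integral_Ioc_small:
  fixes k :: "real \<Rightarrow> real"
  assumes "0 < T" and k: "set_integrable lborel {0<..<T} k" and "0 < \<epsilon>"
  shows "\<exists>\<delta>>0. \<forall>t. 0 < t \<and> t < \<delta> \<and> t < T \<longrightarrow> \<bar>LINT r:{0<..t}|lborel. k r\<bar> \<le> \<epsilon>"
proof -
  define w where "w r = indicator {0<..<T} r *\<^sub>R k r" for r
  have w: "integrable lborel w"
    using k unfolding set_integrable_def w_def .
  have "(\<lambda>n. LINT r|lborel. indicator {0<..1 / (real n + 1)} r * \<bar>w r\<bar>) \<longlonglongrightarrow> (LINT r::real|lborel. 0)"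
  proof (rule integral_dominated_convergence[where w="\<lambda>r. \<bar>w r\<bar>"])
    show "AE r in lborel. (\<lambda>n. indicator {0<..1 / (real n + 1)} r * \<bar>w r\<bar>) \<longlonglongrightarrow> 0"
    proof (rule AE_I2)
      fix r :: real
      show "(\<lambda>n. indicator {0<..1 / (real n + 1)} r * \<bar>w r\<bar>) \<longlonglongrightarrow> 0"
      proof (cases "0 < r")
        case True
        have "(\<lambda>n. 1 / (real n + 1)) \<longlonglongrightarrow> 0"
          using LIMSEQ_inverse_real_of_nat by (simp add: inverse_eq_divide add.commute)
        then have "\<forall>\<^sub>F n in sequentially. 1 / (real n + 1) < r"
          using True by (rule order_tendstoD(2))
        then have "\<forall>\<^sub>F n in sequentially. indicator {0<..1 / (real n + 1)} r * \<bar>w r\<bar> = 0"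
          by (rule eventually_mono) (auto simp: indicator_def)
        then show ?thesis by (rule tendsto_eventually)
      qed simp
    qed
  qed (use w in \<open>auto simp: indicator_def\<close>)
  then have "\<forall>\<^sub>F n in sequentially. (LINT r|lborel. indicator {0<..1 / (real n + 1)} r * \<bar>w r\<bar>) < \<epsilon>"
    using \<open>0 < \<epsilon>\<close> by (intro order_tendstoD(2)) auto
  then obtain n where n: "(LINT r|lborel. indicator {0<..1 / (real n + 1)} r * \<bar>w r\<bar>) < \<epsilon>"
    by (auto simp: eventually_sequentially)
  show ?thesis
  proof (intro exI[of _ "1 / (real n + 1)"] conjI allI impI)
    fix t assume t: "0 < t \<and> t < 1 / (real n + 1) \<and> t < T"
    have "\<bar>LINT r:{0<..t}|lborel. k r\<bar> \<le> (LINT r|lborel. \<bar>indicator {0<..t} r *\<^sub>R k r\<bar>)"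
      unfolding set_lebesgue_integral_def by (rule integral_abs_bound)
    also have "\<dots> \<le> (LINT r|lborel. indicator {0<..1 / (real n + 1)} r * \<bar>w r\<bar>)"
    proof (rule integral_mono)
      have "set_integrable lborel {0<..t} k"
        by (rule set_integrable_subset[OF k]) (use t in auto)
      then show "integrable lborel (\<lambda>r. \<bar>indicator {0<..t} r *\<^sub>R k r\<bar>)"
        unfolding set_integrable_def by (rule integrable_abs)
      show "integrable lborel (\<lambda>r. indicator {0<..1 / (real n + 1)} r * \<bar>w r\<bar>)"
        by (rule Bochner_Integration.integrable_bound[OF w]) (use w in \<open>auto simp: indicator_def\<close>)
      show "\<bar>indicator {0<..t} r *\<^sub>R k r\<bar> \<le> indicator {0<..1 / (real n + 1)} r * \<bar>w r\<bar>" for r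
        using t by (auto simp: indicator_def w_def)
    qed
    also have "\<dots> \<le> \<epsilon>" using n by simp
    finally show "\<bar>LINT r:{0<..t}|lborel. k r\<bar> \<le> \<epsilon>" .
  qed (simp add: add_nonneg_pos)
qed

text \<open>Subtracting the primitive \<open>P\<close> of \<open>k\<close> leaves a function with
  vanishing weak derivative and the same initial value, so
  \<open>weak_derivative_zero_imp_const\<close> applies. As \<open>k\<close> is merely integrable,
  the integration by parts for \<open>P\<close> is a Fubini exchange over
  \<open>r \<le> t\<close>.\<close>

lemma weak_derivative_imp_primitive:
  fixes g k :: "real \<Rightarrow> real"
  assumes "0 < T" and g: "set_integrable lborel {0<..<T} g" and k: "set_integrable lborel {0<..<T} k"
    and weak: "\<And>\<psi>. test_fun {0<..<T} \<psi> \<Longrightarrow>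
      (LINT t:{0<..<T}|lborel. g t * deriv \<psi> t) = - (LINT t:{0<..<T}|lborel. k t * \<psi> t)"
    and init: "\<And>\<epsilon>. \<epsilon> > 0 \<Longrightarrow> \<exists>\<delta>>0. AE t in lborel. 0 < t \<and> t < \<delta> \<and> t < T \<longrightarrow> \<bar>g t - c\<bar> \<le> \<epsilon>"
  shows "AE t in lborel. t \<in> {0<..<T} \<longrightarrow> g t = c + (LINT r:{0<..t}|lborel. k r)"
proof -
  define w where "w r = indicator {0<..<T} r *\<^sub>R k r" for r
  have w: "integrable lborel w"
    using k unfolding set_integrable_def w_def .
  then have wm[measurable]: "w \<in> borel_measurable borel" by auto
  define P where "P t = (LINT r|lborel. indicator {0<..t} r * w r)" for t
  have "(\<lambda>t. LINT r|lborel. (if 0 < r \<and> r \<le> t then 1 else 0) * w r) \<in> borel_measurable lborel"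
    by (rule lborel.borel_measurable_lebesgue_integral) (simp add: case_prod_beta, measurable)
  then have Pm[measurable]: "P \<in> borel_measurable borel"
    unfolding P_def by (simp add: indicator_def of_bool_def)
  have P_bound: "\<bar>P t\<bar> \<le> (LINT r|lborel. \<bar>w r\<bar>)" for t
  proof -
    have "\<bar>P t\<bar> \<le> (LINT r|lborel. \<bar>indicator {0<..t} r * w r\<bar>)"
      unfolding P_def by (rule integral_abs_bound)
    also have "\<dots> \<le> (LINT r|lborel. \<bar>w r\<bar>)"
      by (rule integral_mono) (use w in \<open>auto simp: indicator_def intro: Bochner_Integration.integrable_bound[OF w]\<close>)
    finally show ?thesis .
  qed
  have P_eq: "P t = (LINT r:{0<..t}|lborel. k r)" if "t < T" for t
    unfolding P_def set_lebesgue_integral_def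
    by (rule Bochner_Integration.integral_cong) (use that in \<open>auto simp: w_def indicator_def\<close>)
  have P_int: "set_integrable lborel {0<..<T} P"
    unfolding set_integrable_def
  proof (rule Bochner_Integration.integrable_bound)
    show "integrable lborel (\<lambda>t. indicator {0<..<T} t * (LINT r|lborel. \<bar>w r\<bar>))"
      using \<open>0 < T\<close> by auto
  qed (use P_bound in \<open>auto simp: indicator_def intro!: order.trans[OF P_bound]\<close>)
  have "AE t in lborel. t \<in> {0<..<T} \<longrightarrow> g t - P t = c"
  proof (rule weak_derivative_zero_imp_const[OF \<open>0 < T\<close>])
    show "set_integrable lborel {0<..<T} (\<lambda>t. g t - P t)"
      using g P_int by (rule set_integral_diff(1))
    fix \<epsilon> :: real assume "\<epsilon> > 0"
    then have "\<epsilon> / 2 > 0" by simp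
    obtain \<delta> where \<delta>: "\<delta> > 0" "AE t in lborel. 0 < t \<and> t < \<delta> \<and> t < T \<longrightarrow> \<bar>g t - c\<bar> \<le> \<epsilon> / 2"
      using init[OF \<open>\<epsilon> / 2 > 0\<close>] by blast
    obtain \<delta>' where \<delta>': "\<delta>' > 0" "\<And>t. 0 < t \<and> t < \<delta>' \<and> t < T \<Longrightarrow> \<bar>LINT r:{0<..t}|lborel. k r\<bar> \<le> \<epsilon> / 2"
      using set_integral_Ioc_small[OF \<open>0 < T\<close> k \<open>\<epsilon> / 2 > 0\<close>] by blast
    have "AE t in lborel. 0 < t \<and> t < min \<delta> \<delta>' \<and> t < T \<longrightarrow> \<bar>g t - P t - c\<bar> \<le> \<epsilon>"
      using \<delta>(2)
    proof (rule AE_mp, intro AE_I2 impI)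
      fix t assume *: "0 < t \<and> t < \<delta> \<and> t < T \<longrightarrow> \<bar>g t - c\<bar> \<le> \<epsilon> / 2" and t: "0 < t \<and> t < min \<delta> \<delta>' \<and> t < T"
      have "\<bar>P t\<bar> \<le> \<epsilon> / 2" using \<delta>'(2)[of t] t P_eq[of t] by simp
      moreover have "\<bar>g t - c\<bar> \<le> \<epsilon> / 2" using * t by simp
      ultimately show "\<bar>g t - P t - c\<bar> \<le> \<epsilon>" by linarith
    qed
    then show "\<exists>\<delta>>0. AE t in lborel. 0 < t \<and> t < \<delta> \<and> t < T \<longrightarrow> \<bar>g t - P t - c\<bar> \<le> \<epsilon>"
      using \<delta>(1) \<delta>'(1) by (intro exI[of _ "min \<delta> \<delta>'"]) simp
  next
    fix \<psi> assume \<psi>: "test_fun {0<..<T} \<psi>"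
    note der = test_fun_real_deriv(1)[OF \<psi>] and cont = test_fun_real_deriv(2)[OF \<psi>]
    have dm[measurable]: "deriv \<psi> \<in> borel_measurable borel"
      by (rule borel_measurable_continuous_onI[OF cont])
    have \<psi>T: "\<psi> T = 0"
      using \<psi> closure_subset[of "{x. \<psi> x \<noteq> 0}"] unfolding test_fun_def by force
    define d where "d t = indicator {0<..<T} t * deriv \<psi> t" for t
    have "bounded (deriv \<psi> ` {0..T})"
      by (intro compact_imp_bounded compact_continuous_image continuous_on_subset[OF cont]) auto
    then obtain B where B: "\<And>t. t \<in> {0..T} \<Longrightarrow> \<bar>deriv \<psi> t\<bar> \<le> B"
      unfolding bounded_iff by (auto simp del: atLeastAtMost_iff)
    have mult_int: "set_integrable lborel {0<..<T} (\<lambda>t. h t * deriv \<psi> t)" if h: "set_integrable lborel {0<..<T} h" for h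
      unfolding set_integrable_def
    proof (rule Bochner_Integration.integrable_bound)
      show "integrable lborel (\<lambda>t. B * (indicator {0<..<T} t *\<^sub>R h t))"
        using h unfolding set_integrable_def by (rule integrable_mult_right)
      have "(\<lambda>t. (indicator {0<..<T} t *\<^sub>R h t) * deriv \<psi> t) \<in> borel_measurable lborel"
        using h unfolding set_integrable_def by (intro borel_measurable_times) auto
      then show "(\<lambda>t. indicator {0<..<T} t *\<^sub>R (h t * deriv \<psi> t)) \<in> borel_measurable lborel"
        by (simp add: mult.assoc)
      show "AE t in lborel. norm (indicator {0<..<T} t *\<^sub>R (h t * deriv \<psi> t)) \<le> norm (B * (indicator {0<..<T} t *\<^sub>R h t))"
      proof (rule AE_I2)
        fix t
        show "norm (indicator {0<..<T} t *\<^sub>R (h t * deriv \<psi> t)) \<le> norm (B * (indicator {0<..<T} t *\<^sub>R h t))"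
          using B[of t] mult_left_mono[of "\<bar>deriv \<psi> t\<bar>" "\<bar>B\<bar>" "\<bar>h t\<bar>"] by (auto simp: indicator_def abs_mult mult.commute)
      qed
    qed
    have d_int: "integrable lborel d"
      using mult_int[of "\<lambda>_. 1"] \<open>0 < T\<close> by (simp add: set_integrable_def d_def [abs_def])
    then have d_m[measurable]: "d \<in> borel_measurable borel" by auto
    define \<Phi> where "\<Phi> t r = (if 0 < r \<and> r \<le> t then 1 else 0) * (d t * w r)" for t r :: real
    have "integrable (lborel \<Otimes>\<^sub>M lborel) (\<lambda>p. d (fst p) * w (snd p))"
      by (rule lborel_pair.Fubini_integrable) (use d_int w in \<open>auto simp: abs_mult intro!: AE_I2\<close>)
    moreover have "case_prod \<Phi> \<in> borel_measurable (lborel \<Otimes>\<^sub>M lborel)"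
      unfolding \<Phi>_def case_prod_beta by measurable
    ultimately have \<Phi>_int: "integrable (lborel \<Otimes>\<^sub>M lborel) (case_prod \<Phi>)"
      by (rule Bochner_Integration.integrable_bound)
        (auto simp: \<Phi>_def case_prod_beta intro!: AE_I2)
    \<comment> \<open>After the exchange the time integral of \<psi>' runs from \<open>r\<close> to
      \<open>T\<close>, and \<psi> vanishes at \<open>T\<close>; this produces the minus
      sign.\<close>
    have inner: "(LINT t|lborel. \<Phi> t r) = - (w r * \<psi> r)" for r
    proof (cases "0 < r \<and> r < T")
      case True
      have "(LINT t|lborel. \<Phi> t r) = (LINT t|lborel. w r * (deriv \<psi> t * indicator {r..T} t))"
      proof (rule integral_cong_AE)
        show "AE t in lborel. \<Phi> t r = w r * (deriv \<psi> t * indicator {r..T} t)"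
          using AE_lborel_singleton[of T]
          by (rule AE_mp) (use True in \<open>auto intro!: AE_I2 simp: \<Phi>_def d_def indicator_def\<close>)
      qed (auto simp: \<Phi>_def)
      also have "\<dots> = w r * (\<psi> T - \<psi> r)"
        using True der continuous_on_eq_continuous_at[of UNIV "deriv \<psi>"] cont
        by (simp add: integral_FTC_Icc_real[of r T \<psi> "deriv \<psi>"])
      finally show ?thesis by (simp add: \<psi>T)
    next
      case False
      then have "w r = 0" by (auto simp: w_def)
      then show ?thesis by (simp add: \<Phi>_def)
    qed
    have "(LINT t:{0<..<T}|lborel. P t * deriv \<psi> t) = (LINT t|lborel. LINT r|lborel. \<Phi> t r)"
      unfolding set_lebesgue_integral_def
    proof (rule Bochner_Integration.integral_cong[OF refl])
      fix t
      have "(LINT r|lborel. \<Phi> t r) = (LINT r|lborel. d t * (indicator {0<..t} r * w r))"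
        by (rule Bochner_Integration.integral_cong) (auto simp: \<Phi>_def indicator_def)
      then show "indicator {0<..<T} t *\<^sub>R (P t * deriv \<psi> t) = (LINT r|lborel. \<Phi> t r)"
        by (simp add: P_def d_def)
    qed
    also have "\<dots> = (LINT r|lborel. LINT t|lborel. \<Phi> t r)"
      by (rule lborel_pair.Fubini_integral[OF \<Phi>_int, symmetric])
    also have "\<dots> = - (LINT r:{0<..<T}|lborel. k r * \<psi> r)"
      by (simp add: inner set_lebesgue_integral_def w_def mult.assoc)
    finally have "(LINT t:{0<..<T}|lborel. P t * deriv \<psi> t) = (LINT t:{0<..<T}|lborel. g t * deriv \<psi> t)"
      using weak[OF \<psi>] by simp
    then show "(LINT t:{0<..<T}|lborel. (g t - P t) * deriv \<psi> t) = 0"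
      unfolding left_diff_distrib by (simp add: set_integral_diff(2) mult_int g P_int)
  qed
  then show ?thesis
    by (rule AE_mp) (auto intro!: AE_I2 simp: P_eq)
qed

text \<open>For one fixed \<phi> the functional \<open>w t\<close> enters only through its value at
  \<phi>, which the equation identifies with source minus form for almost every \<open>t\<close>.
  The function of time \<open>(u' t, \<phi>)\<close> thus has an integrable weak derivative, and its
  initial value comes from the essential limit in \<open>L2\<close>.\<close>

lemma weak_solution_integrated:
  fixes \<Omega> :: "'a::euclidean_space set" and u f :: "real \<Rightarrow> 'a \<Rightarrow> real"
  assumes s: "0 < s" "s < 1" and T: "0 < T" and \<Omega>: "\<Omega> \<in> sets borel" and u0: "u0 \<in> tildeH s \<Omega>"
    and weak: "weak_solution s \<Omega> T u0 f u" and \<phi>: "\<phi> \<in> tildeH s \<Omega>"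
    and u'_H: "\<And>t. u' t \<in> tildeH s \<Omega>" and u'_eq: "AE t in lborel. t \<in> {0<..<T} \<longrightarrow> u' t = u t"
    and u'_m: "(\<lambda>p. u' (fst p) (snd p)) \<in> borel_measurable (lborel \<Otimes>\<^sub>M lborel)"
    and f'_L2: "\<And>t. f' t \<in> L2 lborel" and f'_bd: "\<And>t. (LINT x|lborel. (f' t x)^2) \<le> F^2" and F: "0 \<le> F"
    and f'_eq: "AE t in lborel. t \<in> {0<..<T} \<longrightarrow> (\<forall>x\<in>\<Omega>. f' t x = f t x)"
    and f'_m: "(\<lambda>p. f' (fst p) (snd p)) \<in> borel_measurable (lborel \<Otimes>\<^sub>M lborel)"
  shows "AE t in lborel. t \<in> {0<..<T} \<longrightarrow> (LINT x|lborel. u' t x * \<phi> x) = (LINT x|lborel. u0 x * \<phi> x)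
        + (LINT r:{0<..t}|lborel. (LINT x|lborel. f' r x * \<phi> x) - bilinA s (u' r) \<phi>)"
proof (rule weak_derivative_imp_primitive[OF T])
  note u'_m[measurable] f'_m[measurable]
  note Hs = subsetD[OF tildeH_subset_Hs]
  note L2 = Hs_L2[OF Hs]
  have [measurable]: "\<phi> \<in> borel_measurable borel" "u0 \<in> borel_measurable borel"
    and um[measurable]: "\<And>t. u' t \<in> borel_measurable borel"
    using Hs \<phi> u0 u'_H by (auto simp: Hs_iff)
  have fm[measurable]: "\<And>t. f' t \<in> borel_measurable borel"
    using f'_L2 by (simp add: L2_def)
  have gm[measurable]: "(\<lambda>p. gagliardo_diff s (u' (fst p)) (snd p)) \<in> borel_measurable (lborel \<Otimes>\<^sub>M borel)"
    by (rule gagliardo_diff_measurable) (use u'_m in simp)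
  have [measurable]: "gagliardo_diff s \<phi> \<in> borel_measurable borel"
    by (rule gagliardo_diff_measurable_single) simp
  define g where "g t = (LINT x|lborel. u' t x * \<phi> x)" for t
  define a where "a t = bilinA s (u' t) \<phi>" for t
  define h where "h t = (LINT x|lborel. f' t x * \<phi> x)" for t
  \<comment> \<open>The squared fractional norm, integrable in time, serves as common majorant:
    pairing, form and source term are all bounded by an affine function of
    \<open>q t\<close>.\<close>
  define q where "q t = (LINT x|lborel. (u' t x)^2) + (LINT p|lborel. (gagliardo_diff s (u' t) p)^2)" for t
  define n where "n = (LINT x|lborel. (\<phi> x)^2)"
  define n' where "n' = (LINT p|lborel. (gagliardo_diff s \<phi> p)^2)"
  have nn: "0 \<le> n" "0 \<le> n'" by (simp_all add: n_def n'_def)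
  have "(\<lambda>t. LINT x|lborel. u' t x * \<phi> x) \<in> borel_measurable lborel"
    "(\<lambda>t. LINT x|lborel. f' t x * \<phi> x) \<in> borel_measurable lborel"
    "(\<lambda>t. LINT x|lborel. (u' t x)^2) \<in> borel_measurable lborel"
    "(\<lambda>t. LINT p|lborel. gagliardo_diff s (u' t) p * gagliardo_diff s \<phi> p) \<in> borel_measurable lborel"
    "(\<lambda>t. LINT p|lborel. (gagliardo_diff s (u' t) p)^2) \<in> borel_measurable lborel"
    by (rule lborel.borel_measurable_lebesgue_integral, simp add: case_prod_beta)+
  then have [measurable]: "g \<in> borel_measurable borel" "h \<in> borel_measurable borel" "a \<in> borel_measurable borel"
    "q \<in> borel_measurable borel"
    unfolding g_def h_def q_def a_def bilinA_eq by simp_all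
  have q_eq: "Hs_norm_sq s (u' t) = ennreal (q t)" for t
    using Hs[OF u'_H[of t]]
    by (simp add: q_def Hs_norm_sq_def L2_sq_def gagliardo_sq_eq L2_nn_integral Hs_L2 Hs_gagliardo_L2)
  have q_nn: "0 \<le> q t" for t by (simp add: q_def)
  have q_int: "integrable lborel (\<lambda>t. indicator {0<..<T} t * q t)"
  proof (rule integrableI_bounded)
    have "(\<integral>\<^sup>+t. ennreal (norm (indicator {0<..<T} t * q t)) \<partial>lborel) = (\<integral>\<^sup>+t\<in>{0<..<T}. Hs_norm_sq s (u t) \<partial>lborel)"
    proof (rule nn_integral_cong_AE)
      show "AE t in lborel. ennreal (norm (indicator {0<..<T} t * q t)) = Hs_norm_sq s (u t) * indicator {0<..<T} t"
        using u'_eq by (rule AE_mp) (use q_nn in \<open>auto intro!: AE_I2 simp: indicator_def q_eq[symmetric]\<close>)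
    qed
    with weak show "(\<integral>\<^sup>+t. ennreal (norm (indicator {0<..<T} t * q t)) \<partial>lborel) < \<infinity>"
      by (simp add: weak_solution_def)
  qed simp
  have sqrt_mult_le: "sqrt x * sqrt y \<le> x + y" if "0 \<le> x" "0 \<le> y" for x y :: real
    using abs_mult_le_squares[of "sqrt x" "sqrt y"] that by simp
  have g_bd: "\<bar>g t\<bar> \<le> q t + n" for t
  proof -
    have "\<bar>g t\<bar> \<le> (LINT x|lborel. (u' t x)^2) + n"
      using L2_Cauchy_Schwarz[OF L2[OF u'_H] L2[OF \<phi>], of t] sqrt_mult_le[of "LINT x|lborel. (u' t x)^2" n] nn
      by (simp add: g_def n_def)
    moreover have "0 \<le> (LINT p|lborel. (gagliardo_diff s (u' t) p)^2)" by simp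
    ultimately show ?thesis unfolding q_def by linarith
  qed
  have a_bd: "\<bar>a t\<bar> \<le> Cns (real DIM('a)) s / 2 * (q t + n')" for t
  proof -
    have "\<bar>a t\<bar> \<le> Cns (real DIM('a)) s / 2 * (sqrt (LINT p|lborel. (gagliardo_diff s (u' t) p)^2) * sqrt n')"
      unfolding a_def n'_def using bilinA_bound[OF s Hs[OF u'_H] Hs[OF \<phi>]] .
    also have "\<dots> \<le> Cns (real DIM('a)) s / 2 * ((LINT p|lborel. (gagliardo_diff s (u' t) p)^2) + n')"
      using Cns_nonneg[OF s, of "real DIM('a)"] nn by (intro mult_left_mono sqrt_mult_le) auto
    also have "\<dots> \<le> Cns (real DIM('a)) s / 2 * (q t + n')"
      using Cns_nonneg[OF s, of "real DIM('a)"] by (intro mult_left_mono) (auto simp: q_def)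
    finally show ?thesis .
  qed
  have h_bd: "\<bar>h t\<bar> \<le> F * sqrt n" for t
  proof -
    have "sqrt (LINT x|lborel. (f' t x)^2) \<le> F"
      using real_sqrt_le_mono[OF f'_bd[of t]] F by simp
    then show ?thesis
      using L2_Cauchy_Schwarz[OF f'_L2 L2[OF \<phi>], of t] mult_right_mono[of _ F "sqrt n"] nn
      unfolding h_def n_def by (meson order.trans real_sqrt_ge_zero)
  qed
  have int_by_q: "set_integrable lborel {0<..<T} k" if [measurable]: "k \<in> borel_measurable borel" and bd: "\<And>t. \<bar>k t\<bar> \<le> A * q t + B" "0 \<le> A" "0 \<le> B" for k A B
    unfolding set_integrable_def
  proof (rule Bochner_Integration.integrable_bound)
    show "integrable lborel (\<lambda>t. A * (indicator {0<..<T} t * q t) + B * indicator {0<..<T} t)"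
      using T by (intro Bochner_Integration.integrable_add integrable_mult_right q_int) auto
    show "AE t in lborel. norm (indicator {0<..<T} t *\<^sub>R k t) \<le> norm (A * (indicator {0<..<T} t * q t) + B * indicator {0<..<T} t)"
      using bd q_nn by (intro AE_I2) (auto simp: indicator_def intro!: order.trans[OF bd(1)])
  qed simp
  have g_int: "set_integrable lborel {0<..<T} g"
    by (rule int_by_q[of g 1 n]) (use g_bd nn in auto)
  have a_int: "set_integrable lborel {0<..<T} a"
    by (rule int_by_q[of a "Cns (real DIM('a)) s / 2" "Cns (real DIM('a)) s / 2 * n'"])
      (use a_bd nn Cns_nonneg[OF s, of "real DIM('a)"] in \<open>auto simp: distrib_left\<close>)
  have h_int: "set_integrable lborel {0<..<T} h"
    by (rule int_by_q[of h 0 "F * sqrt n"]) (use h_bd F nn in auto)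
  show "set_integrable lborel {0<..<T} (\<lambda>t. LINT x|lborel. u' t x * \<phi> x)"
    using g_int by (simp add: g_def [abs_def])
  show "set_integrable lborel {0<..<T} (\<lambda>t. (LINT x|lborel. f' t x * \<phi> x) - bilinA s (u' t) \<phi>)"
    using set_integral_diff(1)[OF h_int a_int] by (simp add: h_def [abs_def] a_def [abs_def])
  obtain w where w: "\<forall>\<phi>\<in>tildeH s \<Omega>. (\<lambda>t. w t \<phi>) \<in> borel_measurable lborel"
    "\<forall>\<phi>\<in>tildeH s \<Omega>. \<forall>\<psi>. test_fun {0<..<T} \<psi> \<longrightarrow>
            (LINT t:{0<..<T}|lborel. ipO \<Omega> (u t) \<phi> * deriv \<psi> t) =
            - (LINT t:{0<..<T}|lborel. w t \<phi> * \<psi> t)"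
    "\<forall>\<phi>\<in>tildeH s \<Omega>. AE t in lborel. t \<in> {0<..<T} \<longrightarrow>
            w t \<phi> + bilinA s (u t) \<phi> = ipO \<Omega> (f t) \<phi>"
    using weak unfolding weak_solution_def by blast
  have [measurable]: "(\<lambda>t. w t \<phi>) \<in> borel_measurable borel"
    using w(1) \<phi> by simp
  have um0: "(\<lambda>p. u (fst p) (snd p)) \<in> borel_measurable (lborel \<Otimes>\<^sub>M lborel)"
    using weak by (simp add: weak_solution_def)
  have ip_m: "(\<lambda>t. ipO \<Omega> (u t) \<phi>) \<in> borel_measurable borel"
  proof -
    note um0[measurable] \<Omega>[measurable]
    have "(\<lambda>t. LINT x|lborel. indicator \<Omega> x *\<^sub>R (u t x * \<phi> x)) \<in> borel_measurable lborel"
      by (rule lborel.borel_measurable_lebesgue_integral) (simp add: case_prod_beta)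
    then show ?thesis by (simp add: ipO_def set_lebesgue_integral_def)
  qed
  fix \<psi> assume \<psi>: "test_fun {0<..<T} \<psi>"
  have [measurable]: "deriv \<psi> \<in> borel_measurable borel"
    by (rule borel_measurable_continuous_onI[OF test_fun_real_deriv(2)[OF \<psi>]])
  have "continuous_on UNIV \<psi>"
    using test_fun_real_deriv(1)[OF \<psi>] by (auto intro!: continuous_at_imp_continuous_on DERIV_isCont)
  then have [measurable]: "\<psi> \<in> borel_measurable borel"
    by (rule borel_measurable_continuous_onI)
  note ip_m[measurable]
  have "(LINT t:{0<..<T}|lborel. g t * deriv \<psi> t) = (LINT t:{0<..<T}|lborel. ipO \<Omega> (u t) \<phi> * deriv \<psi> t)"
    unfolding set_lebesgue_integral_def
  proof (rule integral_cong_AE)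
    show "AE t in lborel. indicator {0<..<T} t *\<^sub>R (g t * deriv \<psi> t) = indicator {0<..<T} t *\<^sub>R (ipO \<Omega> (u t) \<phi> * deriv \<psi> t)"
      using u'_eq
    proof (rule AE_mp, intro AE_I2 impI)
      fix t assume "t \<in> {0<..<T} \<longrightarrow> u' t = u t"
      then show "indicator {0<..<T} t *\<^sub>R (g t * deriv \<psi> t) = indicator {0<..<T} t *\<^sub>R (ipO \<Omega> (u t) \<phi> * deriv \<psi> t)"
        using ipO_tildeH[OF \<phi> \<Omega> um, of t] by (cases "t \<in> {0<..<T}") (simp_all add: g_def)
    qed
  qed auto
  also have "\<dots> = - (LINT t:{0<..<T}|lborel. w t \<phi> * \<psi> t)"
    using w(2) \<phi> \<psi> by blast
  also have "(LINT t:{0<..<T}|lborel. w t \<phi> * \<psi> t) = (LINT t:{0<..<T}|lborel. (h t - a t) * \<psi> t)"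
    unfolding set_lebesgue_integral_def
  proof (rule integral_cong_AE)
    have "AE t in lborel. t \<in> {0<..<T} \<longrightarrow> w t \<phi> + bilinA s (u t) \<phi> = ipO \<Omega> (f t) \<phi>"
      using w(3) \<phi> by blast
    with u'_eq f'_eq
    have "AE t in lborel. t \<in> {0<..<T} \<longrightarrow> w t \<phi> = h t - a t"
    proof eventually_elim
      case (elim t)
      show ?case
      proof
        assume t: "t \<in> {0<..<T}"
        have "ipO \<Omega> (f t) \<phi> = ipO \<Omega> (f' t) \<phi>"
          unfolding ipO_def set_lebesgue_integral_def
          by (rule Bochner_Integration.integral_cong) (use elim t in \<open>auto simp: indicator_def\<close>)
        also have "\<dots> = h t"
          using ipO_tildeH[OF \<phi> \<Omega> fm] by (simp add: h_def)
        finally show "w t \<phi> = h t - a t"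
          using elim t by (simp add: a_def)
      qed
    qed
    then show "AE t in lborel. indicator {0<..<T} t *\<^sub>R (w t \<phi> * \<psi> t) = indicator {0<..<T} t *\<^sub>R ((h t - a t) * \<psi> t)"
      by (rule AE_mp) (auto intro!: AE_I2 simp: indicator_def)
  qed auto
  finally show "(LINT t:{0<..<T}|lborel. (LINT x|lborel. u' t x * \<phi> x) * deriv \<psi> t)
    = - (LINT t:{0<..<T}|lborel. ((LINT x|lborel. f' t x * \<phi> x) - bilinA s (u' t) \<phi>) * \<psi> t)"
    by (simp add: g_def h_def a_def)
next
  fix \<epsilon> :: real assume "\<epsilon> > 0"
  note Hs = subsetD[OF tildeH_subset_Hs]
  note L2 = Hs_L2[OF Hs]
  define n where "n = (LINT x|lborel. (\<phi> x)^2)"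
  have "0 \<le> n" by (simp add: n_def)
  \<comment> \<open>Makes the Cauchy-Schwarz bound
    \<open>sqrt \<eta> * sqrt n = \<epsilon> * sqrt n / (sqrt n + 1)\<close>, at most \<epsilon>
    even when \<open>n = 0\<close>.\<close>
  define \<eta> where "\<eta> = (\<epsilon> / (sqrt n + 1))^2"
  have pos: "0 < sqrt n + 1" using \<open>0 \<le> n\<close> by (simp add: add_nonneg_pos)
  have "\<eta> > 0" using \<open>\<epsilon> > 0\<close> pos by (simp add: \<eta>_def)
  then obtain \<delta> where \<delta>: "\<delta> > 0" "AE t in lborel. 0 < t \<and> t < \<delta> \<and> t < T \<longrightarrow> L2_sq (\<lambda>x. u t x - u0 x) < ennreal \<eta>"
    using weak unfolding weak_solution_def by blast
  have "AE t in lborel. 0 < t \<and> t < \<delta> \<and> t < T \<longrightarrow> \<bar>(LINT x|lborel. u' t x * \<phi> x) - (LINT x|lborel. u0 x * \<phi> x)\<bar> \<le> \<epsilon>"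
    using \<delta>(2) u'_eq
  proof eventually_elim
    case (elim t)
    show ?case
    proof
      assume t: "0 < t \<and> t < \<delta> \<and> t < T"
      have mem: "u' t \<in> L2 lborel" "u0 \<in> L2 lborel" "\<phi> \<in> L2 lborel"
        using L2 u'_H u0 \<phi> by blast+
      have D: "(\<lambda>x. u' t x - u0 x) \<in> L2 lborel"
        using mem by (intro L2_diff)
      have "L2_sq (\<lambda>x. u' t x - u0 x) < ennreal \<eta>"
        using elim t by simp
      then have sq: "(LINT x|lborel. (u' t x - u0 x)^2) < \<eta>"
        unfolding L2_sq_def L2_nn_integral[OF D] by (simp add: ennreal_less_iff)
      have "(LINT x|lborel. u' t x * \<phi> x) - (LINT x|lborel. u0 x * \<phi> x) = (LINT x|lborel. (u' t x - u0 x) * \<phi> x)"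
        unfolding left_diff_distrib
        by (intro Bochner_Integration.integral_diff[symmetric] L2_mult_integrable mem)
      also have "\<bar>\<dots>\<bar> \<le> sqrt (LINT x|lborel. (u' t x - u0 x)^2) * sqrt n"
        unfolding n_def by (rule L2_Cauchy_Schwarz[OF D L2[OF \<phi>]])
      also have "\<dots> \<le> sqrt \<eta> * sqrt n"
        using sq \<open>0 \<le> n\<close> by (intro mult_right_mono real_sqrt_le_mono) auto
      also have "\<dots> = \<epsilon> / (sqrt n + 1) * sqrt n"
        unfolding \<eta>_def real_sqrt_abs using \<open>\<epsilon> > 0\<close> pos by simp
      also have "\<dots> \<le> \<epsilon>"
        using \<open>\<epsilon> > 0\<close> pos by (simp add: field_simps)
      finally show "\<bar>(LINT x|lborel. u' t x * \<phi> x) - (LINT x|lborel. u0 x * \<phi> x)\<bar> \<le> \<epsilon>" .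
    qed
  qed
  with \<delta>(1) show "\<exists>\<delta>>0. AE t in lborel. 0 < t \<and> t < \<delta> \<and> t < T \<longrightarrow>
      \<bar>(LINT x|lborel. u' t x * \<phi> x) - (LINT x|lborel. u0 x * \<phi> x)\<bar> \<le> \<epsilon>"
    by blast
qed

text \<open>The average of the source is taken pointwise in \<open>x\<close>, whereas the error
  argument pairs with \<phi> first. Fubini links the two; its integrability hypothesis is
  Cauchy-Schwarz at each time with the uniform bound \<open>F\<close>.\<close>

lemma time_average_pairing:
  fixes f' :: "real \<Rightarrow> 'a::euclidean_space \<Rightarrow> real"
  assumes \<phi>: "\<phi> \<in> L2 lborel" and f'_L2: "\<And>t. f' t \<in> L2 lborel"
    and f'_bd: "\<And>t. (LINT x|lborel. (f' t x)^2) \<le> F^2" and F: "0 \<le> F"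
    and f'_m: "(\<lambda>p. f' (fst p) (snd p)) \<in> borel_measurable (lborel \<Otimes>\<^sub>M lborel)"
  shows "(LINT x|lborel. (LINT t:{a<..b}|lborel. f' t x) * \<phi> x) = (LINT t:{a<..b}|lborel. (LINT x|lborel. f' t x * \<phi> x))"
proof -
  note f'_m[measurable]
  have [measurable]: "\<phi> \<in> borel_measurable borel" using \<phi> by (simp add: L2_def)
  define \<Phi> where "\<Phi> t x = indicator {a<..b} t * (f' t x * \<phi> x)" for t x
  have \<Phi>m[measurable]: "(\<lambda>p. \<Phi> (fst p) (snd p)) \<in> borel_measurable (lborel \<Otimes>\<^sub>M lborel)"
    unfolding \<Phi>_def by measurable
  define B where "B = F * sqrt (LINT x|lborel. (\<phi> x)^2)"
  have bd: "(LINT x|lborel. \<bar>f' t x * \<phi> x\<bar>) \<le> \<bar>B\<bar>" for t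
  proof -
    have abs: "(\<lambda>x. \<bar>v x\<bar>) \<in> L2 lborel" if "v \<in> L2 lborel" for v :: "'a \<Rightarrow> real"
      using that by (auto simp: L2_def)
    have "sqrt (LINT x|lborel. (f' t x)^2) \<le> F"
      using real_sqrt_le_mono[OF f'_bd[of t]] F by simp
    then have "sqrt (LINT x|lborel. (f' t x)^2) * sqrt (LINT x|lborel. (\<phi> x)^2) \<le> B"
      unfolding B_def by (intro mult_right_mono) auto
    then show ?thesis
      using L2_Cauchy_Schwarz[OF abs[OF f'_L2[of t]] abs[OF \<phi>]] by (simp add: abs_mult)
  qed
  have "integrable (lborel \<Otimes>\<^sub>M lborel) (\<lambda>p. \<Phi> (fst p) (snd p))"
  proof (rule lborel_pair.Fubini_integrable[OF \<Phi>m])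
    show "AE t in lborel. integrable lborel (\<lambda>x. \<Phi> (fst (t, x)) (snd (t, x)))"
      unfolding \<Phi>_def using L2_mult_integrable[OF f'_L2 \<phi>] by (intro AE_I2) simp
    show "integrable lborel (\<lambda>t. LINT x|lborel. norm (\<Phi> (fst (t, x)) (snd (t, x))))"
    proof (rule Bochner_Integration.integrable_bound)
      show "integrable lborel (\<lambda>t. indicator {a<..b} t * B)"
        by (cases "a \<le> b") auto
      show "(\<lambda>t. LINT x|lborel. norm (\<Phi> (fst (t, x)) (snd (t, x)))) \<in> borel_measurable lborel"
        by (rule lborel.borel_measurable_lebesgue_integral) (simp add: case_prod_beta)
      show "AE t in lborel. norm (LINT x|lborel. norm (\<Phi> (fst (t, x)) (snd (t, x)))) \<le> norm (indicator {a<..b} t * B)"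
        using bd by (intro AE_I2) (auto simp: \<Phi>_def indicator_def)
    qed
  qed
  then have "integrable (lborel \<Otimes>\<^sub>M lborel) (case_prod \<Phi>)"
    by (simp add: split_def)
  from lborel_pair.Fubini_integral[OF this] show ?thesis
    by (simp add: \<Phi>_def set_lebesgue_integral_def mult.assoc flip: integral_mult_left_zero integral_mult_right_zero)
qed

text \<open>\<open>U 0\<close> is only almost everywhere equal to \<open>u0\<close> and may fail to be Borel measurable, in which case
  \<^const>\<open>ipO\<close> returns the junk value 0. Cutting the test function off on a null set containing
  the points where \<open>U 0\<close> and \<open>u0\<close> differ avoids this.\<close>

lemma semidiscrete_scheme_normalized:
  fixes \<Omega> :: "'a::euclidean_space set" and f :: "real \<Rightarrow> 'a \<Rightarrow> real"
  assumes T: "0 < T" and \<Omega>: "\<Omega> \<in> sets borel" and u0: "u0 \<in> tildeH s \<Omega>"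
    and semi: "semidiscrete s \<Omega> T K u0 f U" and k: "k < K" and \<phi>: "\<phi> \<in> tildeH s \<Omega>"
    and V: "\<And>j. V j = (if j = 0 then u0 else if j \<le> K then U j else u0)"
    and f_m: "(\<lambda>p. f (fst p) (snd p)) \<in> borel_measurable (lborel \<Otimes>\<^sub>M lborel)"
    and f'_L2: "\<And>t. f' t \<in> L2 lborel" and f'_bd: "\<And>t. (LINT x|lborel. (f' t x)^2) \<le> F^2" and F: "0 \<le> F"
    and f'_eq: "AE t in lborel. t \<in> {0<..<T} \<longrightarrow> (\<forall>x\<in>\<Omega>. f' t x = f t x)"
    and f'_m: "(\<lambda>p. f' (fst p) (snd p)) \<in> borel_measurable (lborel \<Otimes>\<^sub>M lborel)"
  shows "(LINT x|lborel. (V (Suc k) x - V k x) * \<phi> x) + T / real K * bilinA s (V (Suc k)) \<phi>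
        = (LINT r:{real k * (T / real K)<..real (Suc k) * (T / real K)}|lborel. (LINT x|lborel. f' r x * \<phi> x))"
proof -
  define \<tau> where "\<tau> = T / real K"
  have \<tau>: "0 < \<tau>" using T k by (simp add: \<tau>_def)
  note Hs = subsetD[OF tildeH_subset_Hs]
  note f_m[measurable] f'_m[measurable]
  have U0: "AE x in lborel. U 0 x = u0 x" and U_H: "\<And>j. j < K \<Longrightarrow> U (Suc j) \<in> tildeH s \<Omega>"
    and U_eq: "\<And>j \<phi>. j < K \<Longrightarrow> \<phi> \<in> tildeH s \<Omega> \<Longrightarrow> ipO \<Omega> (\<lambda>x. (U (Suc j) x - U j x) / \<tau>) \<phi> + bilinA s (U (Suc j)) \<phi>
               = ipO \<Omega> (f_avg \<tau> f j) \<phi>"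
    using semi by (simp_all add: semidiscrete_def Let_def \<tau>_def)
  have V_H: "V j \<in> tildeH s \<Omega>" for j
    using u0 U_H[of "j - 1"] by (cases j) (auto simp: V)
  have Vm[measurable]: "V j \<in> borel_measurable borel" for j
    using Hs[OF V_H[of j]] by (simp add: Hs_iff)
  have \<phi>m[measurable]: "\<phi> \<in> borel_measurable borel"
    using Hs[OF \<phi>] by (simp add: Hs_iff)
  obtain N where N: "{x \<in> space lborel. \<not> U 0 x = u0 x} \<subseteq> N" "N \<in> null_sets lborel"
    using U0 by (auto simp: eventually_ae_filter)
  have [measurable]: "N \<in> sets borel" using N(2) by auto
  define \<phi>' where "\<phi>' x = indicator (- N) x * \<phi> x" for x
  have \<phi>'m[measurable]: "\<phi>' \<in> borel_measurable borel"
    unfolding \<phi>'_def by measurable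
  have \<phi>'_eq: "AE x in lborel. \<phi> x = \<phi>' x"
    using AE_not_in[OF N(2)] by (rule AE_mp) (auto intro!: AE_I2 simp: \<phi>'_def indicator_def)
  have \<phi>'_H: "\<phi>' \<in> tildeH s \<Omega>"
    by (rule tildeH_cong_AE[OF \<phi> \<phi>'_eq \<phi>'m])
  have ip': "ipO \<Omega> v \<phi>' = (LINT x|lborel. v x * \<phi> x)" if [measurable]: "v \<in> borel_measurable borel" for v
  proof -
    have "ipO \<Omega> v \<phi>' = (LINT x|lborel. v x * \<phi>' x)"
      by (rule ipO_tildeH[OF \<phi>'_H \<Omega>]) simp
    also have "\<dots> = (LINT x|lborel. v x * \<phi> x)"
      by (rule integral_cong_AE) (use \<phi>'_eq in \<open>auto elim: AE_mp\<close>)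
    finally show ?thesis .
  qed
  have UV: "U (Suc k) = V (Suc k)" using k by (simp add: V)
  have Uk: "U k x * \<phi>' x = V k x * \<phi>' x" for x
    using N(1) k by (auto simp: V \<phi>'_def indicator_def)
  have 1: "ipO \<Omega> (\<lambda>x. (U (Suc k) x - U k x) / \<tau>) \<phi>' = (LINT x|lborel. (V (Suc k) x - V k x) * \<phi> x) / \<tau>"
  proof -
    have "(U (Suc k) x - U k x) / \<tau> * \<phi>' x = (V (Suc k) x - V k x) / \<tau> * \<phi>' x" for x
      using Uk[of x] by (simp add: UV diff_divide_distrib left_diff_distrib)
    then have "ipO \<Omega> (\<lambda>x. (U (Suc k) x - U k x) / \<tau>) \<phi>' = ipO \<Omega> (\<lambda>x. (V (Suc k) x - V k x) / \<tau>) \<phi>'"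
      by (simp only: ipO_def)
    also have "\<dots> = (LINT x|lborel. (V (Suc k) x - V k x) / \<tau> * \<phi> x)"
      by (rule ip') simp
    also have "\<dots> = (LINT x|lborel. (V (Suc k) x - V k x) * \<phi> x / \<tau>)"
      by simp
    finally show ?thesis by simp
  qed
  have 2: "bilinA s (U (Suc k)) \<phi>' = bilinA s (V (Suc k)) \<phi>"
    unfolding UV using \<phi>'_eq by (intro bilinA_cong_AE) auto
  let ?I = "{real k * \<tau><..real (Suc k) * \<tau>}"
  have 3: "ipO \<Omega> (f_avg \<tau> f k) \<phi>' = (LINT t:?I|lborel. (LINT x|lborel. f' t x * \<phi> x)) / \<tau>"
  proof -
    have avg_m: "(\<lambda>x. LINT t:J|lborel. g t x) \<in> borel_measurable borel"
      if gm: "(\<lambda>p. g (fst p) (snd p)) \<in> borel_measurable (lborel \<Otimes>\<^sub>M lborel)" and [measurable]: "J \<in> sets borel"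
      for J and g :: "real \<Rightarrow> 'a \<Rightarrow> real"
    proof -
      have [measurable]: "(\<lambda>q. g (snd q) (fst q)) \<in> borel_measurable (lborel \<Otimes>\<^sub>M lborel)"
        using measurable_compose[OF measurable_pair_swap' gm] by (simp add: case_prod_beta)
      have "(\<lambda>x. LINT t|lborel. indicator J t *\<^sub>R g t x) \<in> borel_measurable lborel"
        by (rule lborel.borel_measurable_lebesgue_integral) (simp add: case_prod_beta)
      then show ?thesis by (simp add: set_lebesgue_integral_def)
    qed
    have fam[measurable]: "f_avg \<tau> f k \<in> borel_measurable borel"
      unfolding f_avg_def [abs_def] by (intro borel_measurable_times avg_m[OF f_m]) auto
    have f'am[measurable]: "(\<lambda>x. LINT t:?I|lborel. f' t x) \<in> borel_measurable borel"
      by (rule avg_m[OF f'_m]) simp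
    \<comment> \<open>\<open>f'\<close> is tied to \<open>f\<close> only on the open interval (0,
      T), while the averages use closed slots that may contain 0 or \<open>T\<close>; the endpoints
      are discarded as null.\<close>
    have I_sub: "t \<in> {0<..<T}" if "t \<in> {real k * \<tau>..real (Suc k) * \<tau>}" "t \<noteq> real k * \<tau>" "t \<noteq> real (Suc k) * \<tau>" for t
    proof -
      have "real (Suc k) * \<tau> \<le> real K * \<tau>"
        using k \<tau> by (intro mult_right_mono) auto
      moreover have "real K * \<tau> = T" using k by (simp add: \<tau>_def)
      moreover have "0 \<le> real k * \<tau>" using \<tau> by simp
      ultimately show ?thesis using that by auto
    qed
    have avg_eq: "f_avg \<tau> f k x = (LINT t:?I|lborel. f' t x) / \<tau>" if x: "x \<in> \<Omega>" for x
    proof -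
      have "AE t in lborel. t \<noteq> real k * \<tau>" "AE t in lborel. t \<noteq> real (Suc k) * \<tau>"
        by (rule AE_lborel_singleton)+
      with f'_eq have "AE t in lborel. indicator {real k * \<tau>..real (Suc k) * \<tau>} t *\<^sub>R f t x = indicator ?I t *\<^sub>R f' t x"
      proof eventually_elim
        case (elim t)
        show ?case
          using I_sub[of t] elim x by (cases "t \<in> {real k * \<tau>..real (Suc k) * \<tau>}") (auto simp: indicator_def)
      qed
      moreover have "(\<lambda>t. f t x) \<in> borel_measurable borel" "(\<lambda>t. f' t x) \<in> borel_measurable borel"
        using measurable_compose[OF measurable_Pair2' f_m, of x] measurable_compose[OF measurable_Pair2' f'_m, of x] by simp_all
      ultimately have "(LINT t:{real k * \<tau>..real (Suc k) * \<tau>}|lborel. f t x) = (LINT t:?I|lborel. f' t x)"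
        unfolding set_lebesgue_integral_def by (intro integral_cong_AE) auto
      then show ?thesis by (simp add: f_avg_def)
    qed
    have "ipO \<Omega> (f_avg \<tau> f k) \<phi>' = (LINT x|lborel. f_avg \<tau> f k x * \<phi> x)"
      by (rule ip'[OF fam])
    also have "\<dots> = (LINT x|lborel. (LINT t:?I|lborel. f' t x) * \<phi> x / \<tau>)"
    \<comment> \<open>The two averages are compared on \<Omega> only; outside, \<phi> vanishes
      almost everywhere.\<close>
    proof (rule integral_cong_AE)
      show "AE x in lborel. f_avg \<tau> f k x * \<phi> x = (LINT t:?I|lborel. f' t x) * \<phi> x / \<tau>"
        using tildeH_AE_zero[OF \<phi> \<Omega>] by (rule AE_mp) (use avg_eq in \<open>auto intro!: AE_I2\<close>)
      show "(\<lambda>x. (LINT t:?I|lborel. f' t x) * \<phi> x / \<tau>) \<in> borel_measurable lborel"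
        by measurable
    qed simp
    also have "\<dots> = (LINT t:?I|lborel. (LINT x|lborel. f' t x * \<phi> x)) / \<tau>"
      using time_average_pairing[OF Hs_L2[OF Hs[OF \<phi>]] f'_L2 f'_bd F f'_m] by simp
    finally show ?thesis .
  qed
  have "(LINT x|lborel. (V (Suc k) x - V k x) * \<phi> x) / \<tau> + bilinA s (V (Suc k)) \<phi>
    = (LINT t:?I|lborel. (LINT x|lborel. f' t x * \<phi> x)) / \<tau>"
    using U_eq[OF k \<phi>'_H] unfolding 1 2 3 .
  then have "\<tau> * ((LINT x|lborel. (V (Suc k) x - V k x) * \<phi> x) / \<tau> + bilinA s (V (Suc k)) \<phi>)
    = \<tau> * ((LINT t:?I|lborel. (LINT x|lborel. f' t x * \<phi> x)) / \<tau>)"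
    by simp
  then show ?thesis
    using \<tau> unfolding \<tau>_def[symmetric] by (simp add: distrib_left)
qed

text \<open>On a Borel null set containing the bad times, and outside (0, T), the value is reset to
  \<open>u0\<close>, which is at hand as a member of \<open>tildeH s \<Omega>\<close>. Cutting along
  a Borel set of times keeps joint measurability.\<close>

lemma weak_solution_normalized:
  fixes \<Omega> :: "'a::euclidean_space set"
  assumes weak: "weak_solution s \<Omega> T u0 f u" and u0: "u0 \<in> tildeH s \<Omega>"
  obtains u' where "\<And>t. u' t \<in> tildeH s \<Omega>" "AE t in lborel. t \<in> {0<..<T} \<longrightarrow> u' t = u t"
    "(\<lambda>p. u' (fst p) (snd p)) \<in> borel_measurable (lborel \<Otimes>\<^sub>M lborel)"
proof -
  have um[measurable]: "(\<lambda>p. u (fst p) (snd p)) \<in> borel_measurable (lborel \<Otimes>\<^sub>M lborel)"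
    and "AE t in lborel. t \<in> {0<..<T} \<longrightarrow> u t \<in> tildeH s \<Omega>"
    using weak by (simp_all add: weak_solution_def)
  then obtain N where N: "{t \<in> space lborel. \<not> (t \<in> {0<..<T} \<longrightarrow> u t \<in> tildeH s \<Omega>)} \<subseteq> N" "N \<in> null_sets lborel"
    by (auto simp: eventually_ae_filter)
  have [measurable]: "N \<in> sets borel" using N(2) by auto
  have [measurable]: "u0 \<in> borel_measurable borel"
    using u0 by (simp add: tildeH_def)
  define u' where "u' t = (if t \<in> {0<..<T} - N then u t else u0)" for t
  show ?thesis
  proof (rule that[of u'])
    show "u' t \<in> tildeH s \<Omega>" for t
      using N(1) u0 by (auto simp: u'_def)
    show "AE t in lborel. t \<in> {0<..<T} \<longrightarrow> u' t = u t"
      using AE_not_in[OF N(2)] by (rule AE_mp) (auto intro!: AE_I2 simp: u'_def)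
    have "(\<lambda>p. u' (fst p) (snd p)) = (\<lambda>p. if fst p \<in> {0<..<T} - N then u (fst p) (snd p) else u0 (snd p))"
      by (auto simp: u'_def)
    also have "\<dots> \<in> borel_measurable (lborel \<Otimes>\<^sub>M lborel)" by measurable
    finally show "(\<lambda>p. u' (fst p) (snd p)) \<in> borel_measurable (lborel \<Otimes>\<^sub>M lborel)" .
  qed
qed

text \<open>The source is cut off where its spatial norm exceeds the essential supremum. This set of
  times is measurable and null within (0, T). Extension by 0 outside \<Omega> turns the norm over
  \<Omega> into one over the whole space.\<close>

lemma in_Linf_L2_normalized:
  fixes \<Omega> :: "'a::euclidean_space set"
  assumes f: "in_Linf_L2 \<Omega> T f" and [measurable]: "\<Omega> \<in> sets borel"
  defines "F \<equiv> sqrt (enn2real (Linf_L2_sq \<Omega> T f))"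
  obtains f' where "\<And>t. f' t \<in> L2 lborel" "\<And>t. (LINT x|lborel. (f' t x)^2) \<le> F^2"
    "AE t in lborel. t \<in> {0<..<T} \<longrightarrow> (\<forall>x\<in>\<Omega>. f' t x = f t x)"
    "(\<lambda>p. f' (fst p) (snd p)) \<in> borel_measurable (lborel \<Otimes>\<^sub>M lborel)"
proof -
  have fm[measurable]: "(\<lambda>p. f (fst p) (snd p)) \<in> borel_measurable (lborel \<Otimes>\<^sub>M lborel)"
    and fin: "Linf_L2_sq \<Omega> T f < \<infinity>"
    using f by (simp_all add: in_Linf_L2_def)
  define g where "g t = (\<integral>\<^sup>+x\<in>\<Omega>. ennreal ((f t x)^2) \<partial>lborel)" for t
  have "(\<lambda>t. \<integral>\<^sup>+x. ennreal ((f t x)^2) * indicator \<Omega> x \<partial>lborel) \<in> borel_measurable lborel"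
    using lborel.borel_measurable_nn_integral_fst[of "\<lambda>p. ennreal ((f (fst p) (snd p))^2) * indicator \<Omega> (snd p)" lborel]
    by simp
  then have [measurable]: "g \<in> borel_measurable borel"
    by (simp add: g_def [abs_def])
  have F2: "Linf_L2_sq \<Omega> T f = ennreal (F^2)"
    using fin by (simp add: F_def)
  have "AE t in restrict_space lborel {0<..<T}. g t \<le> Linf_L2_sq \<Omega> T f"
    unfolding Linf_L2_sq_def g_def by (rule esssup_AE)
  then have ae: "AE t in lborel. t \<in> {0<..<T} \<longrightarrow> g t \<le> ennreal (F^2)"
    unfolding F2 by (subst (asm) AE_restrict_space_iff) auto
  define f' where "f' t x = (if g t \<le> ennreal (F^2) \<and> x \<in> \<Omega> then f t x else 0)" for t x
  have f'm[measurable]: "(\<lambda>p. f' (fst p) (snd p)) \<in> borel_measurable (lborel \<Otimes>\<^sub>M lborel)"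
    unfolding f'_def by measurable
  have f'tm: "f' t \<in> borel_measurable lborel" for t
    using measurable_compose[OF measurable_Pair1' f'm, of t] by simp
  have nn: "(\<integral>\<^sup>+x. ennreal ((f' t x)^2) \<partial>lborel) \<le> ennreal (F^2)" for t
  proof (cases "g t \<le> ennreal (F^2)")
    case True
    have "(\<integral>\<^sup>+x. ennreal ((f' t x)^2) \<partial>lborel) = g t"
      unfolding g_def by (rule nn_integral_cong) (use True in \<open>auto simp: f'_def indicator_def\<close>)
    with True show ?thesis by simp
  qed (simp add: f'_def)
  have L: "f' t \<in> L2 lborel" for t
    using f'tm nn[of t] by (auto simp: L2_iff_nn_integral intro: le_less_trans)
  show ?thesis
  proof (rule that[OF L])
    show "(LINT x|lborel. (f' t x)^2) \<le> F^2" for t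
      using nn[of t] unfolding L2_nn_integral[OF L] by (simp add: ennreal_le_iff)
    show "AE t in lborel. t \<in> {0<..<T} \<longrightarrow> (\<forall>x\<in>\<Omega>. f' t x = f t x)"
      using ae by (rule AE_mp) (auto intro!: AE_I2 simp: f'_def)
  qed (rule f'm)
qed

theorem theorem5p5:
  fixes \<Omega> :: "'a::euclidean_space set" and s T :: real
  assumes "lipschitz_domain \<Omega>" and "0 < s" and "s < 1" and "0 < T"
  shows "\<exists>C>0. \<forall>(u0 :: 'a \<Rightarrow> real) f u (K :: nat) U.
           u0 \<in> tildeH s \<Omega> \<longrightarrow> in_Linf_L2 \<Omega> T f \<longrightarrow>
           weak_solution s \<Omega> T u0 f u \<longrightarrow> 0 < K \<longrightarrow> semidiscrete s \<Omega> T K u0 f U \<longrightarrow>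
           L2L2_dist_sq \<Omega> T u (U_tau (T / real K) U)
             \<le> ennreal ((C * (T / real K) *
                   (sqrt (enn2real (gagliardo_sq s u0)) + sqrt (enn2real (Linf_L2_sq \<Omega> T f))))^2)"
proof -
  define c where "c = Cns (real DIM('a)) s"
  have "c \<ge> 0" using Cns_nonneg[OF assms(2,3)] by (simp add: c_def)
  \<comment> \<open>\<open>10 * T\<close> is the coefficient of \<open>F^2\<close> in the error
    estimate, and \<open>c\<close> appears because
    \<open>2 * bilinA s u0 u0 = c * \<gamma>^2\<close>.\<close>
  define C where "C = sqrt (10 * T + c)"
  have "C > 0" using \<open>c \<ge> 0\<close> assms(4) by (simp add: C_def)
  have C2: "C^2 = 10 * T + c" using \<open>c \<ge> 0\<close> assms(4) by (simp add: C_def)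
  have \<Omega>: "\<Omega> \<in> sets borel"
    using assms(1) by (simp add: lipschitz_domain_def)
  note Hs = subsetD[OF tildeH_subset_Hs]
  show ?thesis
  proof (intro exI[of _ C] conjI allI impI \<open>C > 0\<close>)
    fix u0 :: "'a \<Rightarrow> real" and f u :: "real \<Rightarrow> 'a \<Rightarrow> real" and K and U :: "nat \<Rightarrow> 'a \<Rightarrow> real"
    assume u0: "u0 \<in> tildeH s \<Omega>" and f: "in_Linf_L2 \<Omega> T f" and weak: "weak_solution s \<Omega> T u0 f u"
      and K: "0 < K" and semi: "semidiscrete s \<Omega> T K u0 f U"
    define F where "F = sqrt (enn2real (Linf_L2_sq \<Omega> T f))"
    have F: "0 \<le> F" by (simp add: F_def)
    define \<gamma> where "\<gamma> = sqrt (enn2real (gagliardo_sq s u0))"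
    have \<gamma>: "0 \<le> \<gamma>" by (simp add: \<gamma>_def)
    obtain f' where f': "\<And>t. f' t \<in> L2 lborel" "\<And>t. (LINT x|lborel. (f' t x)^2) \<le> F^2"
      "AE t in lborel. t \<in> {0<..<T} \<longrightarrow> (\<forall>x\<in>\<Omega>. f' t x = f t x)"
      "(\<lambda>p. f' (fst p) (snd p)) \<in> borel_measurable (lborel \<Otimes>\<^sub>M lborel)"
      using in_Linf_L2_normalized[OF f \<Omega>] unfolding F_def by blast
    obtain u' where u': "\<And>t. u' t \<in> tildeH s \<Omega>" "AE t in lborel. t \<in> {0<..<T} \<longrightarrow> u' t = u t"
      "(\<lambda>p. u' (fst p) (snd p)) \<in> borel_measurable (lborel \<Otimes>\<^sub>M lborel)"
      using weak_solution_normalized[OF weak u0] by blast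
    \<comment> \<open>The scheme says nothing about \<open>U j\<close> for \<open>j > K\<close>;
      filling these indices with \<open>u0\<close> puts every \<open>V j\<close> into the
      space.\<close>
    define V where "V j = (if j = 0 then u0 else if j \<le> K then U j else u0)" for j
    interpret semidiscrete_heat s T F K "tildeH s \<Omega>" u0 f' u' V
    proof
      show "V k \<in> tildeH s \<Omega>" for k
        using u0 semi by (cases k) (auto simp: V_def semidiscrete_def Let_def)
      have "(\<integral>\<^sup>+t\<in>{0<..<T}. Hs_norm_sq s (u' t) \<partial>lborel) = (\<integral>\<^sup>+t\<in>{0<..<T}. Hs_norm_sq s (u t) \<partial>lborel)"
        by (rule nn_integral_cong_AE, rule AE_mp[OF u'(2)]) (auto intro!: AE_I2 simp: indicator_def)
      then show "(\<integral>\<^sup>+t\<in>{0<..<T}. Hs_norm_sq s (u' t) \<partial>lborel) < \<infinity>"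
        using weak by (simp add: weak_solution_def)
      show "AE t in lborel. t \<in> {0<..<T} \<longrightarrow> (LINT x|lborel. u' t x * \<phi> x) = (LINT x|lborel. u0 x * \<phi> x)
        + (LINT r:{0<..t}|lborel. (LINT x|lborel. f' r x * \<phi> x) - bilinA s (u' r) \<phi>)" if "\<phi> \<in> tildeH s \<Omega>" for \<phi>
        by (rule weak_solution_integrated[OF assms(2-4) \<Omega> u0 weak that u' f'(1,2) F f'(3,4)])
      show "(LINT x|lborel. (V (Suc k) x - V k x) * \<phi> x) + T / real K * bilinA s (V (Suc k)) \<phi>
        = (LINT r:{real k * (T / real K)<..real (Suc k) * (T / real K)}|lborel. (LINT x|lborel. f' r x * \<phi> x))"
        if "k < K" "\<phi> \<in> tildeH s \<Omega>" for k \<phi>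
        using f f' F
        by (intro semidiscrete_scheme_normalized[OF assms(4) \<Omega> u0 semi that V_def]) (auto simp: in_Linf_L2_def)
    qed (use assms K F u' f' in \<open>auto simp: V_def intro: Hs\<close>)
    \<comment> \<open>On (0, T) the index \<open>slot t\<close> lies between 1 and \<open>K\<close>,
      where \<open>V\<close> and \<open>U\<close> coincide, so the replaced initial value is
      invisible; integrating over the whole space only enlarges the distance.\<close>
    have "L2L2_dist_sq \<Omega> T u (U_tau (T / real K) U) \<le> (\<integral>\<^sup>+t\<in>{0<..<T}. (\<integral>\<^sup>+x. ennreal ((err t x)^2) \<partial>lborel) \<partial>lborel)"
      unfolding L2L2_dist_sq_def
    proof (rule nn_integral_mono_AE, rule AE_mp[OF u'(2)], intro AE_I2 impI)
      fix t assume ut: "t \<in> {0<..<T} \<longrightarrow> u' t = u t"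
      show "(\<integral>\<^sup>+x\<in>\<Omega>. ennreal ((u t x - U_tau (T / real K) U t x)^2) \<partial>lborel) * indicator {0<..<T} t
        \<le> (\<integral>\<^sup>+x. ennreal ((err t x)^2) \<partial>lborel) * indicator {0<..<T} t"
      proof (cases "t \<in> {0<..<T}")
        case True
        then obtain k where "k < K" "slot t = Suc k"
          using slot_cases[of t] by auto
        then have "U_tau (T / real K) U t = V (slot t)"
          by (simp add: U_tau_def V_def slot_def \<tau>_def)
        then have "(\<integral>\<^sup>+x\<in>\<Omega>. ennreal ((u t x - U_tau (T / real K) U t x)^2) \<partial>lborel) \<le> (\<integral>\<^sup>+x. ennreal ((err t x)^2) \<partial>lborel)"
          using ut True by (intro nn_integral_mono) (auto simp: err_def indicator_def power2_commute)
        then show ?thesis using True by simp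
      qed simp
    qed
    also have "\<dots> \<le> ennreal (\<tau>^2 * (10 * T * F^2 + 2 * bilinA s u0 u0))"
      by (rule error_estimate)
    also have "\<dots> \<le> ennreal ((C * (T / real K) * (\<gamma> + F))^2)"
    proof (rule ennreal_leI)
      have "2 * bilinA s u0 u0 = c * \<gamma>^2"
        using Hs[OF u0]
        by (simp add: bilinA_eq c_def \<gamma>_def gagliardo_sq_eq L2_nn_integral Hs_gagliardo_L2 power2_eq_square[symmetric])
      \<comment> \<open>The mixed terms added here are nonnegative; the next step uses
        \<open>\<gamma>^2 + F^2 \<le> (\<gamma> + F)^2\<close> to reach the square of the
        sum.\<close>
      then have "10 * T * F^2 + 2 * bilinA s u0 u0 \<le> (10 * T + c) * (\<gamma>^2 + F^2)"
        using \<open>c \<ge> 0\<close> assms(4) by (simp add: algebra_simps)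
      also have "\<dots> \<le> (10 * T + c) * (\<gamma> + F)^2"
        using \<open>c \<ge> 0\<close> assms(4) F \<gamma> by (intro mult_left_mono) (simp_all add: power2_sum)
      finally have "\<tau>^2 * (10 * T * F^2 + 2 * bilinA s u0 u0) \<le> \<tau>^2 * ((10 * T + c) * (\<gamma> + F)^2)"
        by (rule mult_left_mono) simp
      also have "\<dots> = (C * \<tau> * (\<gamma> + F))^2"
        by (simp only: power_mult_distrib C2 mult_ac)
      finally show "\<tau>^2 * (10 * T * F^2 + 2 * bilinA s u0 u0) \<le> (C * (T / real K) * (\<gamma> + F))^2"
        by (simp only: \<tau>_def)
    qed
    finally show "L2L2_dist_sq \<Omega> T u (U_tau (T / real K) U)
      \<le> ennreal ((C * (T / real K) * (sqrt (enn2real (gagliardo_sq s u0)) + sqrt (enn2real (Linf_L2_sq \<Omega> T f))))^2)"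
      by (simp add: \<gamma>_def F_def)
  qed
qed

end
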